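(* Let $g$ be a round metric of unit area on $\mathbb{S}^2$. There exists a sequence $(\mu_\varepsilon)_\varepsilon$ of admissible, balanced probability measures on $\mathbb{S}^2$ such that $\lambda_1(\mu_\varepsilon)\to 8\pi$ as $\varepsilon\to0$ and $$\liminf_{\varepsilon\to0}\ \|\mu_\varepsilon-dv_g\|_{\left(W^{1,2,-\frac12}\right)^*}>0.$$
   Context: $dv_g$ is the area measure of $g$. A nonzero (nonnegative) Radon measure $\mu$ on $\mathbb{S}^2$ is admissible if the identity map on $C^\infty(\mathbb{S}^2)$ extends to a compact operator $W^{1,2}(\mathbb{S}^2,g)\to L^2(\mathbb{S}^2,\mu)$; then $$\lambda_1(\mu)=\lambda_1(\mathbb{S}^2,\mu)=\inf_{E_2}\sup_{0\neq f\in E_2}\frac{\int|\nabla f|_g^2\,dv_g}{\int f^2\,d\mu},$$ the infimum over $2$-dimensional subspaces $E_2\subset C^\infty(\mathbb{S}^2)$ that are also $2$-dimensional in $L^2(\mathbb{S}^2,\mu)$. A measure $\mu$ is balanced if $\int_{\mathbb{S}^2}F\,d\mu=0\in\mathbb{R}^3$, where $F\colon\mathbb{S}^2\to\mathbb{S}^2\subset\mathbb{R}^3$ is the identity map viewed as an $\mathbb{R}^3$-valued function. For $u\in L^1(\mathbb{S}^2,g)$ set $$\|u\|_{L^2(\mathrm{Log}L)^{-\frac12}}:=\inf\Big\{\eta>0:\ \int_{\mathbb{S}^2}\frac{|u/\eta|^2}{\log(2+|u/\eta|)}\,dv_g\leqslant1\Big\}.$$ The Orlicz–Sobolev space $W^{1,2,-\frac12}=W^{1,2,-\frac12}(\mathbb{S}^2,g)$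 is the space of functions with $\|u\|_{W^{1,2,-\frac12}}:=\|u\|_{L^2(\mathrm{Log}L)^{-\frac12}}+\|du\|_{L^2(\mathrm{Log}L)^{-\frac12}}<\infty$, and $\|\cdot\|_{(W^{1,2,-\frac12})^*}$ denotes the dual norm. *)

theory Defs
  imports "HOL-Probability.Probability"
begin

section \<open>Smooth functions and vector fields on the unit sphere\<close>

text \<open>
  The sphere is a subset of \<open>real^3\<close>; functions and vector fields on it are represented by
  functions on all of \<open>real^3\<close> whose values off the sphere are irrelevant.
\<close>

abbreviation S2 :: "(real^3) set" where
  "S2 \<equiv> sphere 0 1"

fun Ck_on :: "nat \<Rightarrow> (real^3) set \<Rightarrow> (real^3 \<Rightarrow> 'b::real_normed_vector) \<Rightarrow> bool" where
  "Ck_on 0 U F \<longleftrightarrow> continuous_on U F"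
| "Ck_on (Suc k) U F \<longleftrightarrow>
     (\<forall>x\<in>U. F differentiable (at x)) \<and>
     (\<forall>v. Ck_on k U (\<lambda>x. frechet_derivative F (at x) v))"

definition smooth_S2 :: "(real^3 \<Rightarrow> 'b::real_normed_vector) \<Rightarrow> bool" where
  "smooth_S2 f \<longleftrightarrow>
     (\<exists>U F. open U \<and> S2 \<subseteq> U \<and> (\<forall>k. Ck_on k U F) \<and> (\<forall>x\<in>S2. F x = f x))"

text \<open>
  For \<open>x\<close> in the sphere, \<open>y \<mapsto> f (sgn y) = f (y / norm y)\<close> is the extension of \<open>f\<close> that is constant
  along rays. Its derivative in a direction tangent at \<open>x\<close> is the differential of \<open>f\<close>, and its
  radial derivative vanishes.
\<close>

definition diff_S2 :: "(real^3 \<Rightarrow> 'b::real_normed_vector) \<Rightarrow> real^3 \<Rightarrow> real^3 \<Rightarrow> 'b" where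
  "diff_S2 f x v = frechet_derivative (\<lambda>y. f (sgn y)) (at x) v"

text \<open>
  The round metric of unit area: the metric induced from \<open>real^3\<close> (of area \<open>4 * pi\<close>), rescaled.
  It is only meant for vectors tangent to the sphere at a common point.
\<close>

definition g_round :: "real^3 \<Rightarrow> real^3 \<Rightarrow> real" where
  "g_round v w = (v \<bullet> w) / (4 * pi)"

definition gnorm :: "real^3 \<Rightarrow> real" where
  "gnorm v = sqrt (g_round v v)"

definition grad_S2 :: "(real^3 \<Rightarrow> real) \<Rightarrow> real^3 \<Rightarrow> real^3" where
  "grad_S2 f x =
     (THE w. w \<bullet> x = 0 \<and> (\<forall>v. v \<bullet> x = 0 \<longrightarrow> g_round w v = diff_S2 f x v))"

definition tangent_field :: "(real^3 \<Rightarrow> real^3) \<Rightarrow> bool" where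
  "tangent_field X \<longleftrightarrow> (\<forall>x\<in>S2. X x \<bullet> x = 0)"

text \<open>
  The Levi-Civita derivative is the tangential part of \<open>diff_S2 X x\<close>, so its trace is the trace of
  \<open>diff_S2 X x\<close> over the tangent plane; the normal direction contributes \<open>0\<close> to the sum below.
  Rescaling the metric by a constant does not change the divergence.
\<close>

definition div_S2 :: "(real^3 \<Rightarrow> real^3) \<Rightarrow> real^3 \<Rightarrow> real" where
  "div_S2 X x = (\<Sum>b\<in>Basis. diff_S2 X x b \<bullet> b)"


section \<open>The area measure of the round metric\<close>

definition spherical :: "real \<times> real \<Rightarrow> real^3" where
  "spherical p = vector [sin (fst p) * cos (snd p), sin (fst p) * sin (snd p), cos (fst p)]"

text \<open>
  In the coordinates \<open>spherical\<close>, which cover the sphere up to a half great circle, the metric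
  \<open>g_round\<close> is \<open>(d\<phi>^2 + sin(\<phi>)^2 d\<theta>^2) / (4 * pi)\<close>, with area density \<open>sin \<phi> / (4 * pi)\<close>.
\<close>

definition dvg :: "(real^3) measure" where
  "dvg = distr
     (density lborel (\<lambda>p. ennreal (indicator ({0<..<pi} \<times> {0<..<2 * pi}) p * sin (fst p) / (4 * pi))))
     (restrict_space borel S2) spherical"


section \<open>Admissible measures and the first eigenvalue\<close>

text \<open>
  The sphere is a compact metric space, so its Radon measures are its finite Borel measures.
\<close>

definition radon_S2 :: "(real^3) measure \<Rightarrow> bool" where
  "radon_S2 \<mu> \<longleftrightarrow> sets \<mu> = sets (restrict_space borel S2) \<and> finite_measure \<mu>"

definition L2 :: "(real^3) measure \<Rightarrow> (real^3 \<Rightarrow> real) set" where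
  "L2 \<mu> = {u \<in> borel_measurable \<mu>. integrable \<mu> (\<lambda>x. (u x)\<^sup>2)}"

text \<open>
  \<open>W^{1,2}\<close> is the completion of the smooth functions for the \<open>W^{1,2}\<close>-norm, realised inside \<open>L^2\<close>:
  \<open>W12_grad u V\<close> says that \<open>u\<close> belongs to it, with (generalised) gradient \<open>V\<close>.
\<close>

definition W12_grad :: "(real^3 \<Rightarrow> real) \<Rightarrow> (real^3 \<Rightarrow> real^3) \<Rightarrow> bool" where
  "W12_grad u V \<longleftrightarrow>
     u \<in> L2 dvg \<and>
     V \<in> borel_measurable dvg \<and> integrable dvg (\<lambda>x. (gnorm (V x))\<^sup>2) \<and>
     (\<exists>\<phi> :: nat \<Rightarrow> real^3 \<Rightarrow> real. (\<forall>n. smooth_S2 (\<phi> n)) \<and>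
        (\<lambda>n. \<integral>x. (\<phi> n x - u x)\<^sup>2 \<partial>dvg) \<longlonglongrightarrow> 0 \<and>
        (\<lambda>n. \<integral>x. (gnorm (grad_S2 (\<phi> n) x - V x))\<^sup>2 \<partial>dvg) \<longlonglongrightarrow> 0)"

definition W12 :: "(real^3 \<Rightarrow> real) set" where
  "W12 = {u. \<exists>V. W12_grad u V}"

definition W12_norm_sq :: "(real^3 \<Rightarrow> real) \<Rightarrow> (real^3 \<Rightarrow> real^3) \<Rightarrow> real" where
  "W12_norm_sq u V = (\<integral>x. (u x)\<^sup>2 \<partial>dvg) + (\<integral>x. (gnorm (V x))\<^sup>2 \<partial>dvg)"

text \<open>
  Operators act on representatives. Linearity and compactness together imply that almost everywhere
  equal functions of \<open>W12\<close> have \<open>\<mu>\<close>-almost everywhere equal images: if \<open>u = 0\<close> in \<open>W12\<close>, the bounded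
  sequence of the \<open>n u\<close> is mapped to that of the \<open>n T(u)\<close>.
\<close>

definition compact_operator_W12_L2 ::
    "(real^3) measure \<Rightarrow> ((real^3 \<Rightarrow> real) \<Rightarrow> (real^3 \<Rightarrow> real)) \<Rightarrow> bool" where
  "compact_operator_W12_L2 \<mu> T \<longleftrightarrow>
     (\<forall>u\<in>W12. T u \<in> L2 \<mu>) \<and>
     (\<forall>u\<in>W12. \<forall>v\<in>W12. \<forall>a b.
        AE x in \<mu>. T (\<lambda>y. a * u y + b * v y) x = a * T u x + b * T v x) \<and>
     (\<forall>u V C. (\<forall>n::nat. W12_grad (u n) (V n) \<and> W12_norm_sq (u n) (V n) \<le> C) \<longrightarrow>
        (\<exists>r w. strict_mono r \<and> w \<in> L2 \<mu> \<and>
           (\<lambda>n. \<integral>x. (T (u (r n)) x - w x)\<^sup>2 \<partial>\<mu>) \<longlonglongrightarrow> 0))"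

definition admissible :: "(real^3) measure \<Rightarrow> bool" where
  "admissible \<mu> \<longleftrightarrow>
     radon_S2 \<mu> \<and> emeasure \<mu> S2 \<noteq> 0 \<and>
     (\<exists>T. compact_operator_W12_L2 \<mu> T \<and>
        (\<forall>\<phi>. smooth_S2 \<phi> \<longrightarrow> (AE x in \<mu>. T \<phi> x = \<phi> x)))"

definition two_dim_subspace :: "(real^3) measure \<Rightarrow> (real^3 \<Rightarrow> real) set \<Rightarrow> bool" where
  "two_dim_subspace \<mu> E \<longleftrightarrow>
     (\<exists>f1 f2. smooth_S2 f1 \<and> smooth_S2 f2 \<and>
        E = {\<lambda>x. a * f1 x + b * f2 x |a b. True} \<and>
        (\<forall>a b. (AE x in \<mu>. a * f1 x + b * f2 x = 0) \<longrightarrow> a = 0 \<and> b = 0))"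

definition lambda1 :: "(real^3) measure \<Rightarrow> ereal" where
  "lambda1 \<mu> =
     (INF E \<in> {E. two_dim_subspace \<mu> E}.
        SUP f \<in> {f \<in> E. \<exists>x\<in>S2. f x \<noteq> 0}.
          ereal ((\<integral>x. (gnorm (grad_S2 f x))\<^sup>2 \<partial>dvg) / (\<integral>x. (f x)\<^sup>2 \<partial>\<mu>)))"

definition balanced :: "(real^3) measure \<Rightarrow> bool" where
  "balanced \<mu> \<longleftrightarrow> (\<integral>x. x \<partial>\<mu>) = (0 :: real^3)"


section \<open>The Orlicz-Sobolev space and its dual\<close>

definition orlicz_norm :: "(real^3 \<Rightarrow> real) \<Rightarrow> ennreal" where
  "orlicz_norm u =
     Inf {ennreal \<eta> |\<eta>. \<eta> > 0 \<and>
       (\<integral>\<^sup>+ x. ennreal (\<bar>u x / \<eta>\<bar>\<^sup>2 / ln (2 + \<bar>u x / \<eta>\<bar>)) \<partial>dvg) \<le> 1}"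

definition weak_grad :: "(real^3 \<Rightarrow> real) \<Rightarrow> (real^3 \<Rightarrow> real^3) \<Rightarrow> bool" where
  "weak_grad u V \<longleftrightarrow>
     integrable dvg u \<and> integrable dvg V \<and> tangent_field V \<and>
     (\<forall>X. smooth_S2 X \<and> tangent_field X \<longrightarrow>
        (\<integral>x. g_round (V x) (X x) \<partial>dvg) = - (\<integral>x. u x * div_S2 X x \<partial>dvg))"

text \<open>
  Weak gradients are unique almost everywhere, so the infimum is over a single value. It is
  infinite if there is no weak gradient.
\<close>

definition orlicz_sobolev_norm :: "(real^3 \<Rightarrow> real) \<Rightarrow> ennreal" where
  "orlicz_sobolev_norm u =
     (INF V \<in> {V. weak_grad u V}. orlicz_norm u + orlicz_norm (\<lambda>x. gnorm (V x)))"

definition orlicz_sobolev :: "(real^3 \<Rightarrow> real) set" where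
  "orlicz_sobolev = {u. orlicz_sobolev_norm u < \<infinity>}"

definition dual_norm :: "((real^3 \<Rightarrow> real) \<Rightarrow> real) \<Rightarrow> ennreal" where
  "dual_norm L = (SUP u \<in> {u. orlicz_sobolev_norm u \<le> 1}. ennreal \<bar>L u\<bar>)"

definition in_dual :: "((real^3 \<Rightarrow> real) \<Rightarrow> real) \<Rightarrow> bool" where
  "in_dual L \<longleftrightarrow>
     (\<forall>u\<in>orlicz_sobolev. \<forall>v\<in>orlicz_sobolev. \<forall>a b.
        L (\<lambda>x. a * u x + b * v x) = a * L u + b * L v) \<and>
     dual_norm L < \<infinity>"

text \<open>
  The difference of two measures, as an element of the dual: the continuous linear functional that
  extends \<open>\<phi> \<mapsto> \<integral> \<phi> d\<mu> - \<integral> \<phi> d\<nu>\<close> from the smooth functions. It is unique on the space since the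
  smooth functions are dense there.
\<close>

definition represents_diff ::
    "((real^3 \<Rightarrow> real) \<Rightarrow> real) \<Rightarrow> (real^3) measure \<Rightarrow> (real^3) measure \<Rightarrow> bool" where
  "represents_diff L \<mu> \<nu> \<longleftrightarrow>
     in_dual L \<and> (\<forall>\<phi>. smooth_S2 \<phi> \<longrightarrow> L \<phi> = (\<integral>x. \<phi> x \<partial>\<mu>) - (\<integral>x. \<phi> x \<partial>\<nu>))"

end

theory Submission
  imports Defs
begin

text \<open>
  The measures have smooth zonal densities that put a mass of order \<open>\<epsilon>\<close> within distance about
  \<open>exp (- 1 / (2 * \<epsilon>))\<close> of the two poles. The capacity of these discs is of order \<open>\<epsilon>\<close> as well, so the
  mass is just small enough not to create an eigenvalue below \<open>8 * pi\<close>. For functions with zero mean on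
  the parallels this follows from Wirtinger's inequality, which controls \<open>f\<^sup>2 / sin\<^sup>2\<close> and hence the added
  density; for zonal functions it follows from an explicit increasing supersolution
  \<open>z * (1 + \<epsilon> * k z)\<close>, where \<open>k\<close> is a logarithmic potential of the poles. On the other hand
  \<open>\<epsilon> * k\<^sup>2\<close> is bounded in the Orlicz-Sobolev space, because the logarithm in the norm gains a factor \<open>\<epsilon>\<close>
  where the gradient is large, and it is of size \<open>1 / \<epsilon>\<close> at the poles; its integral against the
  concentrated mass is bounded below, while its integral over the sphere tends to \<open>0\<close>.
\<close>

section \<open>Calculus on the sphere in spherical coordinates\<close>

text \<open>On the round sphere the eigenvalue 2 (\<open>8 * pi\<close> in the metric of area one)
  belongs to all three coordinates: zonal and non-zonal functions are both extremal at
  \<open>\<epsilon> = 0\<close>, so every estimate has to be sharp up to a vanishing loss. The zonal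
  problem is reduced to the equator: subtracting the value there can only increase the weighted
  square of a function of mean zero, and for the Dirichlet problem left on each hemisphere the
  supersolution is a barrier. The radius is tuned so that \<open>\<epsilon> * k\<close> is of order
  one at the poles. Its upper bound 2 makes the supersolution inequality hold with the coefficient
  \<open>\<epsilon> / 2\<close> of the added density; its lower bound 1/4 near the poles lets the
  pairing with \<open>\<epsilon> * k\<^sup>2\<close> survive the factor \<open>\<epsilon>\<close> of
  the mass. The loss \<open>6 * \<epsilon>\<close> in the eigenvalue is the defect that
  \<open>k\<close> produces away from the poles. Uniformity in \<open>\<epsilon>\<close> matters
  only for the eigenvalue and the lower bound of the dual norm; compactness and finiteness of the
  dual norm concern one \<open>\<epsilon>\<close> at a time, where the density is bounded.\<close>

declare mem_sphere [simp del] mem_sphere_0 [simp del]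

lemma norm_S2: "x \<in> S2 \<Longrightarrow> norm x = 1"
  by (simp add: mem_sphere_0)

text \<open>One continuous derivative is all that the analysis uses. It is required of the extension
  constant along rays, which is an ordinary function on \<open>real^3\<close>, so membership is
  checked by exhibiting a single derivative.\<close>

definition C1_S2 :: "(real^3 \<Rightarrow> 'b::real_normed_vector) \<Rightarrow> bool" where
  "C1_S2 f \<longleftrightarrow> (\<forall>x\<in>S2. ((\<lambda>y. f (sgn y)) has_derivative diff_S2 f x) (at x)) \<and>
     (\<forall>v. continuous_on S2 (\<lambda>x. diff_S2 f x v))"

lemma sgn_S2: "x \<in> S2 \<Longrightarrow> sgn x = x"
  by (simp add: sgn_div_norm norm_S2)

lemma sgn_has_derivative_S2:
  assumes "x \<in> S2"
  shows "(sgn has_derivative (\<lambda>v. v - (x \<bullet> v) *\<^sub>R x)) (at x)"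
proof -
  have nx: "norm x = 1" "x \<noteq> 0" using norm_S2[OF assms] by auto
  have "((\<lambda>y. inverse (norm y) *\<^sub>R y) has_derivative (\<lambda>v. v - (x \<bullet> v) *\<^sub>R x)) (at x)"
    using has_derivative_norm[OF nx(2)]
    by (auto intro!: derivative_eq_intros simp: nx sgn_S2[OF assms] fun_eq_iff inner_commute)
  then show ?thesis by (simp add: sgn_div_norm[abs_def])
qed

lemma C1_S2_I:
  assumes "\<And>x. x \<in> S2 \<Longrightarrow> ((\<lambda>y. f (sgn y)) has_derivative D x) (at x)"
    and "\<And>v. continuous_on S2 (\<lambda>x. D x v)"
  shows "C1_S2 f" "\<And>x. x \<in> S2 \<Longrightarrow> diff_S2 f x = D x"
proof -
  show eq: "diff_S2 f x = D x" if "x \<in> S2" for x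
    using frechet_derivative_at[OF assms(1)[OF that]] by (simp add: diff_S2_def[abs_def])
  show "C1_S2 f"
    unfolding C1_S2_def
  proof (intro conjI ballI allI)
    show "((\<lambda>y. f (sgn y)) has_derivative diff_S2 f x) (at x)" if "x \<in> S2" for x
      using assms(1) eq that by simp
    show "continuous_on S2 (\<lambda>x. diff_S2 f x v)" for v
      using assms(2)[of v] by (rule continuous_on_eq) (simp add: eq)
  qed
qed

text \<open>Only the values of \<open>f\<close> on the sphere are tied to the smooth extension
  \<open>F\<close>, but \<open>sgn\<close> maps every nonzero vector to the sphere. So
  \<open>f (sgn y)\<close> and \<open>F (sgn y)\<close> agree off the origin, and the chain rule
  applies to the latter.\<close>

lemma smooth_S2_C1:
  assumes "smooth_S2 f"
  shows "C1_S2 f"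
proof -
  obtain U F where U: "open U" "S2 \<subseteq> U" and C: "\<And>k. Ck_on k U F" and F: "\<And>x. x \<in> S2 \<Longrightarrow> F x = f x"
    using assms unfolding smooth_S2_def by metis
  have d: "\<And>x. x \<in> U \<Longrightarrow> F differentiable (at x)"
    and c: "\<And>v. continuous_on U (\<lambda>x. frechet_derivative F (at x) v)"
    using C[of "Suc 0"] by auto
  let ?D = "\<lambda>x v. frechet_derivative F (at x) (v - (x \<bullet> v) *\<^sub>R x)"
  show ?thesis
  proof (rule C1_S2_I(1))
    fix x :: "real^3" assume x: "x \<in> S2"
    have dF: "(F has_derivative frechet_derivative F (at x)) (at (sgn x))"
      using d x U by (auto simp: frechet_derivative_works sgn_S2)
    have "((\<lambda>y. F (sgn y)) has_derivative ?D x) (at x)"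
      using has_derivative_compose[OF sgn_has_derivative_S2[OF x] dF] .
    then show "((\<lambda>y. f (sgn y)) has_derivative ?D x) (at x)"
      by (rule has_derivative_transform_within_open[of _ _ _ _ "- {0}"])
        (use norm_S2[OF x] in \<open>auto simp: F norm_sgn mem_sphere_0\<close>)
  next
    fix v :: "real^3"
    have lin: "linear (frechet_derivative F (at x))" if "x \<in> S2" for x
      using d[of x] U that has_derivative_linear by (metis frechet_derivative_works subsetD)
    \<comment> \<open>Continuity of the derivative is known for fixed directions only, while the
      projected direction moves with \<open>x\<close>; hence the expansion in
      \<open>Basis\<close>.\<close>
    have "continuous_on S2 (\<lambda>x. \<Sum>b\<in>Basis. ((v - (x \<bullet> v) *\<^sub>R x) \<bullet> b) *\<^sub>R frechet_derivative F (at x) b)"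
      by (intro continuous_intros continuous_on_subset[OF c U(2)])
    then show "continuous_on S2 (\<lambda>x. ?D x v)"
    proof (rule continuous_on_eq)
      fix x :: "real^3" assume x: "x \<in> S2"
      let ?u = "v - (x \<bullet> v) *\<^sub>R x"
      have "frechet_derivative F (at x) ?u = frechet_derivative F (at x) (\<Sum>b\<in>Basis. (?u \<bullet> b) *\<^sub>R b)"
        by (simp only: euclidean_representation)
      then show "(\<Sum>b\<in>Basis. (?u \<bullet> b) *\<^sub>R frechet_derivative F (at x) b) = ?D x v"
        using lin[OF x] by (simp add: linear_sum linear_cmul)
    qed
  qed
qed

lemma C1_S2_linear:
  assumes "C1_S2 f" "x \<in> S2"
  shows "linear (diff_S2 f x)"
  using assms has_derivative_linear by (auto simp: C1_S2_def)

lemma C1_S2_continuous: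
  assumes "C1_S2 f"
  shows "continuous_on S2 f"
proof -
  have "continuous (at x) (\<lambda>y. f (sgn y))" if "x \<in> S2" for x
    using assms that has_derivative_continuous[of "\<lambda>y. f (sgn y)" "diff_S2 f x" x UNIV] by (auto simp: C1_S2_def)
  then have "continuous_on S2 (\<lambda>y. f (sgn y))"
    by (simp add: continuous_at_imp_continuous_on)
  then show ?thesis by (rule continuous_on_eq) (simp add: sgn_S2)
qed

lemma C1_S2_continuous_compose:
  fixes f :: "real^3 \<Rightarrow> 'b::real_normed_vector"
  assumes f: "C1_S2 f" and X: "continuous_on A X" "\<And>a. a \<in> A \<Longrightarrow> X a \<in> S2" and V: "continuous_on A V"
  shows "continuous_on A (\<lambda>a. diff_S2 f (X a) (V a))"
proof -
  have "continuous_on A (\<lambda>a. \<Sum>b\<in>Basis. (V a \<bullet> b) *\<^sub>R diff_S2 f (X a) b)"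
  proof (intro continuous_intros V)
    fix b :: "real^3"
    have "continuous_on S2 (\<lambda>x. diff_S2 f x b)" using f by (simp add: C1_S2_def)
    then show "continuous_on A (\<lambda>a. diff_S2 f (X a) b)"
      by (rule continuous_on_compose2[OF _ X(1)]) (use X(2) in auto)
  qed
  then show ?thesis
  proof (rule continuous_on_eq)
    fix a assume "a \<in> A"
    then have lin: "linear (diff_S2 f (X a))" using C1_S2_linear[OF f] X by auto
    have "diff_S2 f (X a) (V a) = diff_S2 f (X a) (\<Sum>b\<in>Basis. (V a \<bullet> b) *\<^sub>R b)"
      by (simp only: euclidean_representation)
    then show "(\<Sum>b\<in>Basis. (V a \<bullet> b) *\<^sub>R diff_S2 f (X a) b) = diff_S2 f (X a) (V a)"
      using lin by (simp add: linear_sum linear_cmul)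
  qed
qed

lemma diff_S2_radial:
  assumes "C1_S2 f" "x \<in> S2"
  shows "diff_S2 f x x = 0"
proof -
  have dx: "((\<lambda>t::real. t *\<^sub>R x) has_vector_derivative x) (at 1)"
    by (auto intro!: derivative_eq_intros)
  have "((\<lambda>y. f (sgn y)) has_derivative diff_S2 f x) (at (1 *\<^sub>R x))"
    using assms by (simp add: C1_S2_def)
  then have "(((\<lambda>y. f (sgn y)) \<circ> (\<lambda>t::real. t *\<^sub>R x)) has_vector_derivative diff_S2 f x x) (at 1)"
    using dx by (intro vector_derivative_diff_chain_within[of _ _ _ UNIV, simplified])
      (auto intro: has_derivative_at_withinI)
  moreover have "eventually (\<lambda>t. ((\<lambda>y. f (sgn y)) \<circ> (\<lambda>t::real. t *\<^sub>R x)) t = f x) (nhds 1)"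
    using eventually_nhds_in_open[of "{0<..}" "1::real"]
    by (auto elim!: eventually_mono simp: sgn_scaleR sgn_S2[OF assms(2)])
  ultimately have "((\<lambda>t::real. f x) has_vector_derivative diff_S2 f x x) (at 1)"
    by (subst (asm) has_vector_derivative_cong_ev[where g = "\<lambda>_. f x"]) (auto simp: sgn_S2[OF assms(2)] eventually_mono)
  then show ?thesis
    using vector_derivative_unique_at[OF _ has_vector_derivative_const] by blast
qed

lemma C1_S2_add:
  assumes "C1_S2 f" "C1_S2 h"
  shows "C1_S2 (\<lambda>x. f x + h x)" "\<And>x. x \<in> S2 \<Longrightarrow> diff_S2 (\<lambda>x. f x + h x) x = (\<lambda>v. diff_S2 f x v + diff_S2 h x v)"
  by (rule C1_S2_I[of _ "\<lambda>x v. diff_S2 f x v + diff_S2 h x v"];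
      use assms in \<open>auto simp: C1_S2_def intro!: derivative_eq_intros continuous_intros\<close>)+

lemma C1_S2_scaleR:
  fixes u :: "real^3 \<Rightarrow> real" and X :: "real^3 \<Rightarrow> 'b::real_normed_vector"
  assumes "C1_S2 u" "C1_S2 X"
  shows "C1_S2 (\<lambda>x. u x *\<^sub>R X x)"
    "\<And>x. x \<in> S2 \<Longrightarrow> diff_S2 (\<lambda>x. u x *\<^sub>R X x) x = (\<lambda>v. u x *\<^sub>R diff_S2 X x v + diff_S2 u x v *\<^sub>R X x)"
proof -
  have 1: "((\<lambda>y. u (sgn y) *\<^sub>R X (sgn y)) has_derivative (\<lambda>v. u x *\<^sub>R diff_S2 X x v + diff_S2 u x v *\<^sub>R X x)) (at x)"
    if "x \<in> S2" for x
    using has_derivative_scaleR[of "\<lambda>y. u (sgn y)" _ x UNIV "\<lambda>y. X (sgn y)"] assms that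
    by (auto simp: C1_S2_def sgn_S2)
  have 2: "continuous_on S2 (\<lambda>x. u x *\<^sub>R diff_S2 X x v + diff_S2 u x v *\<^sub>R X x)" for v
    using assms C1_S2_continuous[OF assms(1)] C1_S2_continuous[OF assms(2)]
    by (auto simp: C1_S2_def intro!: continuous_intros)
  show "C1_S2 (\<lambda>x. u x *\<^sub>R X x)"
    "\<And>x. x \<in> S2 \<Longrightarrow> diff_S2 (\<lambda>x. u x *\<^sub>R X x) x = (\<lambda>v. u x *\<^sub>R diff_S2 X x v + diff_S2 u x v *\<^sub>R X x)"
    using C1_S2_I[OF 1 2] by auto
qed

lemma C1_S2_const: "C1_S2 (\<lambda>x. c)" "x \<in> S2 \<Longrightarrow> diff_S2 (\<lambda>x. c) x = (\<lambda>v. 0)"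
  by (rule C1_S2_I[of _ "\<lambda>x v. 0"]; auto)+

lemma C1_S2_lincomb:
  fixes f h :: "real^3 \<Rightarrow> real"
  assumes "C1_S2 f" "C1_S2 h"
  shows "C1_S2 (\<lambda>x. a * f x + b * h x)"
    "x \<in> S2 \<Longrightarrow> diff_S2 (\<lambda>x. a * f x + b * h x) x = (\<lambda>v. a * diff_S2 f x v + b * diff_S2 h x v)"
  using C1_S2_add[OF C1_S2_scaleR(1)[OF C1_S2_const(1) assms(1)] C1_S2_scaleR(1)[OF C1_S2_const(1) assms(2)]]
  using C1_S2_scaleR(2)[OF C1_S2_const(1)[of a] assms(1), of x] C1_S2_scaleR(2)[OF C1_S2_const(1)[of b] assms(2), of x]
  by (auto simp: C1_S2_scaleR(2)[OF C1_S2_const(1) assms(1)] C1_S2_scaleR(2)[OF C1_S2_const(1) assms(2)] C1_S2_const)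

text \<open>The extension is constant along rays, so its full Euclidean gradient is already tangent
  and represents the differential on every vector, not only on tangent ones. The factor
  \<open>4 * pi\<close> undoes the rescaling of the metric.\<close>

lemma grad_S2_eq:
  assumes "C1_S2 f" "x \<in> S2"
  shows "grad_S2 f x = (\<Sum>b\<in>Basis. (4 * pi * diff_S2 f x b) *\<^sub>R b)"
    (is "_ = ?w")
    and "grad_S2 f x \<bullet> x = 0" "\<And>v. g_round (grad_S2 f x) v = diff_S2 f x v"
proof -
  have lin: "linear (diff_S2 f x)" using C1_S2_linear assms by blast
  have g: "g_round ?w v = diff_S2 f x v" for v
  proof -
    have "diff_S2 f x v = diff_S2 f x (\<Sum>b\<in>Basis. (v \<bullet> b) *\<^sub>R b)"
      by (simp only: euclidean_representation)
    also have "\<dots> = (\<Sum>b\<in>Basis. (v \<bullet> b) * diff_S2 f x b)"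
      using lin by (simp add: linear_sum linear_cmul)
    finally show ?thesis
      unfolding g_round_def inner_sum_left sum_divide_distrib by (simp add: inner_commute[of v] mult.commute)
  qed
  have w: "?w \<bullet> x = 0"
    using g[of x] diff_S2_radial[OF assms] by (simp add: g_round_def)
  show eq: "grad_S2 f x = ?w"
    unfolding grad_S2_def
  proof (rule the_equality)
    show "?w \<bullet> x = 0 \<and> (\<forall>v. v \<bullet> x = 0 \<longrightarrow> g_round ?w v = diff_S2 f x v)"
      using g w by auto
    fix w assume w': "w \<bullet> x = 0 \<and> (\<forall>v. v \<bullet> x = 0 \<longrightarrow> g_round w v = diff_S2 f x v)"
    have "(w - ?w) \<bullet> x = 0" using w w' by (simp add: inner_diff_left)
    then have "g_round w (w - ?w) = g_round ?w (w - ?w)" using w' g by auto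
    then have "(w - ?w) \<bullet> (w - ?w) = 0"
      by (simp add: g_round_def inner_diff_left)
    then show "w = ?w" by simp
  qed
  show "grad_S2 f x \<bullet> x = 0" "\<And>v. g_round (grad_S2 f x) v = diff_S2 f x v"
    using eq w g by auto
qed

section \<open>The orthonormal polar frame\<close>

definition e_phi :: "real \<Rightarrow> real \<Rightarrow> real^3" where
  "e_phi s t = vector [cos s * cos t, cos s * sin t, - sin s]"

text \<open>The unit vector along the parallel rather than the coordinate vector
  \<open>sin s *\<^sub>R e_theta t\<close>: it does not degenerate at the poles, and the
  degeneration of the coordinates stays visible as an explicit factor \<open>sin s\<close>.\<close>

definition e_theta :: "real \<Rightarrow> real^3" where
  "e_theta t = vector [- sin t, cos t, 0]"

lemma vector3_inner: "(vector [a,b,c] :: real^3) \<bullet> vector [a',b',c'] = a*a' + b*b' + c*c'"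
  by (simp add: inner_vec_def sum_3)

lemma spherical_S2: "spherical p \<in> S2"
proof -
  have "(sin a * cos b)\<^sup>2 + (sin a * sin b)\<^sup>2 + (cos a)\<^sup>2 = (sin a)\<^sup>2 * ((cos b)\<^sup>2 + (sin b)\<^sup>2) + (cos a)\<^sup>2" for a b :: real
    by (simp add: power_mult_distrib algebra_simps del: sin_cos_squared_add sin_cos_squared_add2)
  then have "spherical p \<bullet> spherical p = 1"
    by (simp add: spherical_def vector3_inner power2_eq_square[symmetric])
  then show ?thesis by (simp add: norm_eq_1 mem_sphere_0)
qed

lemma frame_expansion:
  "v = (v \<bullet> e_phi s t) *\<^sub>R e_phi s t + (v \<bullet> e_theta t) *\<^sub>R e_theta t + (v \<bullet> spherical (s,t)) *\<^sub>R spherical (s,t)"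
proof -
  obtain a b c where v: "v = vector [a,b,c]"
    using forall_vector_3[of "\<lambda>w. v \<noteq> w"] by auto
  have s: "sin s * sin s = 1 - cos s * cos s" "sin t * sin t = 1 - cos t * cos t"
    using sin_squared_eq[of s] sin_squared_eq[of t] by (simp_all add: power2_eq_square)
  have s': "sin s * (sin s * x) = x - cos s * (cos s * x)" "sin t * (sin t * x) = x - cos t * (cos t * x)" for x
    using s by (metis (no_types, opaque_lifting) left_diff_distrib mult.assoc mult_1)+
  show ?thesis
    unfolding v e_phi_def e_theta_def spherical_def fst_conv snd_conv vector3_inner
    by (simp add: vec_eq_iff forall_3) (simp add: algebra_simps s s')
qed

lemma vector3_has_vector_derivative:
  assumes "(a has_real_derivative a') (at x within S)" "(b has_real_derivative b') (at x within S)"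
    "(c has_real_derivative c') (at x within S)"
  shows "((\<lambda>t. vector [a t, b t, c t] :: real^3) has_vector_derivative vector [a', b', c']) (at x within S)"
proof -
  have eq: "(vector [x, y, z] :: real^3) = x *\<^sub>R vector [1,0,0] + y *\<^sub>R vector [0,1,0] + z *\<^sub>R vector [0,0,1]" for x y z :: real
    by (simp add: vec_eq_iff forall_3)
  show ?thesis
    unfolding eq[of "a _"] eq[of a']
    using assms by (auto intro!: derivative_eq_intros)
qed

lemma continuous_on_vector3:
  fixes a b c :: "'a::t2_space \<Rightarrow> real"
  assumes "continuous_on A a" "continuous_on A b" "continuous_on A c"
  shows "continuous_on A (\<lambda>t. vector [a t, b t, c t] :: real^3)"
proof -
  have eq: "(vector [x, y, z] :: real^3) = x *\<^sub>R vector [1,0,0] + y *\<^sub>R vector [0,1,0] + z *\<^sub>R vector [0,0,1]" for x y z :: real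
    by (simp add: vec_eq_iff forall_3)
  show ?thesis
    unfolding eq[of "a _"] using assms by (intro continuous_intros)
qed

lemma spherical_derivs:
  "((\<lambda>s. spherical (s,t)) has_vector_derivative e_phi s t) (at s within A)"
  "((\<lambda>t. spherical (s,t)) has_vector_derivative sin s *\<^sub>R e_theta t) (at t within A)"
proof -
  show "((\<lambda>s. spherical (s,t)) has_vector_derivative e_phi s t) (at s within A)"
    unfolding spherical_def e_phi_def fst_conv snd_conv
    by (rule vector3_has_vector_derivative) (auto intro!: derivative_eq_intros)
  have eq: "sin s *\<^sub>R e_theta t = vector [sin s * - sin t, sin s * cos t, 0]"
    by (simp add: e_theta_def vec_eq_iff forall_3)
  show "((\<lambda>t. spherical (s,t)) has_vector_derivative sin s *\<^sub>R e_theta t) (at t within A)"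
    unfolding eq spherical_def fst_conv snd_conv
    by (rule vector3_has_vector_derivative) (auto intro!: derivative_eq_intros)
qed

lemma frame_derivs:
  "((\<lambda>s. e_phi s t) has_vector_derivative - spherical (s,t)) (at s within A)"
  "(e_theta has_vector_derivative - (sin s *\<^sub>R spherical (s,t) + cos s *\<^sub>R e_phi s t)) (at t within A)"
proof -
  have eq: "- spherical (s,t) = vector [- sin s * cos t, - sin s * sin t, - cos s]"
    by (simp add: spherical_def vec_eq_iff forall_3)
  show "((\<lambda>s. e_phi s t) has_vector_derivative - spherical (s,t)) (at s within A)"
    unfolding e_phi_def eq
    by (rule vector3_has_vector_derivative) (auto intro!: derivative_eq_intros)
  have s: "sin s * (sin s * x) + cos s * (cos s * x) = x" for x
    by (metis (no_types, opaque_lifting) sin_cos_squared_add3 distrib_right mult.assoc mult_1 add.commute)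
  have eq: "- (sin s *\<^sub>R spherical (s,t) + cos s *\<^sub>R e_phi s t) = vector [- cos t, - sin t, 0]"
    by (simp add: spherical_def e_phi_def vec_eq_iff forall_3) (use s[of "cos t"] s[of "sin t"] in \<open>simp add: algebra_simps\<close>)
  show "(e_theta has_vector_derivative - (sin s *\<^sub>R spherical (s,t) + cos s *\<^sub>R e_phi s t)) (at t within A)"
    unfolding e_theta_def eq
    by (rule vector3_has_vector_derivative) (auto intro!: derivative_eq_intros)
qed

lemma continuous_on_spherical[continuous_intros]:
  fixes a b :: "'a::t2_space \<Rightarrow> real"
  assumes "continuous_on A a" "continuous_on A b"
  shows "continuous_on A (\<lambda>x. spherical (a x, b x))"
    "continuous_on A (\<lambda>x. e_phi (a x) (b x))"
  unfolding spherical_def e_phi_def fst_conv snd_conv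
  by (intro continuous_on_vector3 continuous_intros assms)+

lemma continuous_on_e_theta[continuous_intros]:
  fixes b :: "'a::t2_space \<Rightarrow> real"
  assumes "continuous_on A b"
  shows "continuous_on A (\<lambda>x. e_theta (b x))"
  unfolding e_theta_def
  by (intro continuous_on_vector3 continuous_on_minus continuous_on_sin continuous_on_cos continuous_on_const assms)

lemma C1_S2_curve:
  assumes f: "C1_S2 f" and c: "(c has_vector_derivative c') (at t within A)" "\<And>t. c t \<in> S2"
  shows "((\<lambda>t. f (c t)) has_vector_derivative diff_S2 f (c t) c') (at t within A)"
proof -
  have "((\<lambda>y. f (sgn y)) has_derivative diff_S2 f (c t)) (at (c t) within c ` A)"
    using f c(2) by (auto simp: C1_S2_def intro: has_derivative_at_withinI)
  from vector_derivative_diff_chain_within[OF c(1) this]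
  show ?thesis using c(2) by (simp add: o_def sgn_S2)
qed

lemma C1_S2_spherical_derivs:
  assumes f: "C1_S2 f"
  shows "((\<lambda>s. f (spherical (s,t))) has_vector_derivative diff_S2 f (spherical (s,t)) (e_phi s t)) (at s within A)"
    "((\<lambda>t. f (spherical (s,t))) has_vector_derivative sin s *\<^sub>R diff_S2 f (spherical (s,t)) (e_theta t)) (at t within A)"
  using C1_S2_curve[OF f spherical_derivs(1) spherical_S2] C1_S2_curve[OF f spherical_derivs(2) spherical_S2]
    C1_S2_linear[OF f spherical_S2]
  by (auto simp: linear_cmul)

lemma gnorm_sq: "(gnorm v)\<^sup>2 = (v \<bullet> v) / (4 * pi)"
  by (simp add: gnorm_def g_round_def)

lemma gnorm_grad_spherical:
  assumes f: "C1_S2 f"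
  shows "(gnorm (grad_S2 f (spherical (s,t))))\<^sup>2 = 4 * pi * ((diff_S2 f (spherical (s,t)) (e_phi s t))\<^sup>2
     + (diff_S2 f (spherical (s,t)) (e_theta t))\<^sup>2)"
proof -
  let ?x = "spherical (s,t)" let ?w = "grad_S2 f ?x"
  have g: "?w \<bullet> v = 4 * pi * diff_S2 f ?x v" for v
    using grad_S2_eq(3)[OF f spherical_S2, of "(s,t)" v] by (simp add: g_round_def field_simps)
  have "?w \<bullet> ?w = ?w \<bullet> ((?w \<bullet> e_phi s t) *\<^sub>R e_phi s t + (?w \<bullet> e_theta t) *\<^sub>R e_theta t + (?w \<bullet> ?x) *\<^sub>R ?x)"
    using frame_expansion[of ?w s t] by simp
  also have "\<dots> = (?w \<bullet> e_phi s t)\<^sup>2 + (?w \<bullet> e_theta t)\<^sup>2"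
    using grad_S2_eq(2)[OF f spherical_S2, of "(s,t)"] by (simp add: inner_add_right power2_eq_square)
  finally show ?thesis
    unfolding gnorm_sq g by (simp add: power2_eq_square field_simps)
qed

lemma continuous_on_grad:
  assumes f: "C1_S2 f"
  shows "continuous_on S2 (grad_S2 f)"
proof -
  have "continuous_on S2 (\<lambda>x. \<Sum>b\<in>Basis. (4 * pi * diff_S2 f x b) *\<^sub>R b)"
    using f by (auto simp: C1_S2_def intro!: continuous_intros)
  then show ?thesis by (rule continuous_on_eq) (simp add: grad_S2_eq(1)[OF f])
qed

text \<open>The trace over \<open>Basis\<close> becomes a trace over the polar frame by
  \<open>frame_expansion\<close>; the third frame vector is radial and contributes nothing.\<close>

lemma div_S2_spherical:
  assumes X: "C1_S2 X"
  shows "div_S2 X (spherical (s,t)) = diff_S2 X (spherical (s,t)) (e_phi s t) \<bullet> e_phi s t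
     + diff_S2 X (spherical (s,t)) (e_theta t) \<bullet> e_theta t"
proof -
  let ?x = "spherical (s,t)" let ?D = "diff_S2 X ?x"
  have lin: "linear ?D" using C1_S2_linear[OF X spherical_S2] .
  have D: "?D b \<bullet> b = (b \<bullet> e_phi s t) * (?D (e_phi s t) \<bullet> b) + (b \<bullet> e_theta t) * (?D (e_theta t) \<bullet> b)" for b
  proof -
    have "?D b = ?D ((b \<bullet> e_phi s t) *\<^sub>R e_phi s t + (b \<bullet> e_theta t) *\<^sub>R e_theta t + (b \<bullet> ?x) *\<^sub>R ?x)"
      using frame_expansion[of b s t] by simp
    also have "\<dots> = (b \<bullet> e_phi s t) *\<^sub>R ?D (e_phi s t) + (b \<bullet> e_theta t) *\<^sub>R ?D (e_theta t)"
      using lin diff_S2_radial[OF X spherical_S2] by (simp add: linear_add linear_cmul)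
    finally show ?thesis by (simp add: inner_add_left)
  qed
  have "(\<Sum>b\<in>Basis. ?D b \<bullet> b) = (\<Sum>b\<in>Basis. (?D (e_phi s t) \<bullet> b) * (e_phi s t \<bullet> b)) + (\<Sum>b\<in>Basis. (?D (e_theta t) \<bullet> b) * (e_theta t \<bullet> b))"
    unfolding D sum.distrib by (simp add: inner_commute mult.commute)
  then show ?thesis by (simp add: div_S2_def euclidean_inner[symmetric])
qed

lemma continuous_on_div:
  assumes X: "C1_S2 X"
  shows "continuous_on S2 (div_S2 X)"
  unfolding div_S2_def[abs_def]
  using X by (auto simp: C1_S2_def intro!: continuous_intros)

section \<open>Integration over the sphere in polar coordinates\<close>

lemma sets_dvg [simp]: "sets dvg = sets (restrict_space borel S2)"
  and space_dvg [simp]: "space dvg = S2"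
  by (auto simp: dvg_def space_restrict_space)

lemma continuous_on_spherical': "continuous_on A spherical"
  using continuous_on_spherical(1)[of A fst snd] by (simp add: continuous_on_fst continuous_on_snd)

lemma measurable_spherical: "spherical \<in> measurable borel (restrict_space borel S2)"
  by (intro measurable_restrict_space2 borel_measurable_continuous_onI continuous_on_spherical')
    (auto simp: spherical_S2)

lemma borel_measurable_dvg:
  fixes h :: "real^3 \<Rightarrow> 'b::{topological_space}"
  assumes "continuous_on S2 h"
  shows "h \<in> borel_measurable dvg"
proof -
  have "h \<in> borel_measurable (restrict_space borel S2)"
    using assms by (rule borel_measurable_continuous_on_restrict)
  then show ?thesis by (simp cong: measurable_cong_sets)
qed

text \<open>The weight \<open>sin s\<close> is left out so that one notation serves the weighted
  energies and the unweighted integrals of the compactness proof. For continuous integrands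
  \<open>II_swap\<close> exchanges the order of integration.\<close>

definition II :: "(real \<Rightarrow> real \<Rightarrow> 'b::euclidean_space) \<Rightarrow> 'b" where
  "II h = integral {0..pi} (\<lambda>s. integral {0..2*pi} (h s))"

text \<open>The area measure lives on the open parameter rectangle. The boundary is negligible, so
  the Lebesgue integral turns into an iterated Henstock-Kurzweil integral over the closed
  rectangle.\<close>

lemma dvg_integral_vec:
  fixes h :: "real^3 \<Rightarrow> 'b::euclidean_space"
  assumes h: "continuous_on S2 h"
  shows "integrable dvg h"
    and "(\<integral>x. h x \<partial>dvg) = II (\<lambda>s t. (sin s / (4 * pi)) *\<^sub>R h (spherical (s,t)))"
proof -
  let ?R = "{0<..<pi} \<times> {0<..<2 * pi}" let ?C = "cbox (0,0) (pi,2*pi)"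
  let ?k = "\<lambda>p. indicator ?R p * sin (fst p) / (4 * pi)"
  let ?g = "\<lambda>p. (sin (fst p) / (4 * pi)) *\<^sub>R h (spherical p)"
  have R: "?R = box (0,0) (pi,2*pi)" by (auto simp: box_prod)
  have k0: "0 \<le> ?k p" for p by (simp add: indicator_def mem_Times_iff sin_ge_zero)
  have Rm: "?R \<in> sets lborel" unfolding R by simp
  have "(\<lambda>p::real\<times>real. sin (fst p) / (4 * pi)) \<in> borel_measurable borel"
    by (intro borel_measurable_continuous_onI continuous_intros) simp
  then have "(\<lambda>p::real\<times>real. sin (fst p) / (4 * pi)) \<in> borel_measurable lborel"
    unfolding measurable_lborel2 .
  from borel_measurable_times[OF borel_measurable_indicator[OF Rm, where 'b=real] this]
  have k: "?k \<in> borel_measurable lborel"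
    by (simp only: times_divide_eq_right)
  have cg: "continuous_on A ?g" for A
    by (intro continuous_intros continuous_on_compose2[OF h continuous_on_spherical']) (auto simp: spherical_S2)
  have hs: "(\<lambda>p. h (spherical p)) \<in> borel_measurable borel"
    by (intro borel_measurable_continuous_onI continuous_on_compose2[OF h continuous_on_spherical']) (auto simp: spherical_S2)
  have hs': "(\<lambda>p. h (spherical p)) \<in> borel_measurable lborel"
    using hs unfolding measurable_lborel2 .
  have "set_integrable lborel ?C ?g"
    unfolding set_integrable_def by (intro borel_integrable_compact cg) auto
  then have i: "set_integrable lborel ?R ?g"
    unfolding R by (rule set_integrable_subset) (auto simp: box_subset_cbox)
  have hm: "h \<in> borel_measurable (restrict_space borel S2)"
    using h by (rule borel_measurable_continuous_on_restrict)
  have sm: "spherical \<in> measurable (density lborel (\<lambda>p. ennreal (?k p))) (restrict_space borel S2)"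
    by (subst measurable_cong_sets[where M' = borel, OF _ refl]) (simp, rule measurable_spherical)
  have eq: "(\<lambda>p. ?k p *\<^sub>R h (spherical p)) = (\<lambda>p. indicator ?R p *\<^sub>R ?g p)"
    by (rule ext) (simp add: mult.assoc)
  show "integrable dvg h"
    unfolding dvg_def
  proof (subst integrable_distr_eq[OF sm hm], subst integrable_density)
    show "(\<lambda>p. h (spherical p)) \<in> borel_measurable lborel" by (rule hs')
    show "integrable lborel (\<lambda>p. ?k p *\<^sub>R h (spherical p))"
      using i unfolding eq set_integrable_def .
  qed (rule k, rule AE_I2, rule k0)
  have "(\<integral>x. h x \<partial>dvg) = (\<integral>p. h (spherical p) \<partial>density lborel (\<lambda>p. ennreal (?k p)))"
    unfolding dvg_def by (rule integral_distr[OF sm hm])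
  also have "\<dots> = (\<integral>p. ?k p *\<^sub>R h (spherical p) \<partial>lborel)"
    by (rule integral_density[OF hs' k]) (rule AE_I2, rule k0)
  also have "\<dots> = (LINT p:?R|lborel. ?g p)"
    unfolding eq set_lebesgue_integral_def ..
  also have "\<dots> = integral ?R ?g"
    by (rule set_borel_integral_eq_integral(2)[OF i])
  also have "\<dots> = integral ?C ?g"
    unfolding R by (rule integral_open_interval)
  also have "\<dots> = II (\<lambda>s t. (sin s / (4 * pi)) *\<^sub>R h (spherical (s,t)))"
    using integral_prod_continuous[OF cg] by (simp add: II_def)
  finally show "(\<integral>x. h x \<partial>dvg) = II (\<lambda>s t. (sin s / (4 * pi)) *\<^sub>R h (spherical (s,t)))" .
qed

lemma II_cmult: "II (\<lambda>s t. c * h s t) = c * II h" for h :: "real \<Rightarrow> real \<Rightarrow> real"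
  by (simp add: II_def)

lemma dvg_integral:
  fixes h :: "real^3 \<Rightarrow> real"
  assumes h: "continuous_on S2 h"
  shows "(\<integral>x. h x \<partial>dvg) = II (\<lambda>s t. h (spherical (s,t)) * sin s) / (4 * pi)"
  using dvg_integral_vec(2)[OF h] II_cmult[of "1 / (4*pi)" "\<lambda>s t. h (spherical (s,t)) * sin s"]
  by (simp add: mult.commute)

lemma integral_sin_0_pi: "integral {0..pi} sin = 2"
proof -
  have "(sin has_integral (- cos pi - (- cos 0))) {0..pi}"
    by (rule fundamental_theorem_of_calculus)
      (auto intro!: derivative_eq_intros simp flip: has_real_derivative_iff_has_vector_derivative)
  then show ?thesis by (simp add: integral_unique)
qed

lemma II_zonal:
  fixes h :: "real \<Rightarrow> real"
  shows "II (\<lambda>s t. h s) = 2 * pi * integral {0..pi} h"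
  by (simp add: II_def II_cmult)

lemma prob_space_dvg: "prob_space dvg"
proof -
  have one: "(\<integral>x. (1::real) \<partial>dvg) = 1" "integrable dvg (\<lambda>x. 1::real)"
    using dvg_integral[of "\<lambda>x. 1"] dvg_integral_vec(1)[of "\<lambda>x. 1::real"] II_zonal[of sin]
    by (auto simp: integral_sin_0_pi)
  have "emeasure dvg (space dvg) = 1"
    using nn_integral_eq_integral[OF one(2)] one(1) by simp
  then show ?thesis by (rule prob_spaceI)
qed

interpretation dvg: prob_space dvg
  by (rule prob_space_dvg)

lemma II_cong: "(\<And>s t. s \<in> {0..pi} \<Longrightarrow> t \<in> {0..2*pi} \<Longrightarrow> f s t = g s t) \<Longrightarrow> II f = II g"
  unfolding II_def by (rule integral_cong, rule integral_cong) simp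

lemma continuous_on_II_inner:
  fixes f :: "real \<Rightarrow> real \<Rightarrow> 'b::euclidean_space"
  assumes "continuous_on UNIV (\<lambda>p. f (fst p) (snd p))"
  shows "continuous_on A (\<lambda>s. integral {a..b} (f s))"
proof -
  have "continuous_on UNIV (\<lambda>s. integral (cbox a b) (f s))"
    by (rule integral_continuous_on_param)
      (use assms in \<open>auto simp: split_beta intro: continuous_on_subset\<close>)
  then show ?thesis using continuous_on_subset by auto
qed

lemma continuous_on_slice:
  assumes "continuous_on UNIV (\<lambda>p. f (fst p) (snd p))"
  shows "continuous_on A (f s)" "continuous_on A (\<lambda>s. f s t)"
  using continuous_on_compose2[OF assms, of A "\<lambda>t. (s,t)"] continuous_on_compose2[OF assms, of A "\<lambda>s. (s,t)"]
  by (simp_all add: continuous_on_Pair[OF continuous_on_const continuous_on_id] continuous_on_Pair[OF continuous_on_id continuous_on_const])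

lemma continuous_on_swap:
  fixes f :: "real \<Rightarrow> real \<Rightarrow> real"
  assumes "continuous_on UNIV (\<lambda>p. f (fst p) (snd p))"
  shows "continuous_on UNIV (\<lambda>p. f (snd p) (fst p))"
  using continuous_on_compose2[OF assms, of UNIV "\<lambda>p. (snd p, fst p)"]
  by (simp add: continuous_on_Pair continuous_on_fst continuous_on_snd)

lemma II_integrable:
  fixes f :: "real \<Rightarrow> real \<Rightarrow> 'b::euclidean_space"
  assumes "continuous_on UNIV (\<lambda>p. f (fst p) (snd p))"
  shows "f s integrable_on {a..b}" "(\<lambda>s. f s t) integrable_on {a..b}"
    "(\<lambda>s. integral {c..d} (f s)) integrable_on {a..b}"
  using continuous_on_slice[OF assms] continuous_on_II_inner[OF assms]
  by (auto intro: integrable_continuous_interval)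

lemma II_add:
  fixes f g :: "real \<Rightarrow> real \<Rightarrow> 'b::euclidean_space"
  assumes "continuous_on UNIV (\<lambda>p. f (fst p) (snd p))" "continuous_on UNIV (\<lambda>p. g (fst p) (snd p))"
  shows "II (\<lambda>s t. f s t + g s t) = II f + II g"
  unfolding II_def using II_integrable[OF assms(1)] II_integrable[OF assms(2)]
  by (simp add: integral_add)

lemma II_mono:
  fixes f g :: "real \<Rightarrow> real \<Rightarrow> real"
  assumes "continuous_on UNIV (\<lambda>p. f (fst p) (snd p))" "continuous_on UNIV (\<lambda>p. g (fst p) (snd p))"
    and "\<And>s t. s \<in> {0..pi} \<Longrightarrow> t \<in> {0..2*pi} \<Longrightarrow> f s t \<le> g s t"
  shows "II f \<le> II g"
  unfolding II_def using II_integrable[OF assms(1)] II_integrable[OF assms(2)] assms(3)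
  by (intro integral_le) auto

lemma II_swap:
  fixes f :: "real \<Rightarrow> real \<Rightarrow> 'b::euclidean_space"
  assumes "continuous_on UNIV (\<lambda>p. f (fst p) (snd p))"
  shows "II f = integral {0..2*pi} (\<lambda>t. integral {0..pi} (\<lambda>s. f s t))"
  unfolding II_def using integral_swap_continuous[of 0 0 pi "2*pi" f] assms
  by (auto simp: split_beta intro: continuous_on_subset)

section \<open>The divergence theorem and weak gradients\<close>

lemma continuous_on_pullback:
  assumes "continuous_on S2 h"
  shows "continuous_on A (\<lambda>p. h (spherical (fst p, snd p)))"
  by (rule continuous_on_compose2[OF assms continuous_on_spherical(1)])
    (auto intro!: continuous_intros simp: spherical_S2)

lemma continuous_on_diff_frame:
  assumes "C1_S2 f"
  shows "continuous_on A (\<lambda>p. diff_S2 f (spherical (fst p, snd p)) (e_phi (fst p) (snd p)))"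
    "continuous_on A (\<lambda>p. diff_S2 f (spherical (fst p, snd p)) (e_theta (snd p)))"
  by (intro C1_S2_continuous_compose[OF assms] continuous_intros spherical_S2; simp)+

lemma spherical_periodic: "spherical (s, t + 2 * pi) = spherical (s, t)" "e_theta (t + 2 * pi) = e_theta t"
  by (simp_all add: spherical_def e_theta_def)

text \<open>In polar coordinates \<open>sin s\<close> times the divergence is the
  \<open>s\<close>-derivative of \<open>sin s\<close> times the \<open>e_phi\<close>-component plus
  the \<open>t\<close>-derivative of the \<open>e_theta\<close>-component. The first primitive
  vanishes at both poles and the second is periodic.\<close>

lemma integral_div_S2:
  assumes X: "C1_S2 X" "tangent_field X"
  shows "(\<integral>x. div_S2 X x \<partial>dvg) = 0"
proof -
  define y where "y s t = X (spherical (s,t))" for s t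
  define A where "A s t = diff_S2 X (spherical (s,t)) (e_phi s t)" for s t
  define B where "B s t = diff_S2 X (spherical (s,t)) (e_theta t)" for s t
  define a where "a s t = cos s * (y s t \<bullet> e_phi s t) + sin s * (A s t \<bullet> e_phi s t)" for s t
  define b where "b s t = sin s * (B s t \<bullet> e_theta t) - cos s * (y s t \<bullet> e_phi s t)" for s t
  \<comment> \<open>The frame vectors turn towards the normal when differentiated; tangency of
    \<open>X\<close> removes that component.\<close>
  have tan: "y s t \<bullet> spherical (s,t) = 0" for s t
    using X(2) spherical_S2 by (auto simp: tangent_field_def y_def)
  have cy: "continuous_on UNIV (\<lambda>p. y (fst p) (snd p))"
    unfolding y_def by (rule continuous_on_pullback[OF C1_S2_continuous[OF X(1)]])
  have cA: "continuous_on UNIV (\<lambda>p. A (fst p) (snd p))" and cB: "continuous_on UNIV (\<lambda>p. B (fst p) (snd p))"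
    unfolding A_def B_def using continuous_on_diff_frame[OF X(1)] by auto
  have ca: "continuous_on UNIV (\<lambda>p. a (fst p) (snd p))"
    unfolding a_def by (intro continuous_intros cy cA)
  have cb: "continuous_on UNIV (\<lambda>p. b (fst p) (snd p))"
    unfolding b_def by (intro continuous_intros cy cB)
  have da: "((\<lambda>s. sin s * (y s t \<bullet> e_phi s t)) has_vector_derivative a s t) (at s within S)" for s t S
  proof -
    have 1: "((\<lambda>s. y s t) has_vector_derivative A s t) (at s within S)"
      using C1_S2_spherical_derivs(1)[OF X(1)] by (simp add: y_def A_def)
    have "((\<lambda>s. y s t \<bullet> e_phi s t) has_vector_derivative (y s t \<bullet> (- spherical (s,t)) + A s t \<bullet> e_phi s t)) (at s within S)"
      using bounded_bilinear.has_vector_derivative[OF bounded_bilinear_inner 1 frame_derivs(1)] .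
    then have "((\<lambda>s. y s t \<bullet> e_phi s t) has_real_derivative (A s t \<bullet> e_phi s t)) (at s within S)"
      by (simp add: tan has_real_derivative_iff_has_vector_derivative)
    then show ?thesis
      by (auto intro!: derivative_eq_intros simp: a_def simp flip: has_real_derivative_iff_has_vector_derivative)
  qed
  have db: "((\<lambda>t. y s t \<bullet> e_theta t) has_vector_derivative b s t) (at t within S)" for s t S
  proof -
    have 1: "((\<lambda>t. y s t) has_vector_derivative sin s *\<^sub>R B s t) (at t within S)"
      using C1_S2_spherical_derivs(2)[OF X(1)] by (simp add: y_def B_def)
    show ?thesis
      using bounded_bilinear.has_vector_derivative[OF bounded_bilinear_inner 1 frame_derivs(2)[of s]]
      by (simp add: tan b_def inner_add_right inner_diff_right)
  qed
  have 1: "integral {0..pi} (\<lambda>s. a s t) = 0" for t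
  proof (rule integral_unique)
    have "((\<lambda>s. a s t) has_integral (sin pi * (y pi t \<bullet> e_phi pi t) - sin 0 * (y 0 t \<bullet> e_phi 0 t))) {0..pi}"
      by (rule fundamental_theorem_of_calculus) (simp, rule da)
    then show "((\<lambda>s. a s t) has_integral 0) {0..pi}" by simp
  qed
  have 2: "integral {0..2*pi} (b s) = 0" for s
  proof (rule integral_unique)
    have "(b s has_integral (y s (2*pi) \<bullet> e_theta (2*pi) - y s 0 \<bullet> e_theta 0)) {0..2*pi}"
      by (rule fundamental_theorem_of_calculus) (simp, rule db)
    moreover have "y s (2*pi) \<bullet> e_theta (2*pi) = y s 0 \<bullet> e_theta 0"
      using spherical_periodic(1)[of s 0] spherical_periodic(2)[of 0 ] by (simp add: y_def)
    ultimately show "(b s has_integral 0) {0..2*pi}" by simp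
  qed
  have "II (\<lambda>s t. div_S2 X (spherical (s,t)) * sin s) = II (\<lambda>s t. a s t + b s t)"
    by (intro II_cong) (simp add: div_S2_spherical[OF X(1)] a_def b_def A_def B_def algebra_simps)
  also have "\<dots> = II a + II b"
    by (rule II_add[OF ca cb])
  also have "II a = 0"
    by (simp add: II_swap[OF ca] 1)
  also have "II b = 0"
    by (simp add: II_def 2)
  finally show ?thesis
    by (simp add: dvg_integral[OF continuous_on_div[OF X(1)]])
qed

text \<open>Integration by parts is the divergence theorem for the tangent field
  \<open>u x *\<^sub>R X x\<close>.\<close>

lemma weak_grad_smooth:
  assumes u: "C1_S2 u"
  shows "weak_grad u (grad_S2 u)"
  unfolding weak_grad_def
proof (intro conjI allI impI)
  show "integrable dvg u" "integrable dvg (grad_S2 u)"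
    using dvg_integral_vec(1) C1_S2_continuous[OF u] continuous_on_grad[OF u] by auto
  show "tangent_field (grad_S2 u)"
    using grad_S2_eq(2)[OF u] by (simp add: tangent_field_def)
  fix X assume X': "smooth_S2 X \<and> tangent_field X"
  then have X: "C1_S2 X" "tangent_field X" using smooth_S2_C1 by auto
  let ?Y = "\<lambda>x. u x *\<^sub>R X x"
  have Y: "C1_S2 ?Y" "tangent_field ?Y"
    using C1_S2_scaleR(1)[OF u X(1)] X(2) by (auto simp: tangent_field_def)
  have div: "div_S2 ?Y x = g_round (grad_S2 u x) (X x) + u x * div_S2 X x" if "x \<in> S2" for x
  proof -
    have "diff_S2 u x (X x) = diff_S2 u x (\<Sum>b\<in>Basis. (X x \<bullet> b) *\<^sub>R b)"
      by (simp only: euclidean_representation)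
    also have "\<dots> = (\<Sum>b\<in>Basis. diff_S2 u x b * (X x \<bullet> b))"
      using C1_S2_linear[OF u that] by (simp add: linear_sum linear_cmul mult.commute)
    finally show ?thesis
      by (simp add: grad_S2_eq(3)[OF u that] div_S2_def C1_S2_scaleR(2)[OF u X(1) that] inner_add_left sum.distrib
          sum_distrib_left add.commute)
  qed
  have i1: "integrable dvg (\<lambda>x. g_round (grad_S2 u x) (X x))"
    unfolding g_round_def
    by (intro dvg_integral_vec(1) continuous_intros continuous_on_grad[OF u] C1_S2_continuous[OF X(1)]) simp
  have i2: "integrable dvg (\<lambda>x. u x * div_S2 X x)"
    by (intro dvg_integral_vec(1) continuous_intros continuous_on_div[OF X(1)] C1_S2_continuous[OF u])
  have "0 = (\<integral>x. div_S2 ?Y x \<partial>dvg)" using integral_div_S2[OF Y] by simp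
  also have "\<dots> = (\<integral>x. g_round (grad_S2 u x) (X x) + u x * div_S2 X x \<partial>dvg)"
    by (intro Bochner_Integration.integral_cong) (auto simp: div)
  also have "\<dots> = (\<integral>x. g_round (grad_S2 u x) (X x) \<partial>dvg) + (\<integral>x. u x * div_S2 X x \<partial>dvg)"
    using i1 i2 by simp
  finally show "(\<integral>x. g_round (grad_S2 u x) (X x) \<partial>dvg) = - (\<integral>x. u x * div_S2 X x \<partial>dvg)"
    by simp
qed

section \<open>Spectral gap of the weighted sphere\<close>

text \<open>
  If \<open>\<gamma>\<close> satisfies the Riccati inequality, the square \<open>s (v' - \<gamma> v / s)\<^sup>2 \<ge> 0\<close> bounds
  \<open>s v'\<^sup>2 - r v\<^sup>2\<close> from below by the derivative of \<open>P = \<gamma> v\<^sup>2\<close>.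
\<close>

lemma riccati_comparison:
  fixes v v' s r \<gamma> \<gamma>' P :: "real \<Rightarrow> real"
  assumes ab: "a \<le> b"
    and v: "\<And>x. x \<in> {a<..<b} \<Longrightarrow> (v has_real_derivative v' x) (at x)"
    and \<gamma>: "\<And>x. x \<in> {a<..<b} \<Longrightarrow> (\<gamma> has_real_derivative \<gamma>' x) (at x)"
    and P: "continuous_on {a..b} P" "P a = 0" "P b = 0" "\<And>x. x \<in> {a<..<b} \<Longrightarrow> P x = \<gamma> x * (v x)\<^sup>2"
    and s: "\<And>x. x \<in> {a<..<b} \<Longrightarrow> 0 < s x"
    and ric: "\<And>x. x \<in> {a<..<b} \<Longrightarrow> \<gamma>' x + (\<gamma> x)\<^sup>2 / s x + r x \<le> 0"
    and int: "(\<lambda>x. s x * (v' x)\<^sup>2) integrable_on {a..b}" "(\<lambda>x. r x * (v x)\<^sup>2) integrable_on {a..b}"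
  shows "integral {a..b} (\<lambda>x. r x * (v x)\<^sup>2) \<le> integral {a..b} (\<lambda>x. s x * (v' x)\<^sup>2)"
proof -
  \<comment> \<open>At the end points \<open>\<gamma>\<close> may be singular. There
    \<open>?P'\<close> receives the value of the integrand it is compared with, so the pointwise
    inequality is trivial; of \<open>P\<close> only continuity is asked.\<close>
  let ?P' = "\<lambda>x. if x \<in> {a<..<b} then \<gamma>' x * (v x)\<^sup>2 + 2 * \<gamma> x * v x * v' x
    else s x * (v' x)\<^sup>2 - r x * (v x)\<^sup>2"
  have "(?P' has_integral (P b - P a)) {a..b}"
  proof (rule fundamental_theorem_of_calculus_interior[OF ab P(1)])
    fix x assume x: "x \<in> {a<..<b}"
    have "((\<lambda>x. \<gamma> x * (v x)\<^sup>2) has_real_derivative ?P' x) (at x)"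
      using x by (auto intro!: derivative_eq_intros v \<gamma> simp: algebra_simps)
    then have "(P has_real_derivative ?P' x) (at x)"
      by (rule has_field_derivative_transform_within_open[of _ _ _ "{a<..<b}"]) (use x P(4) in auto)
    then show "(P has_vector_derivative ?P' x) (at x)"
      by (simp only: has_real_derivative_iff_has_vector_derivative)
  qed
  then have P': "(?P' has_integral 0) {a..b}" using P by simp
  have "((\<lambda>x. s x * (v' x)\<^sup>2 - r x * (v x)\<^sup>2) has_integral
      (integral {a..b} (\<lambda>x. s x * (v' x)\<^sup>2) - integral {a..b} (\<lambda>x. r x * (v x)\<^sup>2))) {a..b}"
    using int by (intro has_integral_diff) (auto simp: has_integral_integral)
  then have "0 \<le> integral {a..b} (\<lambda>x. s x * (v' x)\<^sup>2) - integral {a..b} (\<lambda>x. r x * (v x)\<^sup>2)"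
  proof (rule has_integral_le[OF P'])
    fix x assume "x \<in> {a..b}"
    show "?P' x \<le> s x * (v' x)\<^sup>2 - r x * (v x)\<^sup>2"
    proof (cases "x \<in> {a<..<b}")
      case True
      have "0 \<le> s x * (v' x - \<gamma> x * v x / s x)\<^sup>2" using s[OF True] by simp
      also have "\<dots> = s x * (v' x)\<^sup>2 - 2 * \<gamma> x * v x * v' x + (\<gamma> x)\<^sup>2 / s x * (v x)\<^sup>2"
        using s[OF True] by (simp add: power2_eq_square field_simps)
      finally have 1: "0 \<le> s x * (v' x)\<^sup>2 - 2 * \<gamma> x * v x * v' x + (\<gamma> x)\<^sup>2 / s x * (v x)\<^sup>2" .
      have "(\<gamma>' x + (\<gamma> x)\<^sup>2 / s x + r x) * (v x)\<^sup>2 \<le> 0"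
        using ric[OF True] by (intro mult_nonpos_nonneg) auto
      then show ?thesis using 1 True by (simp add: algebra_simps)
    qed auto
  qed
  then show ?thesis by simp
qed

text \<open>A square beats a simple zero: \<open>(v x)\<^sup>2 / d x\<close> is \<open>v x\<close>
  times a quotient of difference quotients with a finite limit. This makes the boundary terms
  \<open>\<gamma> * v\<^sup>2\<close> vanish where \<open>\<gamma>\<close> has a simple
  pole.\<close>

lemma tendsto_square_quotient_0:
  fixes v d :: "real \<Rightarrow> real"
  assumes v: "(v has_real_derivative v1) (at a within S)" and d: "(d has_real_derivative d1) (at a within S)"
    and "v a = 0" "d a = 0" "d1 \<noteq> 0"
  shows "((\<lambda>x. (v x)\<^sup>2 / d x) \<longlongrightarrow> 0) (at a within S)"
proof -
  have "((\<lambda>x. v x / (x - a)) \<longlongrightarrow> v1) (at a within S)" "((\<lambda>x. d x / (x - a)) \<longlongrightarrow> d1) (at a within S)"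
    using v d assms by (simp_all add: has_field_derivative_iff)
  then have "((\<lambda>x. (v x / (x - a)) / (d x / (x - a))) \<longlongrightarrow> v1 / d1) (at a within S)"
    using assms by (intro tendsto_intros)
  moreover have "(v \<longlongrightarrow> v a) (at a within S)"
    using DERIV_continuous[OF v] by (simp add: continuous_within)
  ultimately have "((\<lambda>x. v x * ((v x / (x - a)) / (d x / (x - a)))) \<longlongrightarrow> v a * (v1 / d1)) (at a within S)"
    by (rule tendsto_mult[rotated])
  then have "((\<lambda>x. v x * ((v x / (x - a)) / (d x / (x - a)))) \<longlongrightarrow> 0) (at a within S)"
    using assms by simp
  then show ?thesis
    by (rule Lim_transform_eventually) (auto simp: eventually_at_filter power2_eq_square)
qed

text \<open>Riccati comparison with the ground state \<open>sin (x - a)\<close>: its logarithmic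
  derivative \<open>cot (x - a)\<close> satisfies the Riccati inequality with equality, and the
  simple poles at the two ends are absorbed by the zeros of \<open>v\<close>.\<close>

lemma wirtinger_interval:
  fixes v v' :: "real \<Rightarrow> real"
  assumes v: "\<And>x. (v has_real_derivative v' x) (at x)" and v': "continuous_on UNIV v'"
    and 0: "v a = 0" "v (a + pi) = 0"
  shows "integral {a..a+pi} (\<lambda>x. (v x)\<^sup>2) \<le> integral {a..a+pi} (\<lambda>x. (v' x)\<^sup>2)"
proof -
  define P where "P x = cos (x - a) * ((v x)\<^sup>2 / sin (x - a))" for x
  have cv: "continuous_on A v" for A
    using v by (meson DERIV_continuous_on has_field_derivative_at_within)
  have cv': "continuous_on A v'" for A
    using v' by (rule continuous_on_subset) simp
  have sin0: "0 < sin (x - a)" if "x \<in> {a<..<a+pi}" for x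
    using that by (intro sin_gt_zero) auto
  have ends: "(P \<longlongrightarrow> P c) (at c within {a..a+pi})" if c: "c = a \<or> c = a + pi" for c
  proof -
    have "((\<lambda>x. (v x)\<^sup>2 / sin (x - a)) \<longlongrightarrow> 0) (at c within {a..a+pi})"
    proof (rule tendsto_square_quotient_0)
      show "(v has_real_derivative v' c) (at c within {a..a+pi})"
        using v by (rule has_field_derivative_at_within)
      show "((\<lambda>x. sin (x - a)) has_real_derivative cos (c - a)) (at c within {a..a+pi})"
        by (auto intro!: derivative_eq_intros)
    qed (use c 0 in auto)
    moreover have "((\<lambda>x. cos (x - a)) \<longlongrightarrow> cos (c - a)) (at c within {a..a+pi})"
      by (intro tendsto_intros)
    ultimately have "(P \<longlongrightarrow> cos (c - a) * 0) (at c within {a..a+pi})"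
      unfolding P_def by (rule tendsto_mult[rotated])
    then show ?thesis using c 0 by (auto simp: P_def)
  qed
  have "integral {a..a+pi} (\<lambda>x. 1 * (v x)\<^sup>2) \<le> integral {a..a+pi} (\<lambda>x. 1 * (v' x)\<^sup>2)"
  proof (rule riccati_comparison[where \<gamma> = "\<lambda>x. cot (x - a)" and \<gamma>' = "\<lambda>x. - inverse ((sin (x - a))\<^sup>2)" and P = P])
    show "continuous_on {a..a+pi} P"
      unfolding continuous_on_def
    proof
      fix x assume x: "x \<in> {a..a+pi}"
      show "(P \<longlongrightarrow> P x) (at x within {a..a+pi})"
      proof (cases "x = a \<or> x = a + pi")
        case False
        then have "sin (x - a) \<noteq> 0" using sin0[of x] x by auto
        moreover have "isCont v x" using v DERIV_isCont by blast
        ultimately have "isCont P x"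
          unfolding P_def[abs_def] by (intro continuous_intros)
        then show ?thesis by (auto simp: isCont_def intro: tendsto_within_subset)
      qed (rule ends)
    qed
    show "((\<lambda>x. cot (x - a)) has_real_derivative - inverse ((sin (x - a))\<^sup>2)) (at x)" if "x \<in> {a<..<a+pi}" for x
    proof -
      have "((\<lambda>x. x - a) has_real_derivative 1) (at x)"
        by (auto intro!: derivative_eq_intros)
      from DERIV_chain2[OF DERIV_cot this] sin0[OF that] show ?thesis by simp
    qed
    show "- inverse ((sin (x - a))\<^sup>2) + (cot (x - a))\<^sup>2 / 1 + 1 \<le> 0" if "x \<in> {a<..<a+pi}" for x
      using sin0[OF that] cos_squared_eq[of "x - a"] by (simp add: cot_def power_divide field_simps)
    show "P x = cot (x - a) * (v x)\<^sup>2" for x by (simp add: P_def cot_def)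
  qed (use v 0 in \<open>auto simp: P_def intro!: integrable_continuous_interval continuous_intros cv cv'\<close>)
  then show ?thesis by simp
qed

section \<open>Wirtinger's inequality on the circle\<close>

lemma integral_periodic_shift:
  fixes f :: "real \<Rightarrow> real"
  assumes f: "continuous_on UNIV f" and p: "\<And>x. f (x + T) = f x" and T: "0 \<le> t" "t \<le> T"
  shows "integral {t..t+T} f = integral {0..T} f"
proof -
  have i: "f integrable_on {a..b}" for a b
    using f by (intro integrable_continuous_interval) (rule continuous_on_subset, auto)
  have "integral {t..t+T} f = integral {t..T} f + integral {T..t+T} f"
    using T by (intro Henstock_Kurzweil_Integration.integral_combine[symmetric] i) auto
  also have "integral {T..t+T} f = integral {0..t} f"
    using integral_shift_Icc_real[of 0 t f T] p continuous_on_subset[OF f] by (simp add: o_def add.commute)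
  also have "integral {t..T} f + integral {0..t} f = integral {0..T} f"
    using Henstock_Kurzweil_Integration.integral_combine[of 0 t T f] T i by simp
  finally show ?thesis .
qed

text \<open>A point \<open>t\<close> with \<open>h t = h (t + pi)\<close> splits the period into two
  intervals at whose ends \<open>h - h t\<close> vanishes, so the Dirichlet inequality applies on
  both. As \<open>h\<close> has mean zero, subtracting \<open>h t\<close> does not decrease the
  integral of the square.\<close>

lemma wirtinger:
  fixes h h' :: "real \<Rightarrow> real"
  assumes h: "\<And>x. (h has_real_derivative h' x) (at x)" and h': "continuous_on UNIV h'"
    and p: "\<And>x. h (x + 2 * pi) = h x" "\<And>x. h' (x + 2 * pi) = h' x"
    and mean: "integral {0..2*pi} h = 0"
  shows "integral {0..2*pi} (\<lambda>x. (h x)\<^sup>2) \<le> integral {0..2*pi} (\<lambda>x. (h' x)\<^sup>2)"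
proof -
  have ch: "continuous_on A h" for A
    using h by (meson DERIV_continuous_on has_field_derivative_at_within)
  have ch': "continuous_on A h'" for A
    using h' by (rule continuous_on_subset) simp
  let ?d = "\<lambda>x. h x - h (x + pi)"
  \<comment> \<open>Half a period later the difference has changed sign, so it has a zero in
    between.\<close>
  have dpi: "?d pi = - ?d 0" using p(1)[of 0] by simp
  have cd: "continuous_on {0..pi} ?d"
    by (intro continuous_intros continuous_on_compose2[OF ch[of UNIV]]) auto
  have "\<exists>t\<ge>0. t \<le> pi \<and> ?d t = 0"
  proof (cases "?d 0 \<le> 0")
    case True then show ?thesis using IVT'[of ?d 0 0 pi] cd dpi by auto
  next
    case False then show ?thesis using IVT2'[of ?d pi 0 0] cd dpi by auto
  qed
  then obtain t where t: "0 \<le> t" "t \<le> pi" "h t = h (t + pi)" by auto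
  define c where "c = h t"
  let ?v = "\<lambda>x. h x - c"
  have cv: "continuous_on UNIV ?v" by (intro continuous_intros ch)
  have v: "(?v has_real_derivative h' x) (at x)" for x
    by (auto intro!: derivative_eq_intros h)
  have ci: "(\<lambda>x. (?v x)\<^sup>2) integrable_on {a..b}" "(\<lambda>x. (h' x)\<^sup>2) integrable_on {a..b}" for a b
    by (intro integrable_continuous_interval continuous_intros ch ch')+
  have hi: "h integrable_on {a..b}" "(\<lambda>x. (h x)\<^sup>2) integrable_on {a..b}" for a b
    by (intro integrable_continuous_interval continuous_intros ch)+
  have eq: "t + pi + pi = t + 2 * pi" by simp
  have 1: "integral {t..t+pi} (\<lambda>x. (?v x)\<^sup>2) \<le> integral {t..t+pi} (\<lambda>x. (h' x)\<^sup>2)"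
    by (rule wirtinger_interval[OF v h']) (use t in \<open>auto simp: c_def\<close>)
  have 2: "integral {t+pi..t+pi+pi} (\<lambda>x. (?v x)\<^sup>2) \<le> integral {t+pi..t+pi+pi} (\<lambda>x. (h' x)\<^sup>2)"
    by (rule wirtinger_interval[OF v h']) (use t p(1)[of t] in \<open>auto simp: c_def eq\<close>)
  have comb: "integral {t..t+2*pi} f = integral {t..t+pi} f + integral {t+pi..t+pi+pi} f"
    if "\<And>a b. f integrable_on {a..b}" for f :: "real \<Rightarrow> real"
    using Henstock_Kurzweil_Integration.integral_combine[of t "t+pi" "t+pi+pi" f] that by (simp add: eq)
  have "integral {0..2*pi} (\<lambda>x. (?v x)\<^sup>2) = integral {t..t+2*pi} (\<lambda>x. (?v x)\<^sup>2)"
    by (rule integral_periodic_shift[symmetric]) (use t p in \<open>auto intro!: continuous_intros ch\<close>)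
  also have "\<dots> \<le> integral {t..t+2*pi} (\<lambda>x. (h' x)\<^sup>2)"
    unfolding comb[OF ci(1)] comb[OF ci(2)] using 1 2 by simp
  also have "\<dots> = integral {0..2*pi} (\<lambda>x. (h' x)\<^sup>2)"
    by (rule integral_periodic_shift) (use t p in \<open>auto intro!: continuous_intros ch'\<close>)
  finally have 3: "integral {0..2*pi} (\<lambda>x. (?v x)\<^sup>2) \<le> integral {0..2*pi} (\<lambda>x. (h' x)\<^sup>2)" .
  have "integral {0..2*pi} (\<lambda>x. (?v x)\<^sup>2) = integral {0..2*pi} (\<lambda>x. ((h x)\<^sup>2 - 2 * c * h x) + c\<^sup>2)"
    by (intro integral_cong) (simp add: power2_eq_square algebra_simps)
  also have "\<dots> = integral {0..2*pi} (\<lambda>x. (h x)\<^sup>2) - 2 * c * integral {0..2*pi} h + c\<^sup>2 * (2 * pi)"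
    using hi integrable_on_cmult_left[OF hi(1), of "2*c"]
    by (subst integral_add; (subst integral_diff)?) (auto intro!: integrable_diff simp: mult.assoc)
  finally have "integral {0..2*pi} (\<lambda>x. (?v x)\<^sup>2) = integral {0..2*pi} (\<lambda>x. (h x)\<^sup>2) + c\<^sup>2 * (2 * pi)"
    using mean by simp
  moreover have "0 \<le> c\<^sup>2 * (2 * pi)" by simp
  ultimately show ?thesis using 3 by linarith
qed

text \<open>
  The density is a multiple of \<open>dens_N\<close>. As \<open>dens_w \<epsilon> (cos s) = dens_e \<epsilon> + (sin s)\<^sup>2\<close>, the number
  \<open>sqrt (dens_e \<epsilon>)\<close> is the radius of concentration and \<open>dens_k\<close> grows from \<open>0\<close> on the equator to about
  \<open>1 / \<epsilon>\<close> at the poles.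
\<close>

definition dens_e :: "real \<Rightarrow> real" where "dens_e \<epsilon> = exp (- 1 / \<epsilon>)"
definition dens_w :: "real \<Rightarrow> real \<Rightarrow> real" where "dens_w \<epsilon> z = 1 + dens_e \<epsilon> - z\<^sup>2"
definition dens_k :: "real \<Rightarrow> real \<Rightarrow> real" where "dens_k \<epsilon> z = ln ((1 + dens_e \<epsilon>) / dens_w \<epsilon> z)"
definition dens_N :: "real \<Rightarrow> real \<Rightarrow> real" where "dens_N \<epsilon> z = 1 + \<epsilon> / 2 * (dens_e \<epsilon> / (dens_w \<epsilon> z)\<^sup>2)"

section \<open>Bounds for the density and its logarithmic potential\<close>

lemma dens_e_pos: "0 < dens_e \<epsilon>"
  by (simp add: dens_e_def)

lemma dens_e_le_1: "0 < \<epsilon> \<Longrightarrow> dens_e \<epsilon> \<le> 1"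
  by (simp add: dens_e_def)

lemma dens_w_pos: "\<bar>z\<bar> \<le> 1 \<Longrightarrow> 0 < dens_w \<epsilon> z"
  using dens_e_pos[of \<epsilon>] abs_square_le_1[of z] by (simp add: dens_w_def)

lemma dens_w_ge: "\<bar>z\<bar> \<le> 1 \<Longrightarrow> dens_e \<epsilon> \<le> dens_w \<epsilon> z"
  using abs_square_le_1[of z] by (simp add: dens_w_def)

lemma dens_w_cos: "dens_w \<epsilon> (cos s) = dens_e \<epsilon> + (sin s)\<^sup>2"
  by (simp add: dens_w_def sin_squared_eq)

lemma dens_k_nonneg: "\<bar>z\<bar> \<le> 1 \<Longrightarrow> 0 \<le> dens_k \<epsilon> z"
  unfolding dens_k_def using dens_w_pos[of z \<epsilon>] by (intro ln_ge_zero) (simp add: dens_w_def)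

lemma dens_k_le:
  assumes "0 < \<epsilon>" "\<bar>z\<bar> \<le> 1"
  shows "dens_k \<epsilon> z \<le> dens_e \<epsilon> + 1 / \<epsilon>"
proof -
  have "dens_k \<epsilon> z \<le> ln ((1 + dens_e \<epsilon>) / dens_e \<epsilon>)"
    unfolding dens_k_def using dens_w_pos[OF assms(2), of \<epsilon>] dens_w_ge[OF assms(2), of \<epsilon>] dens_e_pos[of \<epsilon>]
    by (intro ln_mono divide_left_mono) auto
  also have "\<dots> = ln (1 + dens_e \<epsilon>) - ln (dens_e \<epsilon>)"
    using dens_e_pos[of \<epsilon>] by (intro ln_divide_pos) auto
  also have "ln (dens_e \<epsilon>) = - 1 / \<epsilon>" by (simp add: dens_e_def)
  also have "ln (1 + dens_e \<epsilon>) \<le> dens_e \<epsilon>"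
    using dens_e_pos[of \<epsilon>] by (intro ln_add_one_self_le_self) simp
  finally show ?thesis by simp
qed

text \<open>This bound is the reason for the exponent \<open>- 1 / \<epsilon>\<close> in
  \<open>dens_e\<close>: at the poles the potential is \<open>1 / \<epsilon>\<close> up to a bounded
  term, so the supersolution stays within a factor 3 of the height \<open>z\<close>.\<close>

lemma eps_dens_k_le:
  assumes "0 < \<epsilon>" "\<epsilon> \<le> 1" "\<bar>z\<bar> \<le> 1"
  shows "\<epsilon> * dens_k \<epsilon> z \<le> 2"
proof -
  have "\<epsilon> * dens_k \<epsilon> z \<le> \<epsilon> * (dens_e \<epsilon> + 1 / \<epsilon>)"
    using assms dens_k_le by (intro mult_left_mono) auto
  also have "\<dots> = \<epsilon> * dens_e \<epsilon> + 1" using assms by (simp add: field_simps)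
  also have "\<epsilon> * dens_e \<epsilon> \<le> 1 * 1"
    using assms dens_e_le_1 by (intro mult_mono) (auto simp: dens_e_def)
  finally show ?thesis by simp
qed

lemma dens_k_deriv [derivative_intros]:
  assumes "0 < dens_w \<epsilon> z"
  shows "(dens_k \<epsilon> has_real_derivative 2 * z / dens_w \<epsilon> z) (at z within A)"
proof -
  have w: "0 < 1 + dens_e \<epsilon> - z\<^sup>2" using assms by (simp add: dens_w_def)
  have e: "0 < 1 + dens_e \<epsilon>" using dens_e_pos[of \<epsilon>] by simp
  have "((\<lambda>z. ln ((1 + dens_e \<epsilon>) / (1 + dens_e \<epsilon> - z\<^sup>2))) has_real_derivative 2 * z / (1 + dens_e \<epsilon> - z\<^sup>2)) (at z within A)"
    using w e by (auto intro!: derivative_eq_intros simp: divide_simps)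
  then show ?thesis
    by (simp add: dens_k_def[abs_def] dens_w_def)
qed

lemma dens_w_deriv [derivative_intros]:
  "(dens_w \<epsilon> has_real_derivative - 2 * z) (at z within A)"
  unfolding dens_w_def[abs_def] by (auto intro!: derivative_eq_intros)

text \<open>
  For \<open>f z = z (1 + \<epsilon> k z)\<close> the left-hand side below, without the term containing \<open>2 - 6 * \<epsilon>\<close>,
  is \<open>((1 - z\<^sup>2) f')' / z\<close>: the odd increasing function \<open>f\<close> is a supersolution for the eigenvalue
  \<open>2 - 6 * \<epsilon>\<close> of the weight \<open>dens_N\<close>.
\<close>

lemma supersolution_ineq:
  assumes \<epsilon>: "0 < \<epsilon>" "\<epsilon> \<le> 1/3" and z: "\<bar>z\<bar> \<le> 1"
  defines "w \<equiv> dens_w \<epsilon> z" and "k \<equiv> dens_k \<epsilon> z"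
  shows "- 2 * (1 + \<epsilon> * (k + 2 * z\<^sup>2 / w)) + (1 - z\<^sup>2) * (\<epsilon> * (6 / w + 4 * z\<^sup>2 / w\<^sup>2))
    + (2 - 6 * \<epsilon>) * dens_N \<epsilon> z * (1 + \<epsilon> * k) \<le> 0"
proof -
  define e where "e = dens_e \<epsilon>"
  have w: "0 < w" "1 - z\<^sup>2 = w - e" "z\<^sup>2 = 1 + e - w"
    using dens_w_pos[OF z] by (auto simp: w_def e_def dens_w_def)
  have e: "0 < e" by (simp add: e_def dens_e_pos)
  have k: "0 \<le> \<epsilon> * k" "\<epsilon> * k \<le> 2"
    using dens_k_nonneg[OF z] eps_dens_k_le[OF _ _ z, of \<epsilon>] \<epsilon> by (auto simp: k_def)
  have N: "dens_N \<epsilon> z = 1 + \<epsilon> / 2 * (e / w\<^sup>2)" by (simp add: dens_N_def e_def w_def)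
  \<comment> \<open>Expressed through \<open>w\<close>, the constant \<open>6 * \<epsilon>\<close>
    produced by the potential cancels against the loss in the eigenvalue. What remains is a term of
    second order and a multiple of the concentrated density.\<close>
  have "- 2 * (1 + \<epsilon> * (k + 2 * z\<^sup>2 / w)) + (1 - z\<^sup>2) * (\<epsilon> * (6 / w + 4 * z\<^sup>2 / w\<^sup>2))
    + (2 - 6 * \<epsilon>) * dens_N \<epsilon> z * (1 + \<epsilon> * k)
    = - 6 * \<epsilon> * (\<epsilon> * k) - \<epsilon> * (e / w\<^sup>2) * (4 * (1 + e) + 2 * w - (1 - 3 * \<epsilon>) * (1 + \<epsilon> * k))"
    unfolding N w(2) unfolding w(3) using w(1) by (simp add: field_simps power2_eq_square)
  also have "\<dots> \<le> 0"
  proof -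
    \<comment> \<open>The added density contributes at most 3 because
      \<open>\<epsilon> * k \<le> 2\<close>, while the smoothed singularity of the potential
      supplies more than 4.\<close>
    have "(1 - 3 * \<epsilon>) * (1 + \<epsilon> * k) \<le> 1 * 3" using \<epsilon> k by (intro mult_mono) auto
    moreover have "0 \<le> 4 * (1 + e) + 2 * w - x" if "x \<le> 1 * 3" for x using e w(1) that by (simp add: algebra_simps)
    ultimately have "0 \<le> 4 * (1 + e) + 2 * w - (1 - 3 * \<epsilon>) * (1 + \<epsilon> * k)" by blast
    then have "0 \<le> \<epsilon> * (e / w\<^sup>2) * (4 * (1 + e) + 2 * w - (1 - 3 * \<epsilon>) * (1 + \<epsilon> * k))"
      using \<epsilon> e by (intro mult_nonneg_nonneg) auto
    moreover have "0 \<le> 6 * \<epsilon> * (\<epsilon> * k)" using \<epsilon> k by simp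
    ultimately show ?thesis by linarith
  qed
  finally show ?thesis .
qed

text \<open>The supersolution is \<open>z * sup_M \<epsilon> z\<close>, and \<open>sup_D\<close> is
  its derivative. The factor \<open>z\<close> is split off because it carries the zero at the
  equator, whereas \<open>sup_M\<close> is positive on the whole interval.\<close>

definition sup_M :: "real \<Rightarrow> real \<Rightarrow> real" where
  "sup_M \<epsilon> z = 1 + \<epsilon> * dens_k \<epsilon> z"
definition sup_D :: "real \<Rightarrow> real \<Rightarrow> real" where
  "sup_D \<epsilon> z = 1 + \<epsilon> * (dens_k \<epsilon> z + 2 * z\<^sup>2 / dens_w \<epsilon> z)"

lemma sup_M_pos: "0 < \<epsilon> \<Longrightarrow> \<bar>z\<bar> \<le> 1 \<Longrightarrow> 0 < sup_M \<epsilon> z"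
  unfolding sup_M_def using dens_k_nonneg[of z \<epsilon>] by (simp add: add_pos_nonneg)

lemma sup_derivs:
  assumes "\<bar>z\<bar> \<le> 1"
  shows "((\<lambda>z. z * sup_M \<epsilon> z) has_real_derivative sup_D \<epsilon> z) (at z within A)"
    "(sup_D \<epsilon> has_real_derivative \<epsilon> * (6 * z / dens_w \<epsilon> z + 4 * z^3 / (dens_w \<epsilon> z)\<^sup>2)) (at z within A)"
  using dens_w_pos[OF assms, of \<epsilon>] assms unfolding sup_M_def[abs_def] sup_D_def[abs_def]
  by (auto intro!: derivative_eq_intros simp: field_simps power2_eq_square power3_eq_cube)

text \<open>
  In the polar angle \<open>s\<close>, \<open>ric_gamma \<epsilon>\<close> is \<open>sin s\<close> times the logarithmic derivative of the supersolution.
\<close>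

definition ric_gamma :: "real \<Rightarrow> real \<Rightarrow> real" where
  "ric_gamma \<epsilon> s = - ((sin s)\<^sup>2 * sup_D \<epsilon> (cos s)) / (cos s * sup_M \<epsilon> (cos s))"

definition ric_gamma' :: "real \<Rightarrow> real \<Rightarrow> real" where
  "ric_gamma' \<epsilon> s = sin s * ((- 2 * cos s * sup_D \<epsilon> (cos s) + (sin s)\<^sup>2 * (\<epsilon> * (6 * cos s / dens_w \<epsilon> (cos s) + 4 * (cos s)^3 / (dens_w \<epsilon> (cos s))\<^sup>2)))
     / (cos s * sup_M \<epsilon> (cos s)) - (sin s)\<^sup>2 * (sup_D \<epsilon> (cos s))\<^sup>2 / (cos s * sup_M \<epsilon> (cos s))\<^sup>2)"

lemma ric_gamma_deriv:
  assumes "0 < \<epsilon>" "cos s \<noteq> 0"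
  shows "(ric_gamma \<epsilon> has_real_derivative ric_gamma' \<epsilon> s) (at s)"
proof -
  let ?z = "cos s"
  have z: "\<bar>?z\<bar> \<le> 1" by simp
  have ne: "?z * sup_M \<epsilon> ?z \<noteq> 0" using assms sup_M_pos[OF assms(1) z] by simp
  have 1: "((\<lambda>s. cos s * sup_M \<epsilon> (cos s)) has_real_derivative sup_D \<epsilon> ?z * (- sin s)) (at s)"
    using DERIV_chain2[OF sup_derivs(1)[OF z] DERIV_cos] .
  have 2: "((\<lambda>s. sup_D \<epsilon> (cos s)) has_real_derivative
      (\<epsilon> * (6 * ?z / dens_w \<epsilon> ?z + 4 * ?z^3 / (dens_w \<epsilon> ?z)\<^sup>2)) * (- sin s)) (at s)"
    using DERIV_chain2[OF sup_derivs(2)[OF z] DERIV_cos] .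
  have 3: "((\<lambda>s. - ((sin s)\<^sup>2 * sup_D \<epsilon> (cos s))) has_real_derivative
     - (2 * sin s * cos s * sup_D \<epsilon> ?z + (sin s)\<^sup>2 * ((\<epsilon> * (6 * ?z / dens_w \<epsilon> ?z + 4 * ?z^3 / (dens_w \<epsilon> ?z)\<^sup>2)) * (- sin s)))) (at s)"
    by (auto intro!: derivative_eq_intros 2 simp: algebra_simps)
  have eq: "(- (2 * S * z * D + S\<^sup>2 * (X * (- S))) * F - - (S\<^sup>2 * D) * (D * (- S))) / (F * F)
     = S * ((- 2 * z * D + S\<^sup>2 * X) / F - S\<^sup>2 * D\<^sup>2 / F\<^sup>2)" if "F \<noteq> 0" for S z D X F :: real
    using that by (simp add: field_simps power2_eq_square)
  show ?thesis
    unfolding ric_gamma_def[abs_def] ric_gamma'_def eq[OF ne, symmetric]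
    by (rule DERIV_divide[OF 3 1 ne])
qed

text \<open>In the Riccati expression of a logarithmic derivative the squares of
  \<open>sup_D\<close> cancel and a factor \<open>cos s\<close> drops out. What remains is
  \<open>sin s / sup_M\<close> times the left-hand side of \<open>supersolution_ineq\<close>, with
  the same sign on both hemispheres.\<close>

lemma ric_gamma_ineq:
  assumes \<epsilon>: "0 < \<epsilon>" "\<epsilon> \<le> 1/3" and s: "0 < sin s" "cos s \<noteq> 0"
  shows "ric_gamma' \<epsilon> s + (ric_gamma \<epsilon> s)\<^sup>2 / sin s + (2 - 6 * \<epsilon>) * dens_N \<epsilon> (cos s) * sin s \<le> 0"
proof -
  let ?z = "cos s"
  have z: "\<bar>?z\<bar> \<le> 1" by simp
  have M: "0 < sup_M \<epsilon> ?z" using sup_M_pos[OF \<epsilon>(1) z] .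
  have w: "0 < dens_w \<epsilon> ?z" using dens_w_pos[OF z] .
  have eq: "S * ((- 2 * z * D + S\<^sup>2 * (E * (6 * z / w + 4 * z^3 / w\<^sup>2))) / (z * M) - S\<^sup>2 * D\<^sup>2 / (z * M)\<^sup>2)
      + (- (S\<^sup>2 * D) / (z * M))\<^sup>2 / S + Q * N * S
    = S / M * (- 2 * D + S\<^sup>2 * (E * (6 / w + 4 * z\<^sup>2 / w\<^sup>2)) + Q * N * M)"
    if "S \<noteq> 0" "z \<noteq> 0" "M \<noteq> 0" "w \<noteq> 0" for S z D E w M Q N :: real
    using that by (simp add: field_simps power2_eq_square power3_eq_cube)
  have "- 2 * sup_D \<epsilon> ?z + (sin s)\<^sup>2 * (\<epsilon> * (6 / dens_w \<epsilon> ?z + 4 * ?z\<^sup>2 / (dens_w \<epsilon> ?z)\<^sup>2))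
     + (2 - 6 * \<epsilon>) * dens_N \<epsilon> ?z * sup_M \<epsilon> ?z \<le> 0"
    using supersolution_ineq[OF \<epsilon> z] by (simp add: sup_D_def sup_M_def sin_squared_eq)
  then have "sin s / sup_M \<epsilon> ?z * (- 2 * sup_D \<epsilon> ?z + (sin s)\<^sup>2 * (\<epsilon> * (6 / dens_w \<epsilon> ?z + 4 * ?z\<^sup>2 / (dens_w \<epsilon> ?z)\<^sup>2))
     + (2 - 6 * \<epsilon>) * dens_N \<epsilon> ?z * sup_M \<epsilon> ?z) \<le> 0"
    using s M by (intro mult_nonneg_nonpos) auto
  then show ?thesis
    unfolding ric_gamma_def ric_gamma'_def using eq[of "sin s" ?z "sup_M \<epsilon> ?z" "dens_w \<epsilon> ?z"] s M w by simp
qed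

section \<open>Zonal functions: comparison on each hemisphere\<close>

lemma continuous_on_dens:
  assumes "continuous_on A f" "\<And>x. x \<in> A \<Longrightarrow> \<bar>f x\<bar> \<le> 1"
  shows "continuous_on A (\<lambda>x. dens_w \<epsilon> (f x))" "continuous_on A (\<lambda>x. dens_k \<epsilon> (f x))"
    "continuous_on A (\<lambda>x. dens_N \<epsilon> (f x))"
proof -
  have ne: "dens_w \<epsilon> (f x) \<noteq> 0" "(1 + dens_e \<epsilon>) / dens_w \<epsilon> (f x) \<noteq> 0" if "x \<in> A" for x
    using dens_w_pos[OF assms(2)[OF that], of \<epsilon>] dens_e_pos[of \<epsilon>] by auto
  show w: "continuous_on A (\<lambda>x. dens_w \<epsilon> (f x))"
    unfolding dens_w_def by (intro continuous_intros assms(1))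
  show "continuous_on A (\<lambda>x. dens_k \<epsilon> (f x))"
    unfolding dens_k_def using ne by (intro continuous_intros w) auto
  show "continuous_on A (\<lambda>x. dens_N \<epsilon> (f x))"
    unfolding dens_N_def using ne by (intro continuous_intros w) auto
qed

text \<open>The boundary terms vanish for different reasons: at the pole \<open>ric_gamma\<close> is
  zero because of its factor \<open>(sin s)\<^sup>2\<close>; at the equator it has a simple pole,
  which the zero of \<open>v\<close> outweighs.\<close>

lemma zonal_half:
  fixes v v' :: "real \<Rightarrow> real"
  assumes \<epsilon>: "0 < \<epsilon>" "\<epsilon> \<le> 1/3"
    and v: "\<And>x. (v has_real_derivative v' x) (at x)" and v': "continuous_on UNIV v'"
    and v0: "v (pi / 2) = 0" and ab: "(a = 0 \<and> b = pi / 2) \<or> (a = pi / 2 \<and> b = pi)"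
  shows "(2 - 6 * \<epsilon>) * integral {a..b} (\<lambda>s. dens_N \<epsilon> (cos s) * (v s)\<^sup>2 * sin s) \<le> integral {a..b} (\<lambda>s. sin s * (v' s)\<^sup>2)"
proof -
  let ?P = "\<lambda>s. ric_gamma \<epsilon> s * (v s)\<^sup>2"
  have cv: "continuous_on A v" for A
    using v by (meson DERIV_continuous_on has_field_derivative_at_within)
  have cv': "continuous_on A v'" for A
    using v' by (rule continuous_on_subset) simp
  have cN: "continuous_on A (\<lambda>s. dens_N \<epsilon> (cos s))" for A
    by (intro continuous_on_dens continuous_intros) simp
  have int: "0 < sin x \<and> cos x \<noteq> 0" if "x \<in> {a<..<b}" for x
  proof -
    have "0 < x" "x < pi" "x < pi / 2 \<or> pi / 2 < x"
      using ab that pi_gt_zero unfolding greaterThanLessThan_iff by linarith+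
    moreover from this have "0 < cos x \<or> 0 < cos (pi - x)"
      using cos_gt_zero_pi[of x] cos_gt_zero_pi[of "pi - x"] by linarith
    ultimately show ?thesis using sin_gt_zero[of x] by auto
  qed
  have pi2: "(?P \<longlongrightarrow> ?P (pi/2)) (at (pi/2) within {a..b})"
  proof -
    let ?d = "\<lambda>s. cos s * sup_M \<epsilon> (cos s)"
    have d: "(?d has_real_derivative sup_D \<epsilon> (cos (pi/2)) * (- sin (pi/2))) (at (pi/2) within {a..b})"
      by (rule has_field_derivative_at_within, rule DERIV_chain2[OF sup_derivs(1) DERIV_cos]) simp
    have "((\<lambda>s. (v s)\<^sup>2 / ?d s) \<longlongrightarrow> 0) (at (pi/2) within {a..b})"
    proof (rule tendsto_square_quotient_0[OF has_field_derivative_at_within[OF v] d v0])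
      show "sup_D \<epsilon> (cos (pi/2)) * (- sin (pi/2)) \<noteq> 0"
        using sup_M_pos[OF \<epsilon>(1), of 0] by (simp add: sup_D_def sup_M_def)
    qed simp
    moreover have "((\<lambda>s. - ((sin s)\<^sup>2 * sup_D \<epsilon> (cos s))) \<longlongrightarrow> - ((sin (pi/2))\<^sup>2 * sup_D \<epsilon> (cos (pi/2)))) (at (pi/2) within {a..b})"
    proof (intro tendsto_intros)
      have "isCont (\<lambda>s. sup_D \<epsilon> (cos s)) (pi/2)"
        by (rule DERIV_isCont[OF DERIV_chain2[OF sup_derivs(2) DERIV_cos]]) simp
      then show "((\<lambda>s. sup_D \<epsilon> (cos s)) \<longlongrightarrow> sup_D \<epsilon> (cos (pi/2))) (at (pi/2) within {a..b})"
        unfolding isCont_def by (rule tendsto_within_subset) simp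
    qed
    ultimately have "((\<lambda>s. - ((sin s)\<^sup>2 * sup_D \<epsilon> (cos s)) * ((v s)\<^sup>2 / ?d s)) \<longlongrightarrow> - ((sin (pi/2))\<^sup>2 * sup_D \<epsilon> (cos (pi/2))) * 0) (at (pi/2) within {a..b})"
      by (rule tendsto_mult[rotated])
    then show ?thesis by (simp add: ric_gamma_def v0)
  qed
  have "integral {a..b} (\<lambda>s. ((2 - 6 * \<epsilon>) * dens_N \<epsilon> (cos s) * sin s) * (v s)\<^sup>2) \<le> integral {a..b} (\<lambda>s. sin s * (v' s)\<^sup>2)"
  proof (rule riccati_comparison[where \<gamma> = "ric_gamma \<epsilon>" and \<gamma>' = "ric_gamma' \<epsilon>" and P = ?P])
    show "a \<le> b" using ab pi_gt_zero by (elim disjE conjE) linarith+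
    show "continuous_on {a..b} ?P"
      unfolding continuous_on_def
    proof
      fix x assume x: "x \<in> {a..b}"
      show "(?P \<longlongrightarrow> ?P x) (at x within {a..b})"
      proof (cases "x = pi/2")
        case False
        \<comment> \<open>Away from the equator, poles included, \<open>cos x\<close> is nonzero and
          \<open>ric_gamma\<close> is differentiable.\<close>
        then have "x = 0 \<or> x = pi \<or> x \<in> {a<..<b}" using x ab by auto
        then have "cos x \<noteq> 0" using int[of x] by (elim disjE) simp_all
        then have "isCont (ric_gamma \<epsilon>) x" using ric_gamma_deriv[OF \<epsilon>(1)] DERIV_isCont by blast
        moreover have "isCont v x" using v DERIV_isCont by blast
        ultimately have "isCont ?P x" by (intro continuous_intros)
        then show ?thesis by (auto simp: isCont_def intro: tendsto_within_subset)
      qed (simp only: pi2)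
    qed
    have "?P 0 = 0" "?P pi = 0" "?P (pi/2) = 0" by (simp_all add: ric_gamma_def v0)
    with ab show "?P a = 0" "?P b = 0" by metis+
    show "(v has_real_derivative v' x) (at x)" for x by (rule v)
    show "(\<lambda>s. sin s * (v' s)\<^sup>2) integrable_on {a..b}"
      "(\<lambda>s. (2 - 6 * \<epsilon>) * dens_N \<epsilon> (cos s) * sin s * (v s)\<^sup>2) integrable_on {a..b}"
      by (intro integrable_continuous_interval continuous_intros cv cv' cN)+
  next
    fix x assume "x \<in> {a<..<b}"
    then have x: "0 < sin x" "cos x \<noteq> 0" using int by auto
    show "(ric_gamma \<epsilon> has_real_derivative ric_gamma' \<epsilon> x) (at x)"
      by (rule ric_gamma_deriv[OF \<epsilon>(1) x(2)])
    show "0 < sin x" by (rule x(1))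
    show "ric_gamma' \<epsilon> x + (ric_gamma \<epsilon> x)\<^sup>2 / sin x + (2 - 6 * \<epsilon>) * dens_N \<epsilon> (cos x) * sin x \<le> 0"
      by (rule ric_gamma_ineq[OF \<epsilon> x])
  qed simp
  moreover have "integral {a..b} (\<lambda>s. ((2 - 6 * \<epsilon>) * dens_N \<epsilon> (cos s) * sin s) * (v s)\<^sup>2)
     = (2 - 6 * \<epsilon>) * integral {a..b} (\<lambda>s. dens_N \<epsilon> (cos s) * (v s)\<^sup>2 * sin s)"
    by (subst integral_mult_right[symmetric]) (simp add: mult_ac)
  ultimately show ?thesis by simp
qed

text \<open>Subtracting the value at the equator gives a Dirichlet problem on each hemisphere. For a
  function of weighted mean zero this adds a nonnegative multiple of the total weight to the
  weighted square, so the inequality for the shifted function implies the one for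
  \<open>u\<close>.\<close>

lemma zonal_gap:
  fixes u u' :: "real \<Rightarrow> real"
  assumes \<epsilon>: "0 < \<epsilon>" "\<epsilon> \<le> 1/3"
    and u: "\<And>x. (u has_real_derivative u' x) (at x)" and u': "continuous_on UNIV u'"
    and mean: "integral {0..pi} (\<lambda>s. dens_N \<epsilon> (cos s) * u s * sin s) = 0"
  shows "(2 - 6 * \<epsilon>) * integral {0..pi} (\<lambda>s. dens_N \<epsilon> (cos s) * (u s)\<^sup>2 * sin s) \<le> integral {0..pi} (\<lambda>s. sin s * (u' s)\<^sup>2)"
proof -
  define c where "c = u (pi/2)"
  let ?v = "\<lambda>s. u s - c" and ?N = "\<lambda>s. dens_N \<epsilon> (cos s)"
  have v: "(?v has_real_derivative u' x) (at x)" for x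
    by (auto intro!: derivative_eq_intros u)
  have cu: "continuous_on A u" for A
    using u by (meson DERIV_continuous_on has_field_derivative_at_within)
  have cu': "continuous_on A u'" for A
    using u' by (rule continuous_on_subset) simp
  have cN: "continuous_on A ?N" for A
    by (intro continuous_on_dens continuous_intros) simp
  have comb: "integral {0..pi} f = integral {0..pi/2} f + integral {pi/2..pi} f"
    if "\<And>a b. f integrable_on {a..b}" for f :: "real \<Rightarrow> real"
    using Henstock_Kurzweil_Integration.integral_combine[of 0 "pi/2" pi f] that by simp
  have i: "(\<lambda>s. ?N s * (?v s)\<^sup>2 * sin s) integrable_on {a..b}" "(\<lambda>s. sin s * (u' s)\<^sup>2) integrable_on {a..b}"
    "(\<lambda>s. ?N s * (u s)\<^sup>2 * sin s) integrable_on {a..b}" "(\<lambda>s. ?N s * u s * sin s) integrable_on {a..b}"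
    "(\<lambda>s. ?N s * sin s) integrable_on {a..b}" for a b
    by (intro integrable_continuous_interval continuous_intros cu cu' cN)+
  have v0: "?v (pi/2) = 0" by (simp add: c_def)
  have 1: "(2 - 6 * \<epsilon>) * integral {0..pi} (\<lambda>s. ?N s * (?v s)\<^sup>2 * sin s) \<le> integral {0..pi} (\<lambda>s. sin s * (u' s)\<^sup>2)"
    unfolding comb[OF i(1)] comb[OF i(2)] distrib_left
    by (intro add_mono zonal_half[OF \<epsilon> v u' v0]) auto
  have "integral {0..pi} (\<lambda>s. ?N s * (?v s)\<^sup>2 * sin s)
     = integral {0..pi} (\<lambda>s. (?N s * (u s)\<^sup>2 * sin s - 2 * c * (?N s * u s * sin s)) + c\<^sup>2 * (?N s * sin s))"
    by (intro integral_cong) (simp add: power2_eq_square algebra_simps)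
  also have "\<dots> = integral {0..pi} (\<lambda>s. ?N s * (u s)\<^sup>2 * sin s) - 2 * c * integral {0..pi} (\<lambda>s. ?N s * u s * sin s)
      + c\<^sup>2 * integral {0..pi} (\<lambda>s. ?N s * sin s)"
    using i by (subst integral_add; (subst integral_diff)?) (auto intro!: integrable_diff integrable_on_mult_right)
  finally have 2: "integral {0..pi} (\<lambda>s. ?N s * (?v s)\<^sup>2 * sin s) = integral {0..pi} (\<lambda>s. ?N s * (u s)\<^sup>2 * sin s)
      + c\<^sup>2 * integral {0..pi} (\<lambda>s. ?N s * sin s)"
    by (simp add: mean)
  have "0 \<le> integral {0..pi} (\<lambda>s. ?N s * sin s)"
    using \<epsilon> dens_e_pos[of \<epsilon>]
    by (intro integral_nonneg i) (auto simp: dens_N_def intro!: mult_nonneg_nonneg add_nonneg_nonneg sin_ge_zero)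
  then have "integral {0..pi} (\<lambda>s. ?N s * (u s)\<^sup>2 * sin s) \<le> integral {0..pi} (\<lambda>s. ?N s * (?v s)\<^sup>2 * sin s)"
    unfolding 2 by simp
  then have "(2 - 6 * \<epsilon>) * integral {0..pi} (\<lambda>s. ?N s * (u s)\<^sup>2 * sin s)
     \<le> (2 - 6 * \<epsilon>) * integral {0..pi} (\<lambda>s. ?N s * (?v s)\<^sup>2 * sin s)"
    using \<epsilon> by (intro mult_left_mono) auto
  then show ?thesis using 1 by linarith
qed

section \<open>Splitting off the means over the parallels\<close>

lemma DERIV_integral_param:
  fixes f f' :: "real \<Rightarrow> real \<Rightarrow> real"
  assumes f: "\<And>s t. ((\<lambda>s. f s t) has_real_derivative f' s t) (at s)"
    and cf: "continuous_on UNIV (\<lambda>p. f (fst p) (snd p))"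
    and cf': "continuous_on UNIV (\<lambda>p. f' (fst p) (snd p))"
  shows "((\<lambda>s. integral {a..b} (f s)) has_real_derivative integral {a..b} (f' s)) (at s)"
proof -
  have "((\<lambda>s. integral (cbox a b) (f s)) has_real_derivative integral (cbox a b) (f' s)) (at s within UNIV)"
    by (rule leibniz_rule_field_derivative)
      (use f II_integrable(1)[OF cf] cf' in \<open>auto simp: split_beta intro: continuous_on_subset\<close>)
  then show ?thesis by simp
qed

lemma integral_square_minus_mean:
  fixes f :: "real \<Rightarrow> real"
  assumes "continuous_on {0..2*pi} f" and m: "m = integral {0..2*pi} f / (2*pi)"
  shows "integral {0..2*pi} (\<lambda>t. (f t - m)\<^sup>2) = integral {0..2*pi} (\<lambda>t. (f t)\<^sup>2) - 2 * pi * m\<^sup>2"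
proof -
  have i: "f integrable_on {0..2*pi}" "(\<lambda>t. (f t)\<^sup>2) integrable_on {0..2*pi}"
    by (intro integrable_continuous_interval continuous_intros assms)+
  have "integral {0..2*pi} (\<lambda>t. (f t - m)\<^sup>2) = integral {0..2*pi} (\<lambda>t. ((f t)\<^sup>2 - 2 * m * f t) + m\<^sup>2)"
    by (intro integral_cong) (simp add: power2_eq_square algebra_simps)
  also have "\<dots> = integral {0..2*pi} (\<lambda>t. (f t)\<^sup>2) - 2 * m * integral {0..2*pi} f + m\<^sup>2 * (2 * pi)"
    using i integrable_on_mult_right[OF i(1), of "2*m"]
    by (subst integral_add; (subst integral_diff)?) (auto intro!: integrable_diff)
  also have "integral {0..2*pi} f = 2 * pi * m" using m by simp
  finally show ?thesis by (simp add: power2_eq_square algebra_simps)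
qed

text \<open>The pointwise inequality is asked in the interior only, because it is going to come from
  a division by \<open>sin s\<close>.\<close>

lemma integral_0_pi_mono:
  fixes f g :: "real \<Rightarrow> real"
  assumes "continuous_on {0..pi} f" "continuous_on {0..pi} g" "\<And>s. s \<in> {0<..<pi} \<Longrightarrow> f s \<le> g s"
  shows "integral {0..pi} f \<le> integral {0..pi} g"
proof -
  have "f integrable_on {0<..<pi}" "g integrable_on {0<..<pi}"
    using assms(1,2) by (auto simp: integrable_on_open_interval_real intro: integrable_continuous_interval)
  then have "integral {0<..<pi} f \<le> integral {0<..<pi} g" using assms(3) by (intro integral_le) auto
  then show ?thesis by (simp add: integral_open_interval_real)
qed

text \<open>Along each parallel \<open>y\<close> is its mean \<open>u\<close> plus a remainder, and
  both sides split accordingly. The means are covered by \<open>zonal_gap\<close>. For the remainder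
  two bounds of the same integral, one from \<open>s\<close>-derivatives and one from Wirtinger's
  inequality, add up to the sharp constant 2, and the concentrated density costs only a factor
  \<open>1 + \<epsilon>\<close>.\<close>

lemma weighted_gap_coordinates:
  fixes y p q :: "real \<Rightarrow> real \<Rightarrow> real"
  assumes \<epsilon>: "0 < \<epsilon>" "\<epsilon> \<le> 1/3"
    and cy: "continuous_on UNIV (\<lambda>x. y (fst x) (snd x))"
    and cp: "continuous_on UNIV (\<lambda>x. p (fst x) (snd x))"
    and cq: "continuous_on UNIV (\<lambda>x. q (fst x) (snd x))"
    and ys: "\<And>s t. ((\<lambda>s. y s t) has_real_derivative p s t) (at s)"
    and yt: "\<And>s t. ((\<lambda>t. y s t) has_real_derivative sin s * q s t) (at t)"
    and per: "\<And>s t. y s (t + 2 * pi) = y s t" "\<And>s t. q s (t + 2 * pi) = q s t"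
    and mean: "II (\<lambda>s t. dens_N \<epsilon> (cos s) * y s t * sin s) = 0"
  shows "(2 - 6 * \<epsilon>) * II (\<lambda>s t. dens_N \<epsilon> (cos s) * (y s t)\<^sup>2 * sin s) \<le> II (\<lambda>s t. ((p s t)\<^sup>2 + (q s t)\<^sup>2) * sin s)"
proof -
  let ?J = "{0..2*pi}" and ?N = "\<lambda>s. dens_N \<epsilon> (cos s)"
  \<comment> \<open>\<open>H\<close> and \<open>P\<close> measure the deviation of \<open>y\<close>
    and of its \<open>s\<close>-derivative from their means over the parallel; \<open>Q\<close>
    needs no centering because \<open>u\<close> does not depend on \<open>t\<close>.\<close>
  define u where "u s = integral ?J (y s) / (2*pi)" for s
  define u' where "u' s = integral ?J (p s) / (2*pi)" for s
  define H where "H s = integral ?J (\<lambda>t. (y s t - u s)\<^sup>2)" for s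
  define H' where "H' s = integral ?J (\<lambda>t. 2 * (y s t - u s) * (p s t - u' s))" for s
  define P where "P s = integral ?J (\<lambda>t. (p s t - u' s)\<^sup>2)" for s
  define Q where "Q s = integral ?J (\<lambda>t. (q s t)\<^sup>2)" for s
  have cu: "continuous_on A u" and cu': "continuous_on A u'" for A
    unfolding u_def u'_def by (intro continuous_intros continuous_on_II_inner cy cp; simp)+
  have cuf: "continuous_on UNIV (\<lambda>x. u (fst x))" and cuf': "continuous_on UNIV (\<lambda>x. u' (fst x))"
    by (rule continuous_on_compose2[OF cu[of UNIV]] continuous_on_compose2[OF cu'[of UNIV]]; auto intro!: continuous_intros)+
  note sl = continuous_on_slice(1)[OF cy] continuous_on_slice(1)[OF cp] continuous_on_slice(1)[OF cq]
  have cH: "continuous_on A H" and cH': "continuous_on A H'" and cP: "continuous_on A P" and cQ: "continuous_on A Q" for A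
    unfolding H_def H'_def P_def Q_def
    by (intro continuous_on_II_inner continuous_intros cy cp cq cuf cuf')+
  have cN: "continuous_on A ?N" for A
    by (intro continuous_on_dens continuous_intros) simp
  have du: "(u has_real_derivative u' s) (at s)" for s
    unfolding u_def[abs_def] u'_def
    by (intro DERIV_cdivide DERIV_integral_param ys cy cp)
  have dH: "(H has_real_derivative H' s) (at s)" for s
    unfolding H_def[abs_def] H'_def
    by (rule DERIV_integral_param) (auto intro!: derivative_eq_intros ys du continuous_intros cy cp cuf cuf')
  have mean0: "integral ?J (\<lambda>t. y s t - u s) = 0" for s
    by (subst integral_diff[OF integrable_continuous_interval[OF sl(1)] integrable_const_ivl]) (simp add: u_def)
  have wirt: "H s \<le> (sin s)\<^sup>2 * Q s" for s
  proof -
    have "H s \<le> integral ?J (\<lambda>t. (sin s * q s t)\<^sup>2)"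
      unfolding H_def
    proof (rule wirtinger)
      show "((\<lambda>t. y s t - u s) has_real_derivative sin s * q s t) (at t)" for t
        by (auto intro!: derivative_eq_intros yt)
      show "continuous_on UNIV (\<lambda>t. sin s * q s t)" by (intro continuous_intros sl)
    qed (use per mean0 in auto)
    then show ?thesis by (simp add: Q_def power_mult_distrib)
  qed
  have H0: "0 \<le> H s" and Q0: "0 \<le> Q s" for s
    unfolding H_def Q_def by (intro integral_nonneg integrable_continuous_interval continuous_intros sl; simp)+
  have Hpole: "H 0 = 0" "H pi = 0" using wirt[of 0] wirt[of pi] H0[of 0] H0[of pi] by auto
  \<comment> \<open>The square integrated here vanishes for the extremal functions
    \<open>sin s * cos t\<close> and \<open>sin s * sin t\<close>, so the estimate is sharp.
    Wirtinger's inequality then replaces \<open>H\<close> by \<open>Q\<close>, and one factor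
    \<open>sin s\<close> is cancelled.\<close>
  have key: "cos s * H' s \<le> sin s * (P s + (cos s)\<^sup>2 * Q s)" if s: "s \<in> {0<..<pi}" for s
  proof -
    have i: "(\<lambda>t. (p s t - u' s)\<^sup>2) integrable_on ?J" "(\<lambda>t. 2 * (y s t - u s) * (p s t - u' s)) integrable_on ?J"
      "(\<lambda>t. (y s t - u s)\<^sup>2) integrable_on ?J" "(\<lambda>t. (sin s * (p s t - u' s) - cos s * (y s t - u s))\<^sup>2) integrable_on ?J"
      by (intro integrable_continuous_interval continuous_intros sl)+
    have "0 \<le> integral ?J (\<lambda>t. (sin s * (p s t - u' s) - cos s * (y s t - u s))\<^sup>2)"
      by (intro integral_nonneg i) simp
    also have "\<dots> = integral ?J (\<lambda>t. ((sin s)\<^sup>2 * (p s t - u' s)\<^sup>2 - sin s * cos s * (2 * (y s t - u s) * (p s t - u' s)))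
        + (cos s)\<^sup>2 * (y s t - u s)\<^sup>2)"
      by (intro integral_cong) (simp add: power2_eq_square algebra_simps)
    also have "\<dots> = integral ?J (\<lambda>t. (sin s)\<^sup>2 * (p s t - u' s)\<^sup>2) - integral ?J (\<lambda>t. sin s * cos s * (2 * (y s t - u s) * (p s t - u' s)))
        + integral ?J (\<lambda>t. (cos s)\<^sup>2 * (y s t - u s)\<^sup>2)"
      by (subst integral_add; (subst integral_diff)?) (intro refl integrable_diff integrable_on_mult_right i)+
    also have "\<dots> = (sin s)\<^sup>2 * P s - sin s * cos s * H' s + (cos s)\<^sup>2 * H s"
      unfolding P_def H'_def H_def by (simp only: integral_mult_right)
    also have "(cos s)\<^sup>2 * H s \<le> (cos s)\<^sup>2 * ((sin s)\<^sup>2 * Q s)"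
      by (intro mult_left_mono wirt) simp
    finally have "sin s * (cos s * H' s) \<le> sin s * (sin s * (P s + (cos s)\<^sup>2 * Q s))"
      by (simp add: power2_eq_square algebra_simps)
    then show ?thesis using s sin_gt_zero[of s] by simp
  qed
  have i: "(\<lambda>s. sin s * H s) integrable_on {0..pi}" "(\<lambda>s. sin s * P s) integrable_on {0..pi}"
     "(\<lambda>s. sin s * Q s) integrable_on {0..pi}" "(\<lambda>s. sin s * (P s + (cos s)\<^sup>2 * Q s)) integrable_on {0..pi}"
     "(\<lambda>s. sin s * (u' s)\<^sup>2) integrable_on {0..pi}" "(\<lambda>s. ?N s * H s * sin s) integrable_on {0..pi}"
     "(\<lambda>s. ?N s * (u s)\<^sup>2 * sin s) integrable_on {0..pi}"
    by (intro integrable_continuous_interval continuous_intros cH cP cQ cu' cu cN)+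
  \<comment> \<open>The function \<open>cos s * H s\<close> is zero at both poles, so integrating
    its derivative trades \<open>sin s * H s\<close> for \<open>cos s * H' s\<close>.\<close>
  have "((\<lambda>s. cos s * H' s - sin s * H s) has_integral (cos pi * H pi - cos 0 * H 0)) {0..pi}"
  proof (rule fundamental_theorem_of_calculus)
    show "((\<lambda>s. cos s * H s) has_vector_derivative cos s * H' s - sin s * H s) (at s within {0..pi})" for s
      unfolding has_real_derivative_iff_has_vector_derivative[symmetric]
      by (auto intro!: derivative_eq_intros has_field_derivative_at_within[OF dH])
  qed simp
  then have "integral {0..pi} (\<lambda>s. cos s * H' s - sin s * H s) = 0" by (simp add: Hpole integral_unique)
  moreover have "integral {0..pi} (\<lambda>s. cos s * H' s - sin s * H s) \<le> integral {0..pi} (\<lambda>s. sin s * (P s + (cos s)\<^sup>2 * Q s) - sin s * H s)"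
    by (rule integral_0_pi_mono) (use key in \<open>auto intro!: continuous_intros cH cH' cP cQ\<close>)
  moreover have "\<dots> = integral {0..pi} (\<lambda>s. sin s * (P s + (cos s)\<^sup>2 * Q s)) - integral {0..pi} (\<lambda>s. sin s * H s)"
    by (rule integral_diff[OF i(4,1)])
  ultimately have A: "integral {0..pi} (\<lambda>s. sin s * H s) \<le> integral {0..pi} (\<lambda>s. sin s * (P s + (cos s)\<^sup>2 * Q s))"
    by simp
  have B: "integral {0..pi} (\<lambda>s. sin s * H s) \<le> integral {0..pi} (\<lambda>s. sin s * ((sin s)\<^sup>2 * Q s))"
    by (rule integral_0_pi_mono) (auto intro!: continuous_intros cH cQ mult_left_mono wirt sin_ge_zero)
  \<comment> \<open>The two bounds carry the weights \<open>(cos s)\<^sup>2\<close> and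
    \<open>(sin s)\<^sup>2\<close> on \<open>Q\<close>, so together they make up exactly the energy
    of the remainder.\<close>
  have AB: "integral {0..pi} (\<lambda>s. sin s * (P s + (cos s)\<^sup>2 * Q s)) + integral {0..pi} (\<lambda>s. sin s * ((sin s)\<^sup>2 * Q s))
    = integral {0..pi} (\<lambda>s. sin s * P s) + integral {0..pi} (\<lambda>s. sin s * Q s)"
  proof -
    have "integral {0..pi} (\<lambda>s. sin s * (P s + (cos s)\<^sup>2 * Q s)) + integral {0..pi} (\<lambda>s. sin s * ((sin s)\<^sup>2 * Q s))
     = integral {0..pi} (\<lambda>s. sin s * (P s + (cos s)\<^sup>2 * Q s) + sin s * ((sin s)\<^sup>2 * Q s))"
      by (intro integral_add[symmetric] integrable_continuous_interval continuous_intros cP cQ)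
    also have "\<dots> = integral {0..pi} (\<lambda>s. sin s * P s + sin s * Q s)"
      by (intro integral_cong) (simp add: cos_squared_eq algebra_simps)
    also have "\<dots> = integral {0..pi} (\<lambda>s. sin s * P s) + integral {0..pi} (\<lambda>s. sin s * Q s)"
      by (rule integral_add[OF i(2,3)])
    finally show ?thesis .
  qed
  define Ep where "Ep = integral {0..pi} (\<lambda>s. sin s * P s)"
  define Eq where "Eq = integral {0..pi} (\<lambda>s. sin s * Q s)"
  have Ep0: "0 \<le> Ep"
    unfolding Ep_def P_def
    by (intro integral_nonneg integrable_continuous_interval continuous_intros continuous_on_II_inner cp cuf' mult_nonneg_nonneg)
      (auto simp: sin_ge_zero intro!: integrable_continuous_interval continuous_intros sl)
  have Eq0: "0 \<le> Eq"
    unfolding Eq_def using Q0 by (intro integral_nonneg i) (auto simp: sin_ge_zero)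
  have half: "2 * integral {0..pi} (\<lambda>s. sin s * H s) \<le> Ep + Eq"
    using A B AB by (simp add: Ep_def Eq_def)
  \<comment> \<open>Near the poles the peak of the density is compensated by the factor
    \<open>(sin s)\<^sup>2\<close> from Wirtinger's inequality, since
    \<open>dens_e \<epsilon>\<close> and \<open>(sin s)\<^sup>2\<close> are both at most
    \<open>dens_w \<epsilon> (cos s)\<close>.\<close>
  have NH: "integral {0..pi} (\<lambda>s. ?N s * H s * sin s) \<le> integral {0..pi} (\<lambda>s. sin s * H s) + \<epsilon> / 2 * Eq"
  proof -
    have "integral {0..pi} (\<lambda>s. ?N s * H s * sin s) \<le> integral {0..pi} (\<lambda>s. sin s * H s + \<epsilon> / 2 * (sin s * Q s))"
    proof (rule integral_0_pi_mono)
      fix s assume s: "s \<in> {0<..<pi}"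
      then have sin: "0 < sin s" by (simp add: sin_gt_zero)
      let ?w = "dens_w \<epsilon> (cos s)"
      have w: "0 < ?w" "dens_e \<epsilon> \<le> ?w" "(sin s)\<^sup>2 \<le> ?w"
        using dens_w_pos[of "cos s" \<epsilon>] dens_w_ge[of "cos s" \<epsilon>] dens_e_pos[of \<epsilon>] by (auto simp: dens_w_cos)
      have "dens_e \<epsilon> / ?w\<^sup>2 * H s \<le> dens_e \<epsilon> / ?w\<^sup>2 * ((sin s)\<^sup>2 * Q s)"
        using wirt[of s] dens_e_pos[of \<epsilon>] by (intro mult_left_mono) auto
      also have "\<dots> = (dens_e \<epsilon> * (sin s)\<^sup>2 / ?w\<^sup>2) * Q s" by simp
      also have "\<dots> \<le> 1 * Q s"
      proof (intro mult_right_mono Q0)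
        have "dens_e \<epsilon> * (sin s)\<^sup>2 \<le> ?w * ?w" using w dens_e_pos[of \<epsilon>] by (intro mult_mono) auto
        then show "dens_e \<epsilon> * (sin s)\<^sup>2 / ?w\<^sup>2 \<le> 1" using w by (simp add: power2_eq_square)
      qed
      finally have "\<epsilon> / 2 * (dens_e \<epsilon> / ?w\<^sup>2 * H s) \<le> \<epsilon> / 2 * Q s"
        using \<epsilon> by (intro mult_left_mono) auto
      then have "?N s * H s \<le> H s + \<epsilon> / 2 * Q s"
        by (simp add: dens_N_def algebra_simps)
      then have "?N s * H s * sin s \<le> (H s + \<epsilon> / 2 * Q s) * sin s"
        using sin by (intro mult_right_mono) auto
      then show "?N s * H s * sin s \<le> sin s * H s + \<epsilon> / 2 * (sin s * Q s)"
        by (simp add: algebra_simps)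
    qed (intro continuous_intros cN cH cQ)+
    also have "\<dots> = integral {0..pi} (\<lambda>s. sin s * H s) + integral {0..pi} (\<lambda>s. \<epsilon> / 2 * (sin s * Q s))"
      by (intro integral_add i integrable_on_mult_right)
    finally show ?thesis by (simp only: Eq_def integral_mult_right)
  qed
  have perp: "(2 - 6 * \<epsilon>) * integral {0..pi} (\<lambda>s. ?N s * H s * sin s) \<le> Ep + Eq"
  proof -
    have "integral {0..pi} (\<lambda>s. ?N s * H s * sin s) \<le> (1 + \<epsilon>) / 2 * (Ep + Eq)"
    proof -
      have "0 \<le> \<epsilon> * Ep" using Ep0 \<epsilon> by simp
      then show ?thesis using NH half by (simp add: algebra_simps add_divide_distrib)
    qed
    \<comment> \<open>The product \<open>(2 - 6 * \<epsilon>) * (1 + \<epsilon>) / 2\<close> stays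
      below 1: the loss forced by the zonal part also pays for the factor
      \<open>1 + \<epsilon>\<close>.\<close>
    then have "(2 - 6 * \<epsilon>) * integral {0..pi} (\<lambda>s. ?N s * H s * sin s) \<le> (2 - 6 * \<epsilon>) * ((1 + \<epsilon>) / 2 * (Ep + Eq))"
      using \<epsilon> by (intro mult_left_mono) auto
    also have "\<dots> = (1 - 2 * \<epsilon> - 3 * \<epsilon>\<^sup>2) * (Ep + Eq)"
      by (simp add: field_simps power2_eq_square)
    also have "\<dots> \<le> 1 * (Ep + Eq)"
      using \<epsilon> Ep0 Eq0 zero_le_power2[of \<epsilon>] by (intro mult_right_mono add_nonneg_nonneg) linarith+
    finally show ?thesis by simp
  qed
  have zon: "(2 - 6 * \<epsilon>) * integral {0..pi} (\<lambda>s. ?N s * (u s)\<^sup>2 * sin s) \<le> integral {0..pi} (\<lambda>s. sin s * (u' s)\<^sup>2)"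
  proof (rule zonal_gap[OF \<epsilon> du cu'])
    have "integral ?J (\<lambda>t. ?N s * y s t * sin s) = 2 * pi * (?N s * u s * sin s)" for s
      by (simp add: u_def)
    then have "2 * pi * integral {0..pi} (\<lambda>s. ?N s * u s * sin s) = 0"
      using mean by (simp only: II_def integral_mult_right)
    then show "integral {0..pi} (\<lambda>s. ?N s * u s * sin s) = 0" by simp
  qed
  have y2: "integral ?J (\<lambda>t. (y s t)\<^sup>2) = H s + 2 * pi * (u s)\<^sup>2" for s
    using integral_square_minus_mean[OF sl(1) u_def[of s]] by (simp add: H_def)
  have p2: "integral ?J (\<lambda>t. (p s t)\<^sup>2) = P s + 2 * pi * (u' s)\<^sup>2" for s
    using integral_square_minus_mean[OF sl(2) u'_def[of s]] by (simp add: P_def)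
  have "II (\<lambda>s t. ?N s * (y s t)\<^sup>2 * sin s) = integral {0..pi} (\<lambda>s. ?N s * H s * sin s + 2 * pi * (?N s * (u s)\<^sup>2 * sin s))"
  proof -
    have "integral ?J (\<lambda>t. ?N s * (y s t)\<^sup>2 * sin s) = ?N s * (H s + 2 * pi * (u s)\<^sup>2) * sin s" for s
      unfolding y2[symmetric] by simp
    then show ?thesis unfolding II_def by (simp add: algebra_simps)
  qed
  also have "\<dots> = integral {0..pi} (\<lambda>s. ?N s * H s * sin s) + integral {0..pi} (\<lambda>s. 2 * pi * (?N s * (u s)\<^sup>2 * sin s))"
    by (intro integral_add i integrable_on_mult_right)
  finally have Y: "II (\<lambda>s t. ?N s * (y s t)\<^sup>2 * sin s) = integral {0..pi} (\<lambda>s. ?N s * H s * sin s) + 2 * pi * integral {0..pi} (\<lambda>s. ?N s * (u s)\<^sup>2 * sin s)"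
    by (simp only: integral_mult_right)
  have pq: "integral ?J (\<lambda>t. ((p s t)\<^sup>2 + (q s t)\<^sup>2) * sin s) = sin s * P s + sin s * Q s + 2 * pi * (sin s * (u' s)\<^sup>2)" for s
  proof -
    have "integral ?J (\<lambda>t. (p s t)\<^sup>2 + (q s t)\<^sup>2) = integral ?J (\<lambda>t. (p s t)\<^sup>2) + Q s"
      unfolding Q_def by (intro integral_add integrable_continuous_interval continuous_intros sl)
    moreover have "integral ?J (\<lambda>t. ((p s t)\<^sup>2 + (q s t)\<^sup>2) * sin s) = integral ?J (\<lambda>t. (p s t)\<^sup>2 + (q s t)\<^sup>2) * sin s"
      by simp
    ultimately show ?thesis unfolding p2 by (simp add: algebra_simps)
  qed
  have "II (\<lambda>s t. ((p s t)\<^sup>2 + (q s t)\<^sup>2) * sin s) = integral {0..pi} (\<lambda>s. sin s * P s + sin s * Q s + 2 * pi * (sin s * (u' s)\<^sup>2))"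
    unfolding II_def by (simp only: pq)
  also have "\<dots> = integral {0..pi} (\<lambda>s. sin s * P s + sin s * Q s) + integral {0..pi} (\<lambda>s. 2 * pi * (sin s * (u' s)\<^sup>2))"
    by (intro integral_add i integrable_add integrable_on_mult_right)
  also have "integral {0..pi} (\<lambda>s. sin s * P s + sin s * Q s) = Ep + Eq"
    unfolding Ep_def Eq_def by (intro integral_add i)
  finally have E: "II (\<lambda>s t. ((p s t)\<^sup>2 + (q s t)\<^sup>2) * sin s) = Ep + Eq + 2 * pi * integral {0..pi} (\<lambda>s. sin s * (u' s)\<^sup>2)"
    by (simp only: integral_mult_right)
  have "2 * pi * ((2 - 6 * \<epsilon>) * integral {0..pi} (\<lambda>s. ?N s * (u s)\<^sup>2 * sin s)) \<le> 2 * pi * integral {0..pi} (\<lambda>s. sin s * (u' s)\<^sup>2)"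
    using zon by (intro mult_left_mono) auto
  then show ?thesis
    unfolding Y E distrib_left using perp by (simp add: algebra_simps)
qed

lemma continuous_on_dens_S2:
  "continuous_on S2 (\<lambda>x::real^3. dens_N \<epsilon> (x $ 3))" "continuous_on S2 (\<lambda>x::real^3. dens_w \<epsilon> (x $ 3))"
  "continuous_on S2 (\<lambda>x::real^3. dens_k \<epsilon> (x $ 3))"
  using component_le_norm_cart[of _ "3::3"] norm_S2
  by (intro continuous_on_dens continuous_intros; metis)+

lemma spherical_3: "spherical (s,t) $ 3 = cos s"
  by (simp add: spherical_def)

text \<open>In two dimensions the Dirichlet integral does not feel the rescaling of the metric,
  while the area measure carries \<open>1 / (4 * pi)\<close>. This is where the eigenvalue 2 of the
  unit sphere becomes \<open>8 * pi\<close>.\<close>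

lemma weighted_gap:
  assumes \<epsilon>: "0 < \<epsilon>" "\<epsilon> \<le> 1/3" and f: "C1_S2 f"
    and mean: "(\<integral>x. dens_N \<epsilon> (x $ 3) * f x \<partial>dvg) = 0"
  shows "4 * pi * (2 - 6 * \<epsilon>) * (\<integral>x. dens_N \<epsilon> (x $ 3) * (f x)\<^sup>2 \<partial>dvg) \<le> (\<integral>x. (gnorm (grad_S2 f x))\<^sup>2 \<partial>dvg)"
proof -
  have cf: "continuous_on S2 f" by (rule C1_S2_continuous[OF f])
  define y where "y s t = f (spherical (s,t))" for s t
  define p where "p s t = diff_S2 f (spherical (s,t)) (e_phi s t)" for s t
  define q where "q s t = diff_S2 f (spherical (s,t)) (e_theta t)" for s t
  have E: "(\<integral>x. (gnorm (grad_S2 f x))\<^sup>2 \<partial>dvg) = II (\<lambda>s t. ((p s t)\<^sup>2 + (q s t)\<^sup>2) * sin s)"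
  proof -
    have "continuous_on S2 (\<lambda>x. (gnorm (grad_S2 f x))\<^sup>2)"
      unfolding gnorm_sq by (intro continuous_intros continuous_on_grad[OF f]) simp
    from dvg_integral[OF this] show ?thesis
      using II_cmult[of "4*pi" "\<lambda>s t. ((p s t)\<^sup>2 + (q s t)\<^sup>2) * sin s"]
      by (simp add: gnorm_grad_spherical[OF f] p_def q_def mult.assoc)
  qed
  have M: "(\<integral>x. dens_N \<epsilon> (x $ 3) * f x \<partial>dvg) = II (\<lambda>s t. dens_N \<epsilon> (cos s) * y s t * sin s) / (4 * pi)"
    by (subst dvg_integral) (auto intro!: continuous_intros continuous_on_dens_S2 cf simp: spherical_3 y_def)
  have N: "(\<integral>x. dens_N \<epsilon> (x $ 3) * (f x)\<^sup>2 \<partial>dvg) = II (\<lambda>s t. dens_N \<epsilon> (cos s) * (y s t)\<^sup>2 * sin s) / (4 * pi)"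
    by (subst dvg_integral) (auto intro!: continuous_intros continuous_on_dens_S2 cf simp: spherical_3 y_def)
  have "(2 - 6 * \<epsilon>) * II (\<lambda>s t. dens_N \<epsilon> (cos s) * (y s t)\<^sup>2 * sin s) \<le> II (\<lambda>s t. ((p s t)\<^sup>2 + (q s t)\<^sup>2) * sin s)"
  proof (rule weighted_gap_coordinates[OF \<epsilon>])
    show "II (\<lambda>s t. dens_N \<epsilon> (cos s) * y s t * sin s) = 0" using mean M by simp
    show "continuous_on UNIV (\<lambda>x. y (fst x) (snd x))"
      unfolding y_def by (rule continuous_on_pullback[OF cf])
    show "continuous_on UNIV (\<lambda>x. p (fst x) (snd x))" "continuous_on UNIV (\<lambda>x. q (fst x) (snd x))"
      unfolding p_def q_def by (rule continuous_on_diff_frame[OF f])+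
    show "((\<lambda>s. y s t) has_real_derivative p s t) (at s)" "((\<lambda>t. y s t) has_real_derivative sin s * q s t) (at t)" for s t
      using C1_S2_spherical_derivs[OF f] by (simp_all add: y_def p_def q_def has_real_derivative_iff_has_vector_derivative)
    show "y s (t + 2 * pi) = y s t" "q s (t + 2 * pi) = q s t" for s t
      by (simp_all add: y_def q_def spherical_periodic)
  qed
  then show ?thesis unfolding E N by simp
qed

section \<open>The measures and their first eigenvalue\<close>

definition dens_c :: "real \<Rightarrow> real" where
  "dens_c \<epsilon> = (\<integral>x. dens_N \<epsilon> (x $ 3) \<partial>dvg)"

definition mu :: "real \<Rightarrow> (real^3) measure" where
  "mu \<epsilon> = density dvg (\<lambda>x. ennreal (dens_N \<epsilon> (x $ 3) / dens_c \<epsilon>))"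

lemma sets_mu [simp]: "sets (mu \<epsilon>) = sets (restrict_space borel S2)"
  and space_mu [simp]: "space (mu \<epsilon>) = S2"
  by (simp_all add: mu_def)

lemma abs_S2_3: "x \<in> S2 \<Longrightarrow> \<bar>(x::real^3) $ 3\<bar> \<le> 1"
  using component_le_norm_cart[of x "3::3"] norm_S2 by metis

lemma integral_zonal:
  fixes h :: "real \<Rightarrow> real"
  assumes "continuous_on {-1..1} h"
  shows "(\<integral>x. h (x $ 3) \<partial>dvg) = integral {0..pi} (\<lambda>s. h (cos s) * sin s) / 2"
    "integrable dvg (\<lambda>x. h (x $ 3))"
proof -
  have c: "continuous_on S2 (\<lambda>x::real^3. h (x $ 3))"
  proof (rule continuous_on_compose2[OF assms])
    show "continuous_on S2 (\<lambda>x::real^3. x $ 3)" by (intro continuous_intros)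
    show "(\<lambda>x::real^3. x $ 3) ` S2 \<subseteq> {-1..1}"
    proof
      fix z :: real assume "z \<in> (\<lambda>x::real^3. x $ 3) ` S2"
      then obtain x :: "real^3" where "x \<in> S2" "z = x $ 3" by blast
      then show "z \<in> {-1..1}" using abs_S2_3[of x] by auto
    qed
  qed
  show "integrable dvg (\<lambda>x. h (x $ 3))" by (rule dvg_integral_vec(1)[OF c])
  show "(\<integral>x. h (x $ 3) \<partial>dvg) = integral {0..pi} (\<lambda>s. h (cos s) * sin s) / 2"
    using II_zonal[of "\<lambda>s. h (cos s) * sin s"] by (simp add: dvg_integral[OF c] spherical_3)
qed

text \<open>The primitive \<open>- dens_e \<epsilon> * cos s / dens_w \<epsilon> (cos s)\<close>
  runs from - 1 to 1 between the poles, and its derivative combines the wanted integrand with one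
  bounded by \<open>sin s\<close>. The bounds are free of \<open>\<epsilon>\<close>: the peak has
  mass of order one, so the factor \<open>\<epsilon> / 2\<close> in \<open>dens_N\<close> sets the
  order of the concentrated mass.\<close>

lemma integral_e_div_w2:
  assumes "0 < \<epsilon>"
  shows "(\<integral>x. dens_e \<epsilon> / (dens_w \<epsilon> (x $ 3))\<^sup>2 \<partial>dvg) \<in> {1/4..1}"
proof -
  let ?e = "dens_e \<epsilon>" and ?w = "\<lambda>s. dens_w \<epsilon> (cos s)"
  have e: "0 < ?e" "?e \<le> 1" using dens_e_pos dens_e_le_1[OF assms] by auto
  have w: "0 < ?w s" "?e \<le> ?w s" for s using dens_w_pos[of "cos s" \<epsilon>] dens_w_ge[of "cos s" \<epsilon>] by auto
  have ne: "?w s \<noteq> 0" for s using w(1)[of s] by simp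
  have cw: "continuous_on A ?w" for A by (intro continuous_on_dens continuous_intros) simp
  have i: "(\<lambda>s. ?e / (?w s)\<^sup>2 * sin s) integrable_on {0..pi}" "(\<lambda>s. ?e / ?w s * sin s) integrable_on {0..pi}"
    by (intro integrable_continuous_interval continuous_intros cw; simp add: ne)+
  have "((\<lambda>s. 2 * (1 + ?e) * (?e / (?w s)\<^sup>2 * sin s) - ?e / ?w s * sin s) has_integral
     (- ?e * cos pi / ?w pi - - ?e * cos 0 / ?w 0)) {0..pi}"
  proof (rule fundamental_theorem_of_calculus)
    fix s :: real
    have "(?w has_real_derivative 2 * cos s * sin s) (at s within {0..pi})"
      by (auto intro!: derivative_eq_intros simp: dens_w_def)
    moreover have "((\<lambda>s. - ?e * cos s) has_real_derivative ?e * sin s) (at s within {0..pi})"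
      by (auto intro!: derivative_eq_intros)
    ultimately have "((\<lambda>s. - ?e * cos s / ?w s) has_real_derivative
       (?e * sin s * ?w s + ?e * cos s * (2 * cos s * sin s)) / (?w s)\<^sup>2) (at s within {0..pi})"
      using DERIV_divide[of "\<lambda>s. - ?e * cos s" "?e * sin s" s "{0..pi}" ?w "2 * cos s * sin s"] ne[of s]
      by (simp add: power2_eq_square)
    moreover have "(?e * sin s * ?w s + ?e * cos s * (2 * cos s * sin s)) / (?w s)\<^sup>2
        = 2 * (1 + ?e) * (?e / (?w s)\<^sup>2 * sin s) - ?e / ?w s * sin s"
    proof -
      have "cos s * cos s = 1 + ?e - ?w s" by (simp add: dens_w_def power2_eq_square)
      moreover have "?e * sin s * ?w s + ?e * cos s * (2 * cos s * sin s) = ?e * sin s * ?w s + 2 * ?e * sin s * (cos s * cos s)"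
        by simp
      ultimately have "?e * sin s * ?w s + ?e * cos s * (2 * cos s * sin s) = 2 * (1 + ?e) * ?e * sin s - ?e * ?w s * sin s"
        by (simp only:) (simp add: algebra_simps)
      then show ?thesis using ne[of s] by (simp only:) (simp add: power2_eq_square field_simps)
    qed
    ultimately show "((\<lambda>s. - ?e * cos s / ?w s) has_vector_derivative
       2 * (1 + ?e) * (?e / (?w s)\<^sup>2 * sin s) - ?e / ?w s * sin s) (at s within {0..pi})"
      by (simp only: has_real_derivative_iff_has_vector_derivative)
  qed simp
  then have "integral {0..pi} (\<lambda>s. 2 * (1 + ?e) * (?e / (?w s)\<^sup>2 * sin s) - ?e / ?w s * sin s) = 2"
    using e by (simp add: integral_unique dens_w_def)
  moreover have "integral {0..pi} (\<lambda>s. 2 * (1 + ?e) * (?e / (?w s)\<^sup>2 * sin s) - ?e / ?w s * sin s)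
     = 2 * (1 + ?e) * integral {0..pi} (\<lambda>s. ?e / (?w s)\<^sup>2 * sin s) - integral {0..pi} (\<lambda>s. ?e / ?w s * sin s)"
    by (subst integral_diff) (intro integrable_on_mult_right i | simp only: integral_mult_right)+
  ultimately have 1: "2 * (1 + ?e) * integral {0..pi} (\<lambda>s. ?e / (?w s)\<^sup>2 * sin s) = 2 + integral {0..pi} (\<lambda>s. ?e / ?w s * sin s)"
    by simp
  have 2: "0 \<le> integral {0..pi} (\<lambda>s. ?e / ?w s * sin s)"
    using e w(1) by (intro integral_nonneg i) (simp add: sin_ge_zero less_imp_le)
  have "integral {0..pi} (\<lambda>s. ?e / ?w s * sin s) \<le> integral {0..pi} sin"
  proof (rule integral_le[OF i(2)])
    show "sin integrable_on {0..pi}" by (intro integrable_continuous_interval continuous_intros)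
    fix s assume "s \<in> {0..pi}"
    then have "0 \<le> sin s" by (simp add: sin_ge_zero)
    moreover have "?e / ?w s \<le> 1" using w[of s] by simp
    ultimately have "?e / ?w s * sin s \<le> 1 * sin s" by (rule mult_right_mono[rotated])
    then show "?e / ?w s * sin s \<le> sin s" by simp
  qed
  then have 3: "integral {0..pi} (\<lambda>s. ?e / ?w s * sin s) \<le> 2" by (simp add: integral_sin_0_pi)
  define X where "X = integral {0..pi} (\<lambda>s. ?e / (?w s)\<^sup>2 * sin s)"
  have X1: "2 \<le> 2 * ((1 + ?e) * X)" "2 * ((1 + ?e) * X) \<le> 4" using 1 2 3 unfolding X_def mult.assoc[symmetric] by linarith+
  have X0: "0 \<le> X"
    unfolding X_def using e by (intro integral_nonneg i) (simp add: sin_ge_zero less_imp_le)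
  have "(1 + ?e) * X \<le> 2 * X" "1 * X \<le> (1 + ?e) * X" using e X0 by (intro mult_right_mono; simp)+
  moreover have "(1 + ?e) * X \<le> 2" "1 \<le> (1 + ?e) * X" using X1 by linarith+
  ultimately have X: "X \<in> {1/2..2}" unfolding atLeastAtMost_iff mult_1 by linarith
  have "(\<integral>x. ?e / (dens_w \<epsilon> (x $ 3))\<^sup>2 \<partial>dvg) = X / 2"
    unfolding X_def
  proof (rule integral_zonal(1))
    have "dens_w \<epsilon> z \<noteq> 0" if "z \<in> {-1..1}" for z using dens_w_pos[of z \<epsilon>] that by (auto simp: abs_le_iff)
    then show "continuous_on {-1..1} (\<lambda>z. ?e / (dens_w \<epsilon> z)\<^sup>2)"
      by (intro continuous_intros continuous_on_dens) auto
  qed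
  then show ?thesis using X by simp
qed

lemma dens_N_ge_1: "0 < \<epsilon> \<Longrightarrow> 1 \<le> dens_N \<epsilon> z"
  using dens_e_pos[of \<epsilon>] by (simp add: dens_N_def)

lemma integrable_zonal_w2: "integrable dvg (\<lambda>x. dens_e \<epsilon> / (dens_w \<epsilon> (x $ 3))\<^sup>2)"
proof (rule integral_zonal(2))
  have "dens_w \<epsilon> z \<noteq> 0" if "z \<in> {-1..1}" for z using dens_w_pos[of z \<epsilon>] that by (auto simp: abs_le_iff)
  then show "continuous_on {-1..1} (\<lambda>z. dens_e \<epsilon> / (dens_w \<epsilon> z)\<^sup>2)"
    by (intro continuous_intros continuous_on_dens) auto
qed

lemma dens_c_bounds:
  assumes "0 < \<epsilon>"
  shows "1 \<le> dens_c \<epsilon>" "dens_c \<epsilon> \<le> 1 + \<epsilon> / 2"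
proof -
  have "dens_c \<epsilon> = 1 + \<epsilon> / 2 * (\<integral>x. dens_e \<epsilon> / (dens_w \<epsilon> (x $ 3))\<^sup>2 \<partial>dvg)"
    unfolding dens_c_def dens_N_def
    using Bochner_Integration.integral_add[OF _ integrable_mult_right[OF integrable_zonal_w2], of "\<lambda>x. 1" "\<epsilon> / 2" \<epsilon>]
      Bochner_Integration.integral_mult_right_zero[of dvg "\<epsilon> / 2" "\<lambda>x. dens_e \<epsilon> / (dens_w \<epsilon> (x $ 3))\<^sup>2"] dvg.prob_space
    by (simp del: space_dvg Bochner_Integration.integral_mult_right_zero times_divide_eq_right times_divide_eq_left divide_divide_eq_left divide_divide_eq_right)
  then show "1 \<le> dens_c \<epsilon>" "dens_c \<epsilon> \<le> 1 + \<epsilon> / 2"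
    using integral_e_div_w2[OF assms] assms by (auto intro!: mult_left_le)
qed

lemma dens_N_measurable: "(\<lambda>x. dens_N \<epsilon> (x $ 3)) \<in> borel_measurable dvg"
  by (rule borel_measurable_dvg[OF continuous_on_dens_S2(1)])

lemma mu_density_nonneg: "0 < \<epsilon> \<Longrightarrow> 0 \<le> dens_N \<epsilon> z / dens_c \<epsilon>"
  using dens_N_ge_1[of \<epsilon> z] dens_c_bounds[of \<epsilon>] by simp

lemma integral_mu:
  fixes f :: "real^3 \<Rightarrow> 'b::{banach, second_countable_topology}"
  assumes "0 < \<epsilon>" "f \<in> borel_measurable dvg"
  shows "(\<integral>x. f x \<partial>mu \<epsilon>) = (\<integral>x. (dens_N \<epsilon> (x $ 3) / dens_c \<epsilon>) *\<^sub>R f x \<partial>dvg)"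
    "integrable (mu \<epsilon>) f \<longleftrightarrow> integrable dvg (\<lambda>x. (dens_N \<epsilon> (x $ 3) / dens_c \<epsilon>) *\<^sub>R f x)"
  unfolding mu_def using assms mu_density_nonneg[OF assms(1)] dens_N_measurable[of \<epsilon>]
  by (intro integral_density integrable_density; auto)+

lemma prob_space_mu:
  assumes "0 < \<epsilon>"
  shows "prob_space (mu \<epsilon>)"
proof -
  have i: "integrable dvg (\<lambda>x. dens_N \<epsilon> (x $ 3) / dens_c \<epsilon>)"
    using dvg_integral_vec(1)[OF continuous_on_dens_S2(1)] by simp
  have "emeasure (mu \<epsilon>) (space dvg) = (\<integral>\<^sup>+x. ennreal (dens_N \<epsilon> (x $ 3) / dens_c \<epsilon>) * indicator (space dvg) x \<partial>dvg)"
    unfolding mu_def by (rule emeasure_density) (use dens_N_measurable[of \<epsilon>] in simp, rule sets.top)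
  also have "\<dots> = (\<integral>\<^sup>+x. ennreal (dens_N \<epsilon> (x $ 3) / dens_c \<epsilon>) \<partial>dvg)"
    by (intro nn_integral_cong) (simp del: space_dvg)
  also have "\<dots> = ennreal (\<integral>x. dens_N \<epsilon> (x $ 3) / dens_c \<epsilon> \<partial>dvg)"
    by (rule nn_integral_eq_integral[OF i]) (rule AE_I2, rule mu_density_nonneg[OF assms])
  also have "\<dots> = 1"
    using dens_c_bounds[OF assms] by (simp add: dens_c_def[symmetric])
  finally show ?thesis by (intro prob_spaceI) simp
qed

text \<open>The density is symmetric about the equator; an explicit primitive shows this by taking
  equal values at the two poles.\<close>

lemma integral_N_odd: "integral {0..pi} (\<lambda>s. dens_N \<epsilon> (cos s) * cos s * sin s) = 0"
proof -
  let ?w = "\<lambda>s. dens_w \<epsilon> (cos s)"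
  have ne: "?w s \<noteq> 0" for s using dens_w_pos[of "cos s" \<epsilon>] by auto
  let ?F = "\<lambda>s. (sin s)\<^sup>2 / 2 - \<epsilon> * dens_e \<epsilon> / 4 / ?w s"
  have "((\<lambda>s. dens_N \<epsilon> (cos s) * cos s * sin s) has_integral (?F pi - ?F 0)) {0..pi}"
  proof (rule fundamental_theorem_of_calculus)
    fix s :: real
    have "(?w has_real_derivative 2 * cos s * sin s) (at s within {0..pi})"
      by (auto intro!: derivative_eq_intros simp: dens_w_def)
    then have "(?F has_real_derivative dens_N \<epsilon> (cos s) * cos s * sin s) (at s within {0..pi})"
      by (auto intro!: derivative_eq_intros simp: ne power2_eq_square dens_N_def) (simp add: ne field_simps)
    then show "(?F has_vector_derivative dens_N \<epsilon> (cos s) * cos s * sin s) (at s within {0..pi})"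
      by (simp only: has_real_derivative_iff_has_vector_derivative)
  qed simp
  then show ?thesis by (simp add: integral_unique dens_w_def)
qed

lemma integral_sin_cos_period: "integral {0..2*pi} cos = 0" "integral {0..2*pi} sin = 0"
proof -
  have "(cos has_integral (sin (2*pi) - sin 0)) {0..2*pi}"
    by (rule fundamental_theorem_of_calculus)
      (auto intro!: derivative_eq_intros simp flip: has_real_derivative_iff_has_vector_derivative)
  then show "integral {0..2*pi} cos = 0" by (simp add: integral_unique)
  have "(sin has_integral (- cos (2*pi) - - cos 0)) {0..2*pi}"
    by (rule fundamental_theorem_of_calculus)
      (auto intro!: derivative_eq_intros simp flip: has_real_derivative_iff_has_vector_derivative)
  then show "integral {0..2*pi} sin = 0" by (simp add: integral_unique)
qed

lemma integral_N_coordinate: "(\<integral>x. dens_N \<epsilon> (x $ 3) * x $ i \<partial>dvg) = 0"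
proof -
  have c: "continuous_on S2 (\<lambda>x::real^3. dens_N \<epsilon> (x $ 3) * x $ i)"
    by (intro continuous_intros continuous_on_dens_S2)
  have "II (\<lambda>s t. dens_N \<epsilon> (cos s) * spherical (s,t) $ i * sin s) = 0"
  proof -
    have eq: "(\<lambda>s t. dens_N \<epsilon> (cos s) * (sin s * f t) * sin s) = (\<lambda>s t. (dens_N \<epsilon> (cos s) * sin s * sin s) * f t)"
      for f :: "real \<Rightarrow> real" by (simp add: mult_ac)
    have "II (\<lambda>s t. dens_N \<epsilon> (cos s) * (sin s * cos t) * sin s) = 0" "II (\<lambda>s t. dens_N \<epsilon> (cos s) * (sin s * sin t) * sin s) = 0"
      unfolding eq by (simp_all add: II_def integral_sin_cos_period)
    moreover have "II (\<lambda>s t. dens_N \<epsilon> (cos s) * cos s * sin s) = 0"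
      by (simp add: II_zonal integral_N_odd)
    ultimately show ?thesis
      using exhaust_3[of i] by (auto simp: spherical_def)
  qed
  then show ?thesis by (simp add: dvg_integral[OF c] spherical_3)
qed

lemma balanced_mu:
  assumes "0 < \<epsilon>"
  shows "balanced (mu \<epsilon>)"
proof -
  have m: "(\<lambda>x::real^3. x) \<in> borel_measurable dvg" by (rule borel_measurable_dvg) (rule continuous_on_id)
  have i: "integrable dvg (\<lambda>x. (dens_N \<epsilon> (x $ 3) / dens_c \<epsilon>) *\<^sub>R x)"
    using dens_c_bounds[OF assms]
    by (intro dvg_integral_vec(1) continuous_intros continuous_on_dens_S2) auto
  have "(\<integral>x. x \<partial>mu \<epsilon>) $ j = 0" for j
  proof -
    have "(\<integral>x. x \<partial>mu \<epsilon>) $ j = (\<integral>x. ((dens_N \<epsilon> (x $ 3) / dens_c \<epsilon>) *\<^sub>R x) $ j \<partial>dvg)"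
      unfolding integral_mu(1)[OF assms m] by (rule integral_bounded_linear[OF bounded_linear_vec_nth i, symmetric])
    also have "\<dots> = (\<integral>x. dens_N \<epsilon> (x $ 3) * x $ j / dens_c \<epsilon> \<partial>dvg)" by simp
    also have "\<dots> = 0" using integral_N_coordinate by simp
    finally show ?thesis .
  qed
  then show ?thesis by (simp add: balanced_def vec_eq_iff)
qed

section \<open>Lower bound for the first eigenvalue\<close>

lemma integral_mu_continuous:
  fixes f :: "real^3 \<Rightarrow> real"
  assumes "0 < \<epsilon>" "continuous_on S2 f"
  shows "(\<integral>x. f x \<partial>mu \<epsilon>) = (\<integral>x. dens_N \<epsilon> (x $ 3) * f x \<partial>dvg) / dens_c \<epsilon>"
    "integrable (mu \<epsilon>) f"
proof -
  note m = borel_measurable_dvg[OF assms(2)]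
  show "(\<integral>x. f x \<partial>mu \<epsilon>) = (\<integral>x. dens_N \<epsilon> (x $ 3) * f x \<partial>dvg) / dens_c \<epsilon>"
    by (simp add: integral_mu(1)[OF assms(1) m])
  show "integrable (mu \<epsilon>) f"
    unfolding integral_mu(2)[OF assms(1) m] using dens_c_bounds[OF assms(1)]
    by (intro dvg_integral_vec(1) continuous_intros continuous_on_dens_S2 assms(2)) auto
qed

text \<open>Every two-dimensional space contains a nonzero function of weighted mean zero, to which
  the spectral gap applies. The normalisation only helps, because \<open>dens_c \<epsilon>\<close>
  is at least 1.\<close>

lemma lambda1_lower:
  assumes \<epsilon>: "0 < \<epsilon>" "\<epsilon> \<le> 1/3"
  shows "ereal (8 * pi - 24 * pi * \<epsilon>) \<le> lambda1 (mu \<epsilon>)"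
  unfolding lambda1_def
proof (rule INF_greatest)
  fix E assume "E \<in> {E. two_dim_subspace (mu \<epsilon>) E}"
  then obtain f1 f2 where f: "smooth_S2 f1" "smooth_S2 f2" and E: "E = {\<lambda>x. a * f1 x + b * f2 x |a b. True}"
    and indep: "\<And>a b. (AE x in mu \<epsilon>. a * f1 x + b * f2 x = 0) \<Longrightarrow> a = 0 \<and> b = 0"
    unfolding two_dim_subspace_def by auto
  note C1 = smooth_S2_C1[OF f(1)] smooth_S2_C1[OF f(2)]
  note c = C1_S2_continuous[OF C1(1)] C1_S2_continuous[OF C1(2)]
  have iN: "integrable dvg (\<lambda>x. dens_N \<epsilon> (x $ 3) * f1 x)" "integrable dvg (\<lambda>x. dens_N \<epsilon> (x $ 3) * f2 x)"
    by (intro dvg_integral_vec(1) continuous_intros continuous_on_dens_S2 c)+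
  define m1 where "m1 = (\<integral>x. dens_N \<epsilon> (x $ 3) * f1 x \<partial>dvg)"
  define m2 where "m2 = (\<integral>x. dens_N \<epsilon> (x $ 3) * f2 x \<partial>dvg)"
  \<comment> \<open>One linear condition on two coefficients: \<open>(m2, - m1)\<close> solves it,
    and if both means vanish any choice does.\<close>
  obtain a b where ab: "a * m1 + b * m2 = 0" "a \<noteq> 0 \<or> b \<noteq> 0"
  proof (cases "m1 = 0 \<and> m2 = 0")
    case True then show ?thesis using that[of 1 0] by simp
  next
    case False then show ?thesis using that[of m2 "- m1"] by auto
  qed
  let ?f = "\<lambda>x. a * f1 x + b * f2 x"
  have F: "C1_S2 ?f" by (rule C1_S2_lincomb(1)[OF C1])
  have "(\<integral>x. dens_N \<epsilon> (x $ 3) * ?f x \<partial>dvg) = (\<integral>x. a * (dens_N \<epsilon> (x $ 3) * f1 x) + b * (dens_N \<epsilon> (x $ 3) * f2 x) \<partial>dvg)"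
    by (simp add: algebra_simps)
  also have "\<dots> = a * m1 + b * m2" using iN by (simp add: m1_def m2_def)
  finally have "(\<integral>x. dens_N \<epsilon> (x $ 3) * ?f x \<partial>dvg) = 0" unfolding ab(1) .
  then have gap: "4 * pi * (2 - 6 * \<epsilon>) * (\<integral>x. dens_N \<epsilon> (x $ 3) * (?f x)\<^sup>2 \<partial>dvg) \<le> (\<integral>x. (gnorm (grad_S2 ?f x))\<^sup>2 \<partial>dvg)"
    by (rule weighted_gap[OF \<epsilon> F])
  have c2: "continuous_on S2 (\<lambda>x. (?f x)\<^sup>2)" by (intro continuous_intros c)
  have nz: "\<not> (AE x in mu \<epsilon>. ?f x = 0)" using indep ab(2) by blast
  have I: "(\<integral>x. (?f x)\<^sup>2 \<partial>mu \<epsilon>) = (\<integral>x. dens_N \<epsilon> (x $ 3) * (?f x)\<^sup>2 \<partial>dvg) / dens_c \<epsilon>" (is "?I = ?J / _")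
    by (rule integral_mu_continuous(1)[OF \<epsilon>(1) c2])
  have "?I \<noteq> 0"
    using integral_nonneg_eq_0_iff_AE[OF integral_mu_continuous(2)[OF \<epsilon>(1) c2]] nz by simp
  moreover have "0 \<le> ?I" by (intro integral_nonneg_AE) simp
  ultimately have Ipos: "0 < ?I" unfolding less_le by metis
  have "?I * 1 \<le> ?I * dens_c \<epsilon>" using Ipos dens_c_bounds[OF \<epsilon>(1)] by (intro mult_left_mono) auto
  then have "?I \<le> ?J" using I dens_c_bounds[OF \<epsilon>(1)] by simp
  then have "4 * pi * (2 - 6 * \<epsilon>) * ?I \<le> 4 * pi * (2 - 6 * \<epsilon>) * ?J"
    using \<epsilon> by (intro mult_left_mono) auto
  also note gap
  finally have "8 * pi - 24 * pi * \<epsilon> \<le> (\<integral>x. (gnorm (grad_S2 ?f x))\<^sup>2 \<partial>dvg) / ?I"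
    unfolding pos_le_divide_eq[OF Ipos] by (simp add: algebra_simps)
  then have "ereal (8 * pi - 24 * pi * \<epsilon>) \<le> ereal ((\<integral>x. (gnorm (grad_S2 ?f x))\<^sup>2 \<partial>dvg) / ?I)"
    by simp
  also have "\<dots> \<le> (SUP f \<in> {f \<in> E. \<exists>x\<in>S2. f x \<noteq> 0}.
          ereal ((\<integral>x. (gnorm (grad_S2 f x))\<^sup>2 \<partial>dvg) / (\<integral>x. (f x)\<^sup>2 \<partial>mu \<epsilon>)))"
  proof (rule SUP_upper)
    have "\<exists>x\<in>S2. ?f x \<noteq> 0"
    proof (rule ccontr)
      assume "\<not> ?thesis"
      then have "AE x in mu \<epsilon>. ?f x = 0" by (intro AE_I2) auto
      then show False using nz by blast
    qed
    then show "?f \<in> {f \<in> E. \<exists>x\<in>S2. f x \<noteq> 0}" by (auto simp: E)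
  qed
  finally show "ereal (8 * pi - 24 * pi * \<epsilon>) \<le> \<dots>" .
qed

section \<open>Smoothness and gradients of zonal functions\<close>

lemma Ck_on_cong:
  assumes "open U" "\<And>x. x \<in> U \<Longrightarrow> F x = G x"
  shows "Ck_on k U F = Ck_on k U G"
  using assms(2)
proof (induction k arbitrary: F G)
  case 0 then show ?case by (simp cong: continuous_on_cong)
next
  case (Suc k)
  have d: "(F has_derivative D) (at x) \<longleftrightarrow> (G has_derivative D) (at x)" if "x \<in> U" for x D
    using has_derivative_transform_within_open[OF _ assms(1) that, of F D UNIV G]
      has_derivative_transform_within_open[OF _ assms(1) that, of G D UNIV F] Suc.prems by auto
  have "frechet_derivative F (at x) = frechet_derivative G (at x)" "F differentiable (at x) \<longleftrightarrow> G differentiable (at x)" if "x \<in> U" for x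
    using d[OF that] by (simp_all add: frechet_derivative_def differentiable_def)
  moreover have "Ck_on k U (\<lambda>x. frechet_derivative F (at x) v) = Ck_on k U (\<lambda>x. frechet_derivative G (at x) v)" for v
    by (rule Suc.IH) (simp add: calculation(1))
  ultimately show ?case by simp
qed

text \<open>Each directional derivative of \<open>\<psi> (x $ 3)\<close> is a constant multiple of
  \<open>\<psi>' (x $ 3)\<close>. A class of profiles closed under derivatives and multiples
  therefore passes from one order of differentiability to the next.\<close>

lemma Ck_on_zonal:
  fixes A :: "(real \<Rightarrow> real) set"
  assumes J: "open J" and \<psi>: "\<psi> \<in> A"
    and d: "\<And>\<psi>. \<psi> \<in> A \<Longrightarrow> \<exists>\<psi>'\<in>A. \<forall>z\<in>J. (\<psi> has_real_derivative \<psi>' z) (at z)"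
    and s: "\<And>\<psi> c. \<psi> \<in> A \<Longrightarrow> (\<lambda>z. c * \<psi> z) \<in> A"
  shows "Ck_on k {x. x $ 3 \<in> J} (\<lambda>x. \<psi> (x $ 3))"
  using \<psi>
proof (induction k arbitrary: \<psi>)
  let ?U = "{x::real^3. x $ 3 \<in> J}"
  have U: "open ?U"
    using open_vimage[OF J, of "\<lambda>x::real^3. x $ 3"] by (simp add: vimage_def continuous_on_component)
  have D: "((\<lambda>x::real^3. \<psi> (x $ 3)) has_derivative (\<lambda>v. \<psi>' (x $ 3) * v $ 3)) (at x)"
    if "\<forall>z\<in>J. (\<psi> has_real_derivative \<psi>' z) (at z)" "x \<in> ?U" for \<psi> \<psi>' :: "real \<Rightarrow> real" and x :: "real^3"
  proof -
    have "(\<psi> has_derivative (*) (\<psi>' (x $ 3))) (at (x $ 3))"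
      using that by (simp add: has_field_derivative_def)
    from has_derivative_compose[OF bounded_linear_imp_has_derivative[OF bounded_linear_vec_nth] this]
    show ?thesis by simp
  qed
  {
    case 0
    then obtain \<psi>' where "\<forall>z\<in>J. (\<psi> has_real_derivative \<psi>' z) (at z)" using d by blast
    from D[OF this] show ?case
      by (auto intro!: continuous_at_imp_continuous_on has_derivative_continuous)
  next
    case (Suc k)
    then obtain \<psi>' where \<psi>': "\<psi>' \<in> A" "\<forall>z\<in>J. (\<psi> has_real_derivative \<psi>' z) (at z)" using d by blast
    have fd: "frechet_derivative (\<lambda>x. \<psi> (x $ 3)) (at x) v = v $ 3 * \<psi>' (x $ 3)" if "x \<in> ?U" for x v
      by (simp only: frechet_derivative_at[OF D[OF \<psi>'(2) that], symmetric] mult.commute)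
    have "Ck_on k ?U (\<lambda>x. frechet_derivative (\<lambda>x. \<psi> (x $ 3)) (at x) v)" for v
    proof -
      have "Ck_on k ?U (\<lambda>x. v $ 3 * \<psi>' (x $ 3))" using Suc.IH[OF s[OF \<psi>'(1)]] .
      then show ?thesis by (subst Ck_on_cong[OF U fd])
    qed
    moreover have "(\<lambda>x. \<psi> (x $ 3)) differentiable (at x)" if "x \<in> ?U" for x
      using D[OF \<psi>'(2) that] differentiableI by blast
    ultimately show ?case by simp
  }
qed

lemma smooth_affine: "smooth_S2 (\<lambda>x. a + b * x $ 3)"
proof -
  have "Ck_on k {x. x $ 3 \<in> UNIV} (\<lambda>x. (\<lambda>z. a + b * z) (x $ 3))" for k
  proof (rule Ck_on_zonal[where A = "{\<lambda>z. a + b * z |a b. True}"])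
    fix \<psi> :: "real \<Rightarrow> real" assume "\<psi> \<in> {\<lambda>z. a + b * z |a b. True}"
    then obtain a b where \<psi>: "\<psi> = (\<lambda>z. a + b * z)" by auto
    have "(\<psi> has_real_derivative b) (at z)" for z unfolding \<psi> by (auto intro!: derivative_eq_intros)
    then show "\<exists>\<psi>'\<in>{\<lambda>z. a + b * z |a b. True}. \<forall>z\<in>UNIV. (\<psi> has_real_derivative \<psi>' z) (at z)"
      by (intro bexI[of _ "\<lambda>z. b + 0 * z"] CollectI exI[of _ b] exI[of _ 0]) auto
    show "(\<lambda>z. c * \<psi> z) \<in> {\<lambda>z. a + b * z |a b. True}" for c
      unfolding \<psi> by (auto simp: distrib_left mult.assoc[symmetric])
  qed auto
  then show ?thesis
    unfolding smooth_S2_def by (intro exI[of _ UNIV] exI[of _ "\<lambda>x. a + b * x $ 3"]) auto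
qed

lemma C1_S2_zonal:
  assumes "\<And>z. z \<in> {-1..1} \<Longrightarrow> (\<psi> has_real_derivative \<psi>' z) (at z)" "continuous_on {-1..1} \<psi>'"
  shows "C1_S2 (\<lambda>x. \<psi> (x $ 3))"
    "x \<in> S2 \<Longrightarrow> diff_S2 (\<lambda>x. \<psi> (x $ 3)) x v = \<psi>' (x $ 3) * (v - (x \<bullet> v) *\<^sub>R x) $ 3"
proof -
  have mem: "x $ 3 \<in> {-1..1}" if "x \<in> S2" for x :: "real^3" using abs_S2_3[OF that] by auto
  have 1: "((\<lambda>y. \<psi> (sgn y $ 3)) has_derivative (\<lambda>v. \<psi>' (x $ 3) * (v - (x \<bullet> v) *\<^sub>R x) $ 3)) (at x)" if x: "x \<in> S2" for x :: "real^3"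
  proof -
    have "((\<lambda>y. sgn y $ 3) has_derivative (\<lambda>v. (v - (x \<bullet> v) *\<^sub>R x) $ 3)) (at x)"
      using bounded_linear.has_derivative[OF bounded_linear_vec_nth sgn_has_derivative_S2[OF x]] .
    moreover have "(\<psi> has_derivative (*) (\<psi>' (x $ 3))) (at (sgn x $ 3))"
      using assms(1)[OF mem[OF x]] by (simp add: has_field_derivative_def sgn_S2[OF x])
    ultimately show ?thesis using has_derivative_compose by blast
  qed
  have 2: "continuous_on S2 (\<lambda>x::real^3. \<psi>' (x $ 3) * (v - (x \<bullet> v) *\<^sub>R x) $ 3)" for v
    by (intro continuous_intros continuous_on_compose2[OF assms(2)]) (use mem in auto)
  show "C1_S2 (\<lambda>x. \<psi> (x $ 3))" by (rule C1_S2_I(1)[OF 1 2])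
  show "x \<in> S2 \<Longrightarrow> diff_S2 (\<lambda>x. \<psi> (x $ 3)) x v = \<psi>' (x $ 3) * (v - (x \<bullet> v) *\<^sub>R x) $ 3"
    by (simp only: C1_S2_I(2)[OF 1 2])
qed

text \<open>The gradient need not be computed: pairing it with itself leaves only its third
  component, and pairing it with the third axis gives that component.\<close>

lemma gnorm_grad_zonal:
  assumes "\<And>z. z \<in> {-1..1} \<Longrightarrow> (\<psi> has_real_derivative \<psi>' z) (at z)" "continuous_on {-1..1} \<psi>'" "x \<in> S2"
  shows "(gnorm (grad_S2 (\<lambda>x. \<psi> (x $ 3)) x))\<^sup>2 = 4 * pi * ((\<psi>' (x $ 3))\<^sup>2 * (1 - (x $ 3)\<^sup>2))"
proof -
  have C: "C1_S2 (\<lambda>x. \<psi> (x $ 3))"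
    "diff_S2 (\<lambda>x. \<psi> (x $ 3)) x v = \<psi>' (x $ 3) * (v - (x \<bullet> v) *\<^sub>R x) $ 3" for v
    by (rule C1_S2_zonal; use assms in simp)+
  let ?g = "grad_S2 (\<lambda>x. \<psi> (x $ 3)) x"
  have "?g \<bullet> ?g = 4 * pi * diff_S2 (\<lambda>x. \<psi> (x $ 3)) x ?g"
    using grad_S2_eq(3)[OF C(1) assms(3), of ?g] by (simp add: g_round_def field_simps)
  also have "\<dots> = 4 * pi * \<psi>' (x $ 3) * ?g $ 3"
    using grad_S2_eq(2)[OF C(1) assms(3)] by (simp add: C(2) inner_commute)
  also have "?g $ 3 = ?g \<bullet> axis 3 1" by (simp add: inner_axis)
  also have "\<dots> = 4 * pi * diff_S2 (\<lambda>x. \<psi> (x $ 3)) x (axis 3 1)"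
    using grad_S2_eq(3)[OF C(1) assms(3), of "axis 3 1"] by (simp add: g_round_def field_simps)
  also have "diff_S2 (\<lambda>x. \<psi> (x $ 3)) x (axis 3 1) = \<psi>' (x $ 3) * (1 - (x $ 3)\<^sup>2)"
    by (simp add: C(2) inner_axis power2_eq_square)
  finally show ?thesis
    unfolding gnorm_sq by (simp add: power2_eq_square)
qed

section \<open>Upper bound by affine functions of the height\<close>

lemma integral_x3_squared: "(\<integral>x. (x $ 3)\<^sup>2 \<partial>dvg) = 1 / 3"
proof -
  have "((\<lambda>s. (cos s)\<^sup>2 * sin s) has_integral (- ((cos pi)^3 / 3) - (- ((cos 0)^3 / 3)))) {0..pi}"
    by (rule fundamental_theorem_of_calculus)
      (auto intro!: derivative_eq_intros simp flip: has_real_derivative_iff_has_vector_derivative)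
  then have "integral {0..pi} (\<lambda>s. (cos s)\<^sup>2 * sin s) = 2 / 3"
    by (simp add: integral_unique)
  then show ?thesis
    by (subst integral_zonal(1)) (auto intro!: continuous_intros)
qed

text \<open>On the span of 1 and the height the quadratic form of the measure is diagonal by
  balance, and constants have no energy, so the quotient is largest for the height itself. Its
  square has integral at least \<open>1 / (3 * dens_c \<epsilon>)\<close>, with
  \<open>dens_c \<epsilon>\<close> close to 1.\<close>

lemma lambda1_upper:
  assumes \<epsilon>: "0 < \<epsilon>"
  shows "lambda1 (mu \<epsilon>) \<le> ereal (8 * pi * (1 + \<epsilon> / 2))"
proof -
  define Z where "Z = (\<integral>x. (x $ 3)\<^sup>2 \<partial>mu \<epsilon>)"
  note c = dens_c_bounds[OF \<epsilon>]
  have cx: "continuous_on S2 (\<lambda>x::real^3. x $ 3)" by (intro continuous_intros)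
  have Z: "1 / 3 / dens_c \<epsilon> \<le> Z"
  proof -
    have "1 / 3 \<le> (\<integral>x. dens_N \<epsilon> (x $ 3) * (x $ 3)\<^sup>2 \<partial>dvg)"
      unfolding integral_x3_squared[symmetric]
    proof (rule integral_mono)
      show "integrable dvg (\<lambda>x::real^3. (x $ 3)\<^sup>2)" "integrable dvg (\<lambda>x::real^3. dens_N \<epsilon> (x $ 3) * (x $ 3)\<^sup>2)"
        by (intro dvg_integral_vec(1) continuous_intros continuous_on_dens_S2)+
      show "(x $ 3)\<^sup>2 \<le> dens_N \<epsilon> (x $ 3) * (x $ 3)\<^sup>2" for x :: "real^3"
        using mult_right_mono[OF dens_N_ge_1[OF \<epsilon>], of "(x $ 3)\<^sup>2"] by simp
    qed
    moreover have "Z = (\<integral>x. dens_N \<epsilon> (x $ 3) * (x $ 3)\<^sup>2 \<partial>dvg) / dens_c \<epsilon>"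
      unfolding Z_def by (intro integral_mu_continuous(1)[OF \<epsilon>] continuous_intros)
    ultimately show ?thesis using c by (simp only: divide_right_mono)
  qed
  then have Z0: "0 < Z" using c by (intro less_le_trans[OF _ Z]) auto
  have x0: "(\<integral>x. x $ 3 \<partial>mu \<epsilon>) = 0"
    by (simp add: integral_mu_continuous(1)[OF \<epsilon> cx] integral_N_coordinate)
  interpret mu: prob_space "mu \<epsilon>" by (rule prob_space_mu[OF \<epsilon>])
  have sq: "(\<integral>x. (a + b * x $ 3)\<^sup>2 \<partial>mu \<epsilon>) = a\<^sup>2 + b\<^sup>2 * Z" for a b
  proof -
    have i: "integrable (mu \<epsilon>) (\<lambda>x::real^3. x $ 3)" "integrable (mu \<epsilon>) (\<lambda>x::real^3. (x $ 3)\<^sup>2)"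
      by (intro integral_mu_continuous(2)[OF \<epsilon>] continuous_intros)+
    have "(\<integral>x. (a + b * x $ 3)\<^sup>2 \<partial>mu \<epsilon>) = (\<integral>x. a\<^sup>2 + (2 * a * b * x $ 3 + b\<^sup>2 * (x $ 3)\<^sup>2) \<partial>mu \<epsilon>)"
      by (simp add: power2_eq_square algebra_simps)
    also have "\<dots> = a\<^sup>2 + (2 * a * b * (\<integral>x. x $ 3 \<partial>mu \<epsilon>) + b\<^sup>2 * Z)"
      using i mu.prob_space by (simp add: Z_def)
    finally show ?thesis by (simp add: x0)
  qed
  have grad: "(\<integral>x. (gnorm (grad_S2 (\<lambda>x. a + b * x $ 3) x))\<^sup>2 \<partial>dvg) = b\<^sup>2 * (8 * pi / 3)" for a b
  proof -
    have "(\<integral>x. (gnorm (grad_S2 (\<lambda>x. a + b * x $ 3) x))\<^sup>2 \<partial>dvg) = (\<integral>x. 4 * pi * b\<^sup>2 * (1 - (x $ 3)\<^sup>2) \<partial>dvg)"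
      by (intro Bochner_Integration.integral_cong refl, subst gnorm_grad_zonal[where \<psi>' = "\<lambda>z. b"])
        (auto intro!: derivative_eq_intros)
    also have "\<dots> = 4 * pi * b\<^sup>2 * (1 - 1/3)"
    proof -
      have "integrable dvg (\<lambda>x::real^3. (x $ 3)\<^sup>2)" by (intro dvg_integral_vec(1) continuous_intros)
      then show ?thesis using dvg.prob_space by (simp add: integral_x3_squared)
    qed
    finally show ?thesis by simp
  qed
  define E where "E = {\<lambda>x::real^3. a * 1 + b * x $ 3 |a b. True}"
  have "two_dim_subspace (mu \<epsilon>) E"
    unfolding two_dim_subspace_def
  proof (rule exI[of _ "\<lambda>x. 1"], rule exI[of _ "\<lambda>x. x $ 3"], intro conjI allI impI)
    show "smooth_S2 (\<lambda>x::real^3. 1::real)" "smooth_S2 (\<lambda>x::real^3. x $ 3)"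
      using smooth_affine[of 1 0] smooth_affine[of 0 1] by simp_all
    show "E = {\<lambda>x. a * 1 + b * x $ 3 |a b. True}" by (simp add: E_def)
    fix a b :: real assume "AE x in mu \<epsilon>. a * 1 + b * x $ 3 = 0"
    then have "(\<integral>x. (a + b * x $ 3)\<^sup>2 \<partial>mu \<epsilon>) = 0"
      by (intro integral_eq_zero_AE) auto
    then have "a\<^sup>2 + b\<^sup>2 * Z = 0" by (simp add: sq)
    moreover have "0 \<le> b\<^sup>2 * Z" using Z0 by simp
    ultimately have "a\<^sup>2 = 0" "b\<^sup>2 * Z = 0" using zero_le_power2[of a] by linarith+
    then show "a = 0" "b = 0" using Z0 by auto
  qed
  then have "lambda1 (mu \<epsilon>) \<le> (SUP f \<in> {f \<in> E. \<exists>x\<in>S2. f x \<noteq> 0}.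
          ereal ((\<integral>x. (gnorm (grad_S2 f x))\<^sup>2 \<partial>dvg) / (\<integral>x. (f x)\<^sup>2 \<partial>mu \<epsilon>)))"
    unfolding lambda1_def by (intro INF_lower) simp
  also have "\<dots> \<le> ereal (8 * pi * (1 + \<epsilon> / 2))"
  proof (rule SUP_least)
    fix f assume "f \<in> {f \<in> E. \<exists>x\<in>S2. f x \<noteq> 0}"
    then obtain a b x where f: "f = (\<lambda>x. a + b * x $ 3)" and "f x \<noteq> 0"
      unfolding E_def by auto
    then have ab: "a \<noteq> 0 \<or> b \<noteq> 0" by auto
    have pos: "0 < a\<^sup>2 + b\<^sup>2 * Z"
      using ab Z0 by (auto intro: add_pos_nonneg add_nonneg_pos)
    have "1 / 3 \<le> Z * dens_c \<epsilon>" using Z c by (simp add: field_simps)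
    also have "\<dots> \<le> Z * (1 + \<epsilon> / 2)" using c Z0 by (intro mult_left_mono) auto
    finally have "b\<^sup>2 * (8 * pi) * (1 / 3) \<le> b\<^sup>2 * (8 * pi) * (Z * (1 + \<epsilon> / 2))"
      by (intro mult_left_mono) auto
    also have "\<dots> \<le> 8 * pi * (1 + \<epsilon> / 2) * (a\<^sup>2 + b\<^sup>2 * Z)"
      using \<epsilon> by (simp add: algebra_simps)
    finally have "b\<^sup>2 * (8 * pi / 3) / (a\<^sup>2 + b\<^sup>2 * Z) \<le> 8 * pi * (1 + \<epsilon> / 2)"
      unfolding pos_divide_le_eq[OF pos] by simp
    then show "ereal ((\<integral>x. (gnorm (grad_S2 f x))\<^sup>2 \<partial>dvg) / (\<integral>x. (f x)\<^sup>2 \<partial>mu \<epsilon>)) \<le> ereal (8 * pi * (1 + \<epsilon> / 2))"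
      by (simp only: f grad sq ereal_less_eq)
  qed
  finally show ?thesis .
qed

lemma lambda1_tendsto: "((\<lambda>\<epsilon>. lambda1 (mu \<epsilon>)) \<longlongrightarrow> ereal (8 * pi)) (at_right 0)"
proof (rule tendsto_sandwich)
  show "\<forall>\<^sub>F \<epsilon> in at_right 0. ereal (8 * pi - 24 * pi * \<epsilon>) \<le> lambda1 (mu \<epsilon>)"
    by (rule eventually_mono[OF eventually_at_right_real[of 0 "1/3"]]) (auto intro!: lambda1_lower)
  show "\<forall>\<^sub>F \<epsilon> in at_right 0. lambda1 (mu \<epsilon>) \<le> ereal (8 * pi * (1 + \<epsilon> / 2))"
    by (rule eventually_mono[OF eventually_at_right_real[of 0 1]]) (auto intro!: lambda1_upper)
  have "((\<lambda>\<epsilon>. 8 * pi - 24 * pi * \<epsilon>) \<longlongrightarrow> 8 * pi - 24 * pi * 0) (at_right 0)"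
    "((\<lambda>\<epsilon>. 8 * pi * (1 + \<epsilon> / 2)) \<longlongrightarrow> 8 * pi * (1 + 0 / 2)) (at_right 0)"
    by (intro tendsto_intros; simp)+
  then show "((\<lambda>\<epsilon>. ereal (8 * pi - 24 * pi * \<epsilon>)) \<longlongrightarrow> ereal (8 * pi)) (at_right 0)"
    "((\<lambda>\<epsilon>. ereal (8 * pi * (1 + \<epsilon> / 2))) \<longlongrightarrow> ereal (8 * pi)) (at_right 0)"
    by simp_all
qed

section \<open>The dual norm of the difference to the area measure\<close>

text \<open>The claim amounts to \<open>ln (2 + t) \<le> n * ln (2 + t / n)\<close>, a case of
  Bernoulli's inequality. It turns a bound \<open>n\<close> for the integral in the Orlicz norm into
  a bound for the norm itself after division by \<open>n\<close>.\<close>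

lemma young_scale:
  fixes t :: real and n :: nat
  assumes "0 \<le> t" "1 \<le> n"
  shows "(t / n)\<^sup>2 / ln (2 + t / n) \<le> (t\<^sup>2 / ln (2 + t)) / n"
proof -
  have n: "0 < real n" using assms by simp
  have "2 + t \<le> 1 + real n * (1 + t / n)" using assms n by (simp add: field_simps)
  also have "\<dots> \<le> (1 + (1 + t / n)) ^ n"
    using assms by (intro Bernoulli_inequality) (simp add: add_nonneg_nonneg)
  finally have "ln (2 + t) \<le> ln ((2 + t / n) ^ n)"
    using assms by (intro ln_mono) (auto simp: add_pos_nonneg)
  also have "\<dots> = n * ln (2 + t / n)"
    by (rule ln_realpow)
  finally have 1: "ln (2 + t) \<le> n * ln (2 + t / n)" .
  have pos: "0 < ln (2 + t)" "0 < ln (2 + t / n)"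
    using assms divide_nonneg_pos[OF assms(1) n] by (intro ln_gt_zero; linarith)+
  have "t\<^sup>2 / n * ln (2 + t) \<le> t\<^sup>2 / n * (n * ln (2 + t / n))"
    by (intro mult_left_mono 1) simp
  then have "t\<^sup>2 / n\<^sup>2 * ln (2 + t) \<le> t\<^sup>2 / n * ln (2 + t / n)"
    using n by (simp add: field_simps power2_eq_square)
  then show ?thesis
    using pos n by (simp add: power_divide field_simps)
qed

text \<open>One factor \<open>n\<close> in the denominator brings the integral below 1 by
  \<open>young_scale\<close>. The factor 2 allows \<open>\<eta> = 1/2\<close>, because a function
  and its gradient must together have norm at most 1.\<close>

lemma orlicz_norm_le_half:
  assumes "1 \<le> n" "\<And>x. x \<in> S2 \<Longrightarrow> 0 \<le> h x" "\<And>x. x \<in> S2 \<Longrightarrow> \<bar>u x\<bar> = h x / (2 * real n)"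
    and "(\<integral>\<^sup>+x. ennreal ((h x)\<^sup>2 / ln (2 + h x)) \<partial>dvg) \<le> ennreal n"
    and m: "(\<lambda>x. ennreal ((h x)\<^sup>2 / ln (2 + h x))) \<in> borel_measurable dvg"
  shows "orlicz_norm u \<le> ennreal (1/2)"
  unfolding orlicz_norm_def
proof (rule Inf_lower, intro CollectI exI[of _ "1/2"] conjI refl)
  have n: "0 < real n" using assms by simp
  have "(\<integral>\<^sup>+x. ennreal (\<bar>u x / (1/2)\<bar>\<^sup>2 / ln (2 + \<bar>u x / (1/2)\<bar>)) \<partial>dvg)
     \<le> (\<integral>\<^sup>+x. ennreal (1 / n) * ennreal ((h x)\<^sup>2 / ln (2 + h x)) \<partial>dvg)"
  proof (rule nn_integral_mono)
    fix x assume "x \<in> space dvg"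
    then have x: "x \<in> S2" by simp
    have eq: "\<bar>u x / (1/2)\<bar> = h x / n" using assms(3)[OF x] by (simp add: abs_mult)
    have "0 \<le> (h x)\<^sup>2 / ln (2 + h x)" using assms(2)[OF x] by (auto intro!: divide_nonneg_nonneg)
    then have "ennreal (1 / n) * ennreal ((h x)\<^sup>2 / ln (2 + h x)) = ennreal (((h x)\<^sup>2 / ln (2 + h x)) / n)"
      by (simp add: ennreal_mult'[symmetric] mult.commute)
    then show "ennreal (\<bar>u x / (1/2)\<bar>\<^sup>2 / ln (2 + \<bar>u x / (1/2)\<bar>)) \<le> ennreal (1 / n) * ennreal ((h x)\<^sup>2 / ln (2 + h x))"
      unfolding eq using young_scale[OF assms(2)[OF x] assms(1)] by (simp add: ennreal_leI)
  qed
  also have "\<dots> = ennreal (1 / n) * (\<integral>\<^sup>+x. ennreal ((h x)\<^sup>2 / ln (2 + h x)) \<partial>dvg)"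
    by (rule nn_integral_cmult[OF m])
  also have "\<dots> \<le> ennreal (1 / n) * ennreal n"
    by (intro mult_left_mono assms(4)) simp
  also have "\<dots> = 1" using n by (simp add: ennreal_mult'[symmetric])
  finally show "(\<integral>\<^sup>+x. ennreal (\<bar>u x / (1/2)\<bar>\<^sup>2 / ln (2 + \<bar>u x / (1/2)\<bar>)) \<partial>dvg) \<le> 1" .
qed simp

text \<open>Up to an additive constant \<open>t\<^sup>2 / ln (2 + t)\<close> dominates
  \<open>t\<close>, so on a probability space the norm controls the integral of the absolute value.
  The hypothesis is strict so that the infimum yields an actual \<open>\<eta> < 2\<close>.\<close>

lemma orlicz_norm_integral_le:
  assumes u: "integrable dvg u" and o: "orlicz_norm u < 2"
  shows "(\<integral>x. \<bar>u x\<bar> \<partial>dvg) \<le> 4"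
proof -
  obtain \<eta> where \<eta>: "0 < \<eta>" "ennreal \<eta> < 2"
    and le: "(\<integral>\<^sup>+ x. ennreal (\<bar>u x / \<eta>\<bar>\<^sup>2 / ln (2 + \<bar>u x / \<eta>\<bar>)) \<partial>dvg) \<le> 1"
    using o unfolding orlicz_norm_def Inf_less_iff by auto
  have "\<eta> < 2" using \<eta> by (metis ennreal_less_iff ennreal_numeral less_eq_real_def)
  \<comment> \<open>From \<open>ln (2 + t) \<le> 1 + t\<close> and
    \<open>(t - 1) * (1 + t) \<le> t\<^sup>2\<close>.\<close>
  have ptw: "t \<le> 1 + t\<^sup>2 / ln (2 + t)" if "0 \<le> t" for t :: real
  proof -
    have "0 < ln (2 + t)" using that by (intro ln_gt_zero) simp
    moreover have "ln (2 + t) \<le> 1 + t" using ln_add_one_self_le_self[of "1 + t"] that by simp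
    ultimately have "t\<^sup>2 / (1 + t) \<le> t\<^sup>2 / ln (2 + t)" using that by (intro divide_left_mono) auto
    moreover have "t - 1 \<le> t\<^sup>2 / (1 + t)" using that by (simp add: field_simps power2_eq_square)
    ultimately show ?thesis by simp
  qed
  have um: "u \<in> borel_measurable dvg" using u by auto
  have "ennreal (\<integral>x. \<bar>u x / \<eta>\<bar> \<partial>dvg) = (\<integral>\<^sup>+x. ennreal \<bar>u x / \<eta>\<bar> \<partial>dvg)"
    using u by (intro nn_integral_eq_integral[symmetric] integrable_abs integrable_divide) auto
  also have "\<dots> \<le> (\<integral>\<^sup>+x. 1 + ennreal (\<bar>u x / \<eta>\<bar>\<^sup>2 / ln (2 + \<bar>u x / \<eta>\<bar>)) \<partial>dvg)"
  proof (rule nn_integral_mono)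
    fix x
    have "ennreal \<bar>u x / \<eta>\<bar> \<le> ennreal (1 + \<bar>u x / \<eta>\<bar>\<^sup>2 / ln (2 + \<bar>u x / \<eta>\<bar>))"
      by (intro ennreal_leI ptw) simp
    also have "\<dots> = ennreal 1 + ennreal (\<bar>u x / \<eta>\<bar>\<^sup>2 / ln (2 + \<bar>u x / \<eta>\<bar>))"
      by (intro ennreal_plus) auto
    finally show "ennreal \<bar>u x / \<eta>\<bar> \<le> 1 + ennreal (\<bar>u x / \<eta>\<bar>\<^sup>2 / ln (2 + \<bar>u x / \<eta>\<bar>))" by simp
  qed
  also have "\<dots> = (\<integral>\<^sup>+x. 1 \<partial>dvg) + (\<integral>\<^sup>+x. ennreal (\<bar>u x / \<eta>\<bar>\<^sup>2 / ln (2 + \<bar>u x / \<eta>\<bar>)) \<partial>dvg)"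
  proof (rule nn_integral_add)
    have "ln (2 + \<bar>t / \<eta>\<bar>) \<noteq> 0" for t
      using ln_gt_zero[of "2 + \<bar>t / \<eta>\<bar>"] abs_ge_zero[of "t / \<eta>"] by (metis add_increasing2 add_pos_nonneg
        less_add_same_cancel1 less_le_trans less_numeral_extra(3) one_less_numeral_iff order_le_less semiring_norm(76) zero_less_numeral)
    moreover have "2 + \<bar>t / \<eta>\<bar> \<noteq> 0" for t using abs_ge_zero[of "t / \<eta>"] by linarith
    ultimately have "(\<lambda>t::real. \<bar>t / \<eta>\<bar>\<^sup>2 / ln (2 + \<bar>t / \<eta>\<bar>)) \<in> borel_measurable borel"
      using \<eta>(1) by (intro borel_measurable_continuous_onI continuous_intros) auto
    from measurable_compose[OF measurable_compose[OF um this] measurable_ennreal]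
    show "(\<lambda>x. ennreal (\<bar>u x / \<eta>\<bar>\<^sup>2 / ln (2 + \<bar>u x / \<eta>\<bar>))) \<in> borel_measurable dvg" .
  qed simp
  also have "\<dots> \<le> 1 + 1" using le dvg.emeasure_space_1 by (intro add_mono) auto
  finally have "ennreal (\<integral>x. \<bar>u x / \<eta>\<bar> \<partial>dvg) \<le> ennreal 2" by simp
  then have "(\<integral>x. \<bar>u x / \<eta>\<bar> \<partial>dvg) \<le> 2"
    by (subst (asm) ennreal_le_iff) auto
  then have "(\<integral>x. \<bar>u x\<bar> \<partial>dvg) / \<eta> \<le> 2"
    using \<eta> by (simp add: abs_divide)
  then have "(\<integral>x. \<bar>u x\<bar> \<partial>dvg) \<le> 2 * \<eta>" using \<eta> by (simp add: field_simps)
  then show ?thesis using \<open>\<eta> < 2\<close> by simp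
qed

section \<open>The difference functional as an element of the dual space\<close>

definition mu_diff :: "real \<Rightarrow> (real^3 \<Rightarrow> real) \<Rightarrow> real" where
  "mu_diff \<epsilon> u = (\<integral>x. u x \<partial>mu \<epsilon>) - (\<integral>x. u x \<partial>dvg)"

text \<open>The bound explodes as \<open>\<epsilon>\<close> tends to 0. It serves only statements
  about a fixed \<open>\<epsilon>\<close>: admissibility and membership in the dual.\<close>

lemma mu_density_le:
  assumes "0 < \<epsilon>" "x \<in> S2"
  shows "dens_N \<epsilon> (x $ 3) / dens_c \<epsilon> \<le> 1 + \<epsilon> / 2 / dens_e \<epsilon>"
proof -
  let ?e = "dens_e \<epsilon>" and ?w = "dens_w \<epsilon> (x $ 3)"
  have e: "0 < ?e" "?e \<le> ?w" using dens_e_pos dens_w_ge[OF abs_S2_3[OF assms(2)]] by auto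
  have "?e / ?w\<^sup>2 \<le> ?e / ?e\<^sup>2" using e by (intro divide_left_mono power_mono) auto
  then have "\<epsilon> / 2 * (?e / ?w\<^sup>2) \<le> \<epsilon> / 2 * (1 / ?e)"
    using assms e by (intro mult_left_mono) (auto simp: power2_eq_square)
  then have "dens_N \<epsilon> (x $ 3) \<le> 1 + \<epsilon> / 2 / ?e" by (simp add: dens_N_def)
  moreover have "dens_N \<epsilon> (x $ 3) / dens_c \<epsilon> \<le> dens_N \<epsilon> (x $ 3) / 1"
    using dens_c_bounds[OF assms(1)] dens_N_ge_1[OF assms(1), of "x $ 3"] by (intro divide_left_mono) auto
  ultimately show ?thesis by simp
qed

lemma integrable_mu_dvg:
  fixes u :: "real^3 \<Rightarrow> real"
  assumes "0 < \<epsilon>" "integrable dvg u"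
  shows "integrable (mu \<epsilon>) u" "integrable dvg (\<lambda>x. dens_N \<epsilon> (x $ 3) / dens_c \<epsilon> * u x)"
    "\<bar>\<integral>x. u x \<partial>mu \<epsilon>\<bar> \<le> (1 + \<epsilon> / 2 / dens_e \<epsilon>) * (\<integral>x. \<bar>u x\<bar> \<partial>dvg)"
proof -
  let ?B = "1 + \<epsilon> / 2 / dens_e \<epsilon>"
  have um: "u \<in> borel_measurable dvg" using assms by auto
  have B: "0 \<le> ?B" using assms dens_e_pos[of \<epsilon>] by simp
  have le: "norm (dens_N \<epsilon> (x $ 3) / dens_c \<epsilon> * u x) \<le> ?B * \<bar>u x\<bar>" if "x \<in> S2" for x
    using mu_density_le[OF assms(1) that] mu_density_nonneg[OF assms(1), of "x $ 3"]
    unfolding real_norm_def abs_mult[of "_ / _"] by (intro mult_right_mono) auto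
  have iB: "integrable dvg (\<lambda>x. ?B * \<bar>u x\<bar>)" using assms by auto
  show i: "integrable dvg (\<lambda>x. dens_N \<epsilon> (x $ 3) / dens_c \<epsilon> * u x)"
  proof (rule Bochner_Integration.integrable_bound[OF iB])
    show "(\<lambda>x. dens_N \<epsilon> (x $ 3) / dens_c \<epsilon> * u x) \<in> borel_measurable dvg"
      using dens_N_measurable[of \<epsilon>] um by simp
    show "AE x in dvg. norm (dens_N \<epsilon> (x $ 3) / dens_c \<epsilon> * u x) \<le> norm (?B * \<bar>u x\<bar>)"
      using le B by (intro AE_I2) (simp add: abs_mult)
  qed
  then show "integrable (mu \<epsilon>) u" by (simp add: integral_mu(2)[OF assms(1) um])
  have "\<bar>\<integral>x. u x \<partial>mu \<epsilon>\<bar> = \<bar>\<integral>x. dens_N \<epsilon> (x $ 3) / dens_c \<epsilon> * u x \<partial>dvg\<bar>"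
    by (simp add: integral_mu(1)[OF assms(1) um])
  also have "\<dots> \<le> (\<integral>x. \<bar>dens_N \<epsilon> (x $ 3) / dens_c \<epsilon> * u x\<bar> \<partial>dvg)"
    by (rule integral_abs_bound)
  also have "\<dots> \<le> (\<integral>x. ?B * \<bar>u x\<bar> \<partial>dvg)"
    by (rule integral_mono[OF integrable_abs[OF i] iB]) (use le in auto)
  also have "\<dots> = ?B * (\<integral>x. \<bar>u x\<bar> \<partial>dvg)" by simp
  finally show "\<bar>\<integral>x. u x \<partial>mu \<epsilon>\<bar> \<le> ?B * (\<integral>x. \<bar>u x\<bar> \<partial>dvg)" .
qed

lemma orlicz_sobolev_integrable: "u \<in> orlicz_sobolev \<Longrightarrow> integrable dvg u"
  unfolding orlicz_sobolev_def orlicz_sobolev_norm_def weak_grad_def by (auto simp: INF_less_iff)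

lemma represents_mu_diff:
  assumes \<epsilon>: "0 < \<epsilon>"
  shows "represents_diff (mu_diff \<epsilon>) (mu \<epsilon>) dvg"
  unfolding represents_diff_def in_dual_def
proof (intro conjI ballI allI impI)
  fix u v :: "real^3 \<Rightarrow> real" and a b :: real assume "u \<in> orlicz_sobolev" "v \<in> orlicz_sobolev"
  then have i: "integrable dvg u" "integrable dvg v" by (auto intro: orlicz_sobolev_integrable)
  show "mu_diff \<epsilon> (\<lambda>x. a * u x + b * v x) = a * mu_diff \<epsilon> u + b * mu_diff \<epsilon> v"
    using i integrable_mu_dvg(1)[OF \<epsilon> i(1)] integrable_mu_dvg(1)[OF \<epsilon> i(2)]
    by (simp add: mu_diff_def algebra_simps)
next
  show "mu_diff \<epsilon> \<phi> = (\<integral>x. \<phi> x \<partial>mu \<epsilon>) - (\<integral>x. \<phi> x \<partial>dvg)" for \<phi> by (simp add: mu_diff_def)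
next
  let ?B = "1 + \<epsilon> / 2 / dens_e \<epsilon>"
  have B: "0 \<le> ?B" using \<epsilon> dens_e_pos[of \<epsilon>] by simp
  have "dual_norm (mu_diff \<epsilon>) \<le> ennreal (4 * (?B + 1))"
    unfolding dual_norm_def
  proof (rule SUP_least)
    fix u assume "u \<in> {u. orlicz_sobolev_norm u \<le> 1}"
    \<comment> \<open>The infimum over weak gradients need not be attained at a value of at most 1;
      the slack up to 2 provides a weak gradient to work with.\<close>
    then have "orlicz_sobolev_norm u < 2"
      using order.strict_trans1[of "orlicz_sobolev_norm u" 1 2] by simp
    then obtain V where V: "weak_grad u V" "orlicz_norm u + orlicz_norm (\<lambda>x. gnorm (V x)) < 2"
      unfolding orlicz_sobolev_norm_def INF_less_iff by auto
    then have i: "integrable dvg u" by (simp add: weak_grad_def)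
    have "orlicz_norm u \<le> orlicz_norm u + orlicz_norm (\<lambda>x. gnorm (V x))" by simp
    then have "orlicz_norm u < 2" using V(2) by (rule order.strict_trans1)
    then have 4: "(\<integral>x. \<bar>u x\<bar> \<partial>dvg) \<le> 4" by (rule orlicz_norm_integral_le[OF i])
    have "\<bar>mu_diff \<epsilon> u\<bar> \<le> \<bar>\<integral>x. u x \<partial>mu \<epsilon>\<bar> + \<bar>\<integral>x. u x \<partial>dvg\<bar>" by (simp add: mu_diff_def)
    also have "\<dots> \<le> ?B * (\<integral>x. \<bar>u x\<bar> \<partial>dvg) + (\<integral>x. \<bar>u x\<bar> \<partial>dvg)"
      by (intro add_mono integrable_mu_dvg(3)[OF \<epsilon> i] integral_abs_bound)
    also have "\<dots> = (\<integral>x. \<bar>u x\<bar> \<partial>dvg) * (?B + 1)" by (simp add: algebra_simps)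
    also have "\<dots> \<le> 4 * (?B + 1)" using B 4 by (intro mult_right_mono) auto
    finally show "ennreal \<bar>mu_diff \<epsilon> u\<bar> \<le> ennreal (4 * (?B + 1))" by (rule ennreal_leI)
  qed
  then show "dual_norm (mu_diff \<epsilon>) < \<infinity>"
    by (rule order.strict_trans1) (simp add: ennreal_less_top)
qed

text \<open>
  Smoothness of the test function is proved for an algebra that is closed under differentiation.
\<close>

inductive_set zonal_class :: "real \<Rightarrow> (real \<Rightarrow> real) set" for \<epsilon> where
  const: "(\<lambda>z. c) \<in> zonal_class \<epsilon>"
| coord: "(\<lambda>z. z) \<in> zonal_class \<epsilon>"
| log: "dens_k \<epsilon> \<in> zonal_class \<epsilon>"
| recip: "(\<lambda>z. 1 / dens_w \<epsilon> z) \<in> zonal_class \<epsilon>"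
| plus: "f \<in> zonal_class \<epsilon> \<Longrightarrow> h \<in> zonal_class \<epsilon> \<Longrightarrow> (\<lambda>z. f z + h z) \<in> zonal_class \<epsilon>"
| times: "f \<in> zonal_class \<epsilon> \<Longrightarrow> h \<in> zonal_class \<epsilon> \<Longrightarrow> (\<lambda>z. f z * h z) \<in> zonal_class \<epsilon>"

lemma zonal_class_deriv:
  assumes "f \<in> zonal_class \<epsilon>"
  shows "\<exists>f'\<in>zonal_class \<epsilon>. \<forall>z\<in>{z. 0 < dens_w \<epsilon> z}. (f has_real_derivative f' z) (at z)"
  using assms
proof induction
  case (const c) show ?case by (rule bexI[OF _ zonal_class.const[of 0]]) auto
next
  case coord show ?case by (rule bexI[OF _ zonal_class.const[of 1]]) auto
next
  case log
  show ?case
  proof (rule bexI)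
    show "(\<lambda>z. (2 * z) * (1 / dens_w \<epsilon> z)) \<in> zonal_class \<epsilon>"
      by (intro zonal_class.intros)
    show "\<forall>z\<in>{z. 0 < dens_w \<epsilon> z}. (dens_k \<epsilon> has_real_derivative (2 * z) * (1 / dens_w \<epsilon> z)) (at z)"
      using dens_k_deriv by auto
  qed
next
  case recip
  show ?case
  proof (rule bexI)
    show "(\<lambda>z. (2 * z) * ((1 / dens_w \<epsilon> z) * (1 / dens_w \<epsilon> z))) \<in> zonal_class \<epsilon>"
      by (intro zonal_class.intros)
    show "\<forall>z\<in>{z. 0 < dens_w \<epsilon> z}. ((\<lambda>z. 1 / dens_w \<epsilon> z) has_real_derivative (2 * z) * ((1 / dens_w \<epsilon> z) * (1 / dens_w \<epsilon> z))) (at z)"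
      by (auto intro!: derivative_eq_intros)
  qed
next
  case (plus f h)
  then obtain f' h' where fh: "f' \<in> zonal_class \<epsilon>" "h' \<in> zonal_class \<epsilon>"
    "\<forall>z\<in>{z. 0 < dens_w \<epsilon> z}. (f has_real_derivative f' z) (at z)"
    "\<forall>z\<in>{z. 0 < dens_w \<epsilon> z}. (h has_real_derivative h' z) (at z)" by blast
  then show ?case
    by (intro bexI[of _ "\<lambda>z. f' z + h' z"]) (auto intro!: derivative_eq_intros zonal_class.plus)
next
  case (times f h)
  then obtain f' h' where fh: "f' \<in> zonal_class \<epsilon>" "h' \<in> zonal_class \<epsilon>"
    "\<forall>z\<in>{z. 0 < dens_w \<epsilon> z}. (f has_real_derivative f' z) (at z)"
    "\<forall>z\<in>{z. 0 < dens_w \<epsilon> z}. (h has_real_derivative h' z) (at z)" by blast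
  then show ?case using times.hyps
    by (intro bexI[of _ "\<lambda>z. f' z * h z + h' z * f z"]) (auto intro!: DERIV_mult zonal_class.plus zonal_class.times)
qed

lemma smooth_zonal:
  assumes "f \<in> zonal_class \<epsilon>"
  shows "smooth_S2 (\<lambda>x. f (x $ 3))"
proof -
  let ?J = "{z. 0 < dens_w \<epsilon> z}"
  have J: "open ?J"
    unfolding dens_w_def by (intro open_Collect_less continuous_intros)
  have "Ck_on k {x. x $ 3 \<in> ?J} (\<lambda>x. f (x $ 3))" for k
    by (rule Ck_on_zonal[OF J assms zonal_class_deriv zonal_class.times[OF zonal_class.const]])
  moreover have "open {x::real^3. x $ 3 \<in> ?J}"
    using open_vimage[OF J, of "\<lambda>x::real^3. x $ 3"] by (simp add: vimage_def continuous_on_component)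
  moreover have "S2 \<subseteq> {x::real^3. x $ 3 \<in> ?J}"
    using dens_w_pos abs_S2_3 by auto
  ultimately show ?thesis
    unfolding smooth_S2_def by (intro exI[of _ "{x. x $ 3 \<in> ?J}"] exI[of _ "\<lambda>x. f (x $ 3)"]) auto
qed

text \<open>The area element cancels the singularity, since \<open>sin s\<close> is at most
  \<open>sqrt (dens_w \<epsilon> (cos s))\<close>; hence the bound is uniform in
  \<open>\<epsilon>\<close>.\<close>

lemma integral_recip_sqrt_w:
  assumes "0 < \<epsilon>"
  shows "(\<integral>x. 1 / sqrt (dens_w \<epsilon> (x $ 3)) \<partial>dvg) \<le> pi / 2" "integrable dvg (\<lambda>x. 1 / sqrt (dens_w \<epsilon> (x $ 3)))"
proof -
  have ne: "sqrt (dens_w \<epsilon> z) \<noteq> 0" if "z \<in> {-1..1}" for z using dens_w_pos[of z \<epsilon>] that by (auto simp: abs_le_iff)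
  have c: "continuous_on {-1..1} (\<lambda>z. 1 / sqrt (dens_w \<epsilon> z))"
    using ne by (intro continuous_intros continuous_on_dens) auto
  show "integrable dvg (\<lambda>x. 1 / sqrt (dens_w \<epsilon> (x $ 3)))" by (rule integral_zonal(2)[OF c])
  have w: "0 < dens_w \<epsilon> (cos s)" for s by (rule dens_w_pos) simp
  have "integral {0..pi} (\<lambda>s. 1 / sqrt (dens_w \<epsilon> (cos s)) * sin s) \<le> integral {0..pi} (\<lambda>s. 1)"
  proof (rule integral_le)
    show "(\<lambda>s. 1 / sqrt (dens_w \<epsilon> (cos s)) * sin s) integrable_on {0..pi}"
      using w by (intro integrable_continuous_interval continuous_intros continuous_on_dens) (auto simp: less_imp_neq[symmetric])
    fix s assume "s \<in> {0..pi}"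
    then have "0 \<le> sin s" by (simp add: sin_ge_zero)
    then have "sin s \<le> sqrt (dens_w \<epsilon> (cos s))"
      using dens_e_pos[of \<epsilon>] by (intro real_le_rsqrt) (simp add: dens_w_cos)
    then show "1 / sqrt (dens_w \<epsilon> (cos s)) * sin s \<le> 1" using w[of s] by simp
  qed auto
  then show "(\<integral>x. 1 / sqrt (dens_w \<epsilon> (x $ 3)) \<partial>dvg) \<le> pi / 2"
    by (simp add: integral_zonal(1)[OF c])
qed

text \<open>The integral grows like \<open>ln (1 / dens_e \<epsilon>)\<close>, that is like
  \<open>1 / \<epsilon>\<close>, and the factor \<open>\<epsilon>\<close> compensates this.\<close>

lemma integral_recip_w:
  assumes "0 < \<epsilon>" "\<epsilon> \<le> 1"
  shows "\<epsilon> * (\<integral>x. 1 / dens_w \<epsilon> (x $ 3) \<partial>dvg) \<le> 2" "integrable dvg (\<lambda>x. 1 / dens_w \<epsilon> (x $ 3))"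
proof -
  have ne: "dens_w \<epsilon> z \<noteq> 0" if "z \<in> {-1..1}" for z using dens_w_pos[of z \<epsilon>] that by (auto simp: abs_le_iff)
  have c: "continuous_on {-1..1} (\<lambda>z. 1 / dens_w \<epsilon> z)"
    using ne by (intro continuous_intros continuous_on_dens) auto
  show "integrable dvg (\<lambda>x. 1 / dens_w \<epsilon> (x $ 3))" by (rule integral_zonal(2)[OF c])
  have w: "0 < dens_w \<epsilon> (cos s)" "dens_w \<epsilon> (cos s) \<noteq> 0" for s using dens_w_pos[of "cos s" \<epsilon>] by auto
  \<comment> \<open>Its derivative contains the integrand up to the bounded part
    \<open>(sin s)^3 / dens_w \<epsilon> (cos s)\<close>, and its increment is the value of the
    potential at a pole.\<close>
  let ?F = "\<lambda>s. - cos s * dens_k \<epsilon> (cos s) / 2"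
  let ?f = "\<lambda>s. sin s * dens_k \<epsilon> (cos s) / 2 + (cos s)\<^sup>2 * sin s / dens_w \<epsilon> (cos s)"
  have F: "(?f has_integral (?F pi - ?F 0)) {0..pi}"
  proof (rule fundamental_theorem_of_calculus)
    fix s :: real
    have "((\<lambda>s. dens_k \<epsilon> (cos s)) has_real_derivative (2 * cos s / dens_w \<epsilon> (cos s)) * (- sin s)) (at s within {0..pi})"
      by (rule has_field_derivative_at_within, rule DERIV_chain2[OF dens_k_deriv[OF w(1)] DERIV_cos])
    then have "(?F has_real_derivative ?f s) (at s within {0..pi})"
      using w(2)[of s] by (auto intro!: derivative_eq_intros simp: power2_eq_square field_simps)
    then show "(?F has_vector_derivative ?f s) (at s within {0..pi})"
      by (simp only: has_real_derivative_iff_has_vector_derivative)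
  qed simp
  have k1: "dens_k \<epsilon> 1 = dens_k \<epsilon> (-1)" by (simp add: dens_k_def dens_w_def)
  have "integral {0..pi} (\<lambda>s. 1 / dens_w \<epsilon> (cos s) * sin s) \<le> integral {0..pi} (\<lambda>s. sin s + ?f s)"
  proof (rule integral_le)
    show "(\<lambda>s. 1 / dens_w \<epsilon> (cos s) * sin s) integrable_on {0..pi}" "(\<lambda>s. sin s + ?f s) integrable_on {0..pi}"
      using w by (intro integrable_continuous_interval continuous_intros continuous_on_dens; simp)+
    fix s assume s: "s \<in> {0..pi}"
    then have sin: "0 \<le> sin s" by (simp add: sin_ge_zero)
    have "(sin s)\<^sup>2 \<le> dens_w \<epsilon> (cos s)" using dens_e_pos[of \<epsilon>] by (simp add: dens_w_cos)
    then have "(sin s)\<^sup>2 / dens_w \<epsilon> (cos s) \<le> 1" using w(1)[of s] by simp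
    then have "(sin s)\<^sup>2 / dens_w \<epsilon> (cos s) * sin s \<le> 1 * sin s" using sin by (intro mult_right_mono)
    moreover have "1 / dens_w \<epsilon> (cos s) * sin s = (sin s)\<^sup>2 / dens_w \<epsilon> (cos s) * sin s + (cos s)\<^sup>2 * sin s / dens_w \<epsilon> (cos s)"
      by (simp add: cos_squared_eq algebra_simps diff_divide_distrib)
    moreover have "0 \<le> sin s * dens_k \<epsilon> (cos s) / 2" using sin dens_k_nonneg[of "cos s" \<epsilon>] by simp
    ultimately show "1 / dens_w \<epsilon> (cos s) * sin s \<le> sin s + ?f s" by linarith
  qed
  also have "\<dots> = 2 + dens_k \<epsilon> 1"
  proof -
    have "sin integrable_on {0..pi}" by (intro integrable_continuous_interval continuous_intros)
    moreover have "?f integrable_on {0..pi}" using F by blast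
    ultimately have "integral {0..pi} (\<lambda>s. sin s + ?f s) = integral {0..pi} sin + integral {0..pi} ?f"
      by (rule integral_add)
    then show ?thesis using integral_unique[OF F] by (simp add: integral_sin_0_pi k1)
  qed
  also have "dens_k \<epsilon> 1 \<le> 1 + 1 / \<epsilon>" using dens_k_le[OF assms(1), of 1] dens_e_le_1[OF assms(1)] by simp
  finally have "(\<integral>x. 1 / dens_w \<epsilon> (x $ 3) \<partial>dvg) \<le> (3 + 1 / \<epsilon>) / 2"
    by (simp add: integral_zonal(1)[OF c])
  then have "\<epsilon> * (\<integral>x. 1 / dens_w \<epsilon> (x $ 3) \<partial>dvg) \<le> \<epsilon> * ((3 + 1 / \<epsilon>) / 2)"
    using assms by (intro mult_left_mono) auto
  also have "\<dots> = (3 * \<epsilon> + 1) / 2" using assms by (simp add: field_simps)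
  also have "\<dots> \<le> 2" using assms by simp
  finally show "\<epsilon> * (\<integral>x. 1 / dens_w \<epsilon> (x $ 3) \<partial>dvg) \<le> 2" .
qed

text \<open>Fourth roots: \<open>ln y = 4 * ln (sqrt (sqrt y))\<close> is at most
  \<open>4 * sqrt (sqrt y)\<close>, so the square grows only like \<open>sqrt y\<close>. The
  constant is \<open>16 * (3 / 2)\<close>, where 3 / 2 bounds
  \<open>sqrt (1 + dens_e \<epsilon>)\<close>.\<close>

lemma dens_k_sq_le:
  assumes "0 < \<epsilon>" "\<bar>z\<bar> \<le> 1"
  shows "(dens_k \<epsilon> z)\<^sup>2 \<le> 24 / sqrt (dens_w \<epsilon> z)"
proof -
  let ?X = "(1 + dens_e \<epsilon>) / dens_w \<epsilon> z"
  have X: "0 < ?X" using dens_w_pos[OF assms(2), of \<epsilon>] dens_e_pos[of \<epsilon>] by simp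
  have "dens_k \<epsilon> z = 4 * ln (sqrt (sqrt ?X))"
  proof -
    have "ln y = 4 * ln (sqrt (sqrt y))" if "0 < y" for y :: real
      using that by (simp add: ln_sqrt)
    then show ?thesis unfolding dens_k_def using X by blast
  qed
  also have "\<dots> \<le> 4 * sqrt (sqrt ?X)"
    using ln_le_minus_one[of "sqrt (sqrt ?X)"] X by (simp del: ln_sqrt)
  finally have "(dens_k \<epsilon> z)\<^sup>2 \<le> (4 * sqrt (sqrt ?X))\<^sup>2"
    using dens_k_nonneg[OF assms(2)] by (intro power_mono)
  also have "\<dots> = 16 * sqrt ?X" using X by (simp add: power_mult_distrib)
  also have "\<dots> = 16 * sqrt (1 + dens_e \<epsilon>) / sqrt (dens_w \<epsilon> z)" by (simp add: real_sqrt_divide)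
  also have "\<dots> \<le> 24 / sqrt (dens_w \<epsilon> z)"
  proof (intro divide_right_mono)
    have "sqrt (1 + dens_e \<epsilon>) \<le> 3 / 2"
      using dens_e_le_1[OF assms(1)] by (intro real_le_lsqrt) (auto simp: power2_eq_square)
    then show "16 * sqrt (1 + dens_e \<epsilon>) \<le> 24" by simp
  qed (use dens_w_pos[OF assms(2), of \<epsilon>] in simp)
  finally show ?thesis .
qed

section \<open>The Orlicz-Sobolev norm of the test function\<close>

lemma ln_2_ge_half: "1 / 2 \<le> ln (2::real)"
  using ln_le_minus_one[of "1/2"] by (simp add: ln_div)

text \<open>The gradient norm of \<open>\<epsilon> * (dens_k \<epsilon> z)\<^sup>2\<close>, which is
  12000 times the test function; the inner square is that of its derivative in
  \<open>z\<close>.\<close>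

definition test_grad :: "real \<Rightarrow> real \<Rightarrow> real" where
  "test_grad \<epsilon> z = sqrt (4 * pi * ((4 * \<epsilon> * dens_k \<epsilon> z * z / dens_w \<epsilon> z)\<^sup>2 * (1 - z\<^sup>2)))"

text \<open>
  Where \<open>h\<^sup>4 w > 1\<close> the logarithm of the gradient norm \<open>h\<close> is comparable to \<open>dens_k\<close>, and this
  cancels one of the two factors \<open>dens_k\<close> in \<open>h\<^sup>2\<close>.
\<close>

lemma test_grad_young:
  assumes \<epsilon>: "0 < \<epsilon>" "\<epsilon> \<le> 1" and z: "\<bar>z\<bar> \<le> 1"
  shows "(test_grad \<epsilon> z)\<^sup>2 / ln (2 + test_grad \<epsilon> z) \<le> 2 / sqrt (dens_w \<epsilon> z) + 640 * pi * (\<epsilon> * (1 / dens_w \<epsilon> z))"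
proof -
  define h where "h = test_grad \<epsilon> z"
  define k where "k = dens_k \<epsilon> z"
  define w where "w = dens_w \<epsilon> z"
  define e where "e = dens_e \<epsilon>"
  have e: "0 < e" "e \<le> 1" using dens_e_pos dens_e_le_1[OF \<epsilon>(1)] by (auto simp: e_def)
  have w: "0 < w" "1 - z\<^sup>2 \<le> w" using dens_w_pos[OF z, of \<epsilon>] e by (auto simp: w_def dens_w_def e_def)
  have k: "0 \<le> k" "\<epsilon> * k \<le> 2" using dens_k_nonneg[OF z, of \<epsilon>] eps_dens_k_le[OF \<epsilon> z] by (auto simp: k_def)
  have z2: "z\<^sup>2 \<le> 1" "0 \<le> 1 - z\<^sup>2" using z abs_square_le_1[of z] by auto
  have h0: "0 \<le> h" using z2 by (simp add: h_def test_grad_def)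
  have "h\<^sup>2 = 4 * pi * ((4 * \<epsilon> * k * z / w)\<^sup>2 * (1 - z\<^sup>2))"
    using z2 by (simp add: h_def test_grad_def k_def w_def)
  also have "\<dots> = 64 * pi * (\<epsilon>\<^sup>2 * k\<^sup>2 / w\<^sup>2) * (z\<^sup>2 * (1 - z\<^sup>2))"
    by (simp add: power_mult_distrib power_divide)
  also have "\<dots> \<le> 64 * pi * (\<epsilon>\<^sup>2 * k\<^sup>2 / w\<^sup>2) * (1 * w)"
    using z2 w by (intro mult_left_mono mult_mono) auto
  also have "\<dots> = 64 * pi * (\<epsilon>\<^sup>2 * k\<^sup>2 / w)" using w by (simp add: power2_eq_square)
  finally have h2: "h\<^sup>2 \<le> 64 * pi * (\<epsilon>\<^sup>2 * k\<^sup>2 / w)" .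
  note ln2 = ln_2_ge_half
  have lnh: "ln 2 \<le> ln (2 + h)" using h0 by simp
  have pos: "0 < ln (2 + h)" using ln2 lnh by linarith
  show ?thesis
  proof (cases "h^4 * w \<le> 1")
    \<comment> \<open>Small gradient: \<open>h\<^sup>2\<close> is already below
      \<open>1 / sqrt w\<close>, and the logarithm is at least 1/2.\<close>
    case True
    then have "(h\<^sup>2)\<^sup>2 \<le> 1 / w" using w by (simp add: field_simps)
    then have "h\<^sup>2 \<le> sqrt (1 / w)" by (rule real_le_rsqrt)
    then have "h\<^sup>2 \<le> 1 / sqrt w" by (simp add: real_sqrt_divide)
    then have "h\<^sup>2 / ln (2 + h) \<le> (1 / sqrt w) / (1/2)"
      using lnh ln2 w by (intro frac_le) auto
    moreover have "0 \<le> 640 * pi * (\<epsilon> * (1 / w))" using \<epsilon> w by simp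
    ultimately show ?thesis by (simp add: h_def w_def)
  next
    case False
    then have hp: "0 < h" using h0 by (cases "h = 0") auto
    have "1 / w \<le> h^4" using False w by (simp add: field_simps)
    then have "ln (1 / w) \<le> ln (h^4)" using w by (intro ln_mono) auto
    also have "\<dots> = 4 * ln h" using hp by (simp add: ln_realpow)
    also have "\<dots> \<le> 4 * ln (2 + h)" using hp by simp
    finally have lw: "ln (1 / w) \<le> 4 * ln (2 + h)" .
    have "k = ln (1 + e) + ln (1 / w)"
      using w e by (simp add: k_def dens_k_def e_def w_def ln_div)
    moreover have "ln (1 + e) \<le> ln 2" using e by simp
    ultimately have k5: "k \<le> 5 * ln (2 + h)" using lw lnh by linarith
    \<comment> \<open>One factor \<open>\<epsilon> * k\<close> is at most 2 and the remaining
      \<open>k\<close> at most five logarithms; with the 64 from the gradient this makes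
      640.\<close>
    have "\<epsilon>\<^sup>2 * k\<^sup>2 = \<epsilon> * (\<epsilon> * k) * k" by (simp add: power2_eq_square)
    also have "\<dots> \<le> \<epsilon> * 2 * (5 * ln (2 + h))"
      using \<epsilon> k k5 by (intro mult_mono) auto
    finally have "\<epsilon>\<^sup>2 * k\<^sup>2 / w \<le> \<epsilon> * 2 * (5 * ln (2 + h)) / w"
      using w by (intro divide_right_mono) auto
    then have "64 * pi * (\<epsilon>\<^sup>2 * k\<^sup>2 / w) \<le> 64 * pi * (\<epsilon> * 2 * (5 * ln (2 + h)) / w)"
      by (intro mult_left_mono) auto
    then have "h\<^sup>2 \<le> 640 * pi * (\<epsilon> * (1 / w)) * ln (2 + h)" using h2 by (simp add: algebra_simps)
    then have "h\<^sup>2 / ln (2 + h) \<le> 640 * pi * (\<epsilon> * (1 / w))"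
      using pos by (simp only: pos_divide_le_eq)
    moreover have "0 \<le> 2 / sqrt w" using w by simp
    ultimately show ?thesis unfolding h_def w_def by linarith
  qed
qed

text \<open>12000 is \<open>2 * 6000\<close>: 6000 exceeds \<open>1281 * pi\<close>, the bound
  obtained for the Orlicz integral of the undivided gradient, and 2 halves the norm for each of the
  two contributions.\<close>

definition test_fn :: "real \<Rightarrow> real \<Rightarrow> real" where
  "test_fn \<epsilon> z = \<epsilon> * (dens_k \<epsilon> z)\<^sup>2 / 12000"

lemma test_fn_class: "test_fn \<epsilon> \<in> zonal_class \<epsilon>"
proof -
  have "(\<lambda>z. (\<epsilon> / 12000) * (dens_k \<epsilon> z * dens_k \<epsilon> z)) \<in> zonal_class \<epsilon>"
    by (intro zonal_class.intros)
  then show ?thesis by (simp add: test_fn_def[abs_def] power2_eq_square mult.assoc)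
qed

lemma nn_integral_zonal_le:
  assumes le: "\<And>z. \<bar>z\<bar> \<le> 1 \<Longrightarrow> f z \<le> h z" and i: "integrable dvg (\<lambda>x. h (x $ 3))"
    and nn: "\<And>z. \<bar>z\<bar> \<le> 1 \<Longrightarrow> 0 \<le> f z" and b: "(\<integral>x. h (x $ 3) \<partial>dvg) \<le> b"
  shows "(\<integral>\<^sup>+x. ennreal (f (x $ 3)) \<partial>dvg) \<le> ennreal b"
proof -
  have "(\<integral>\<^sup>+x. ennreal (f (x $ 3)) \<partial>dvg) \<le> (\<integral>\<^sup>+x. ennreal (h (x $ 3)) \<partial>dvg)"
    by (intro nn_integral_mono ennreal_leI le abs_S2_3) simp
  also have "\<dots> = ennreal (\<integral>x. h (x $ 3) \<partial>dvg)"
  proof (rule nn_integral_eq_integral[OF i], rule AE_I2)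
    fix x assume "x \<in> space dvg"
    then have "\<bar>x $ 3\<bar> \<le> 1" by (intro abs_S2_3) simp
    then show "0 \<le> h (x $ 3)" using le nn order_trans by blast
  qed
  also have "\<dots> \<le> ennreal b" using b by (rule ennreal_leI)
  finally show ?thesis .
qed

lemma young_measurable:
  assumes "continuous_on S2 h" "\<And>x. x \<in> S2 \<Longrightarrow> 0 \<le> h x"
  shows "(\<lambda>x. ennreal ((h x)\<^sup>2 / ln (2 + h x))) \<in> borel_measurable dvg"
proof -
  have ne: "2 + h x \<noteq> 0" "ln (2 + h x) \<noteq> 0" if "x \<in> S2" for x
    using assms(2)[OF that] ln_gt_zero[of "2 + h x"] by auto
  have "continuous_on S2 (\<lambda>x. (h x)\<^sup>2 / ln (2 + h x))"
    using ne by (intro continuous_intros assms(1)) auto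
  from borel_measurable_dvg[OF this] show ?thesis by simp
qed

text \<open>Since \<open>\<epsilon> * k \<le> 2\<close>, the square of
  \<open>\<epsilon> * k\<^sup>2\<close> is at most \<open>4 * k\<^sup>2\<close>, whose integral
  \<open>dens_k_sq_le\<close> bounds uniformly in \<open>\<epsilon>\<close>. Here the logarithm
  enters only through its lower bound 1/2.\<close>

lemma test_fn_norm:
  assumes \<epsilon>: "0 < \<epsilon>" "\<epsilon> \<le> 1"
  shows "orlicz_norm (\<lambda>x. test_fn \<epsilon> (x $ 3)) \<le> ennreal (1/2)"
proof (rule orlicz_norm_le_half[where n = 6000 and h = "\<lambda>x. \<epsilon> * (dens_k \<epsilon> (x $ 3))\<^sup>2"])
  show nn: "0 \<le> \<epsilon> * (dens_k \<epsilon> (x $ 3))\<^sup>2" for x :: "real^3" using \<epsilon> by simp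
  show "\<bar>test_fn \<epsilon> (x $ 3)\<bar> = \<epsilon> * (dens_k \<epsilon> (x $ 3))\<^sup>2 / (2 * real 6000)" for x :: "real^3"
    using \<epsilon> by (simp add: test_fn_def)
  show "(\<lambda>x::real^3. ennreal ((\<epsilon> * (dens_k \<epsilon> (x $ 3))\<^sup>2)\<^sup>2 / ln (2 + \<epsilon> * (dens_k \<epsilon> (x $ 3))\<^sup>2))) \<in> borel_measurable dvg"
    by (rule young_measurable) (use nn in \<open>auto intro!: continuous_intros continuous_on_dens_S2\<close>)
  have "(\<integral>\<^sup>+x. ennreal ((\<epsilon> * (dens_k \<epsilon> (x $ 3))\<^sup>2)\<^sup>2 / ln (2 + \<epsilon> * (dens_k \<epsilon> (x $ 3))\<^sup>2)) \<partial>dvg) \<le> ennreal (192 * (pi / 2))"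
  proof (rule nn_integral_zonal_le[where h = "\<lambda>z. 192 * (1 / sqrt (dens_w \<epsilon> z))"])
    fix z :: real assume z: "\<bar>z\<bar> \<le> 1"
    let ?k = "dens_k \<epsilon> z"
    have k: "0 \<le> ?k" "\<epsilon> * ?k \<le> 2" using dens_k_nonneg[OF z] eps_dens_k_le[OF \<epsilon> z] by auto
    have h0: "0 \<le> \<epsilon> * ?k\<^sup>2" using \<epsilon> by simp
    have L: "1 / 2 \<le> ln (2 + \<epsilon> * ?k\<^sup>2)"
    proof -
      have "ln 2 \<le> ln (2 + \<epsilon> * ?k\<^sup>2)" using h0 by (intro ln_mono) auto
      then show ?thesis using ln_2_ge_half by linarith
    qed
    have "(\<epsilon> * ?k\<^sup>2)\<^sup>2 = (\<epsilon> * ?k)\<^sup>2 * ?k\<^sup>2" by (simp add: power2_eq_square)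
    also have "\<dots> \<le> 2\<^sup>2 * (24 / sqrt (dens_w \<epsilon> z))"
      using k \<epsilon> by (intro mult_mono power_mono dens_k_sq_le z) auto
    finally have "(\<epsilon> * ?k\<^sup>2)\<^sup>2 / ln (2 + \<epsilon> * ?k\<^sup>2) \<le> (2\<^sup>2 * (24 / sqrt (dens_w \<epsilon> z))) / (1 / 2)"
      using L dens_w_pos[OF z, of \<epsilon>] by (intro frac_le) auto
    then show "(\<epsilon> * ?k\<^sup>2)\<^sup>2 / ln (2 + \<epsilon> * ?k\<^sup>2) \<le> 192 * (1 / sqrt (dens_w \<epsilon> z))" by simp
    show "0 \<le> (\<epsilon> * ?k\<^sup>2)\<^sup>2 / ln (2 + \<epsilon> * ?k\<^sup>2)" using L by simp
  next
    show "integrable dvg (\<lambda>x. 192 * (1 / sqrt (dens_w \<epsilon> (x $ 3))))"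
      by (intro integrable_mult_right integral_recip_sqrt_w(2) \<epsilon>)
    show "(\<integral>x. 192 * (1 / sqrt (dens_w \<epsilon> (x $ 3))) \<partial>dvg) \<le> 192 * (pi / 2)"
      using integral_recip_sqrt_w(1)[OF \<epsilon>(1)] by (simp del: times_divide_eq_right)
  qed
  also have "\<dots> \<le> ennreal (real 6000)" using pi_less_4 by (intro ennreal_leI) simp
  finally show "(\<integral>\<^sup>+x. ennreal ((\<epsilon> * (dens_k \<epsilon> (x $ 3))\<^sup>2)\<^sup>2 / ln (2 + \<epsilon> * (dens_k \<epsilon> (x $ 3))\<^sup>2)) \<partial>dvg) \<le> ennreal (real 6000)" .
qed simp

lemma test_fn_deriv:
  assumes "z \<in> {-1..1}"
  shows "(test_fn \<epsilon> has_real_derivative (4 * \<epsilon> * dens_k \<epsilon> z * z / dens_w \<epsilon> z) / 12000) (at z)"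
proof -
  have "0 < dens_w \<epsilon> z" using assms by (intro dens_w_pos) auto
  then show ?thesis
    unfolding test_fn_def[abs_def] by (auto intro!: derivative_eq_intros)
qed

lemma test_fn_deriv_continuous: "continuous_on {-1..1} (\<lambda>z. (4 * \<epsilon> * dens_k \<epsilon> z * z / dens_w \<epsilon> z) / 12000)"
proof -
  have "dens_w \<epsilon> z \<noteq> 0" if "z \<in> {-1..1}" for z using dens_w_pos[of z \<epsilon>] that by (auto simp: abs_le_iff)
  then show ?thesis by (intro continuous_intros continuous_on_dens) auto
qed

text \<open>Of the two terms in \<open>test_grad_young\<close> the first has a bounded integral by
  itself, the second precisely because of the factor \<open>\<epsilon>\<close> that the logarithm
  has saved.\<close>

lemma test_grad_norm:
  assumes \<epsilon>: "0 < \<epsilon>" "\<epsilon> \<le> 1"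
  shows "orlicz_norm (\<lambda>x. gnorm (grad_S2 (\<lambda>x. test_fn \<epsilon> (x $ 3)) x)) \<le> ennreal (1/2)"
proof (rule orlicz_norm_le_half[where n = 6000 and h = "\<lambda>x. test_grad \<epsilon> (x $ 3)"])
  have nnz: "0 \<le> test_grad \<epsilon> z" if "\<bar>z\<bar> \<le> 1" for z
    using that abs_square_le_1[of z] by (simp add: test_grad_def)
  show nn: "0 \<le> test_grad \<epsilon> (x $ 3)" if "x \<in> S2" for x :: "real^3"
    by (rule nnz[OF abs_S2_3[OF that]])
  show "\<bar>gnorm (grad_S2 (\<lambda>x. test_fn \<epsilon> (x $ 3)) x)\<bar> = test_grad \<epsilon> (x $ 3) / (2 * real 6000)" if x: "x \<in> S2" for x
  proof -
    let ?z = "x $ 3"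
    have z: "\<bar>?z\<bar> \<le> 1" by (rule abs_S2_3[OF x])
    have "(gnorm (grad_S2 (\<lambda>x. test_fn \<epsilon> (x $ 3)) x))\<^sup>2
      = 4 * pi * (((4 * \<epsilon> * dens_k \<epsilon> ?z * ?z / dens_w \<epsilon> ?z) / 12000)\<^sup>2 * (1 - ?z\<^sup>2))"
      by (rule gnorm_grad_zonal[OF test_fn_deriv test_fn_deriv_continuous x])
    also have "\<dots> = (test_grad \<epsilon> ?z / 12000)\<^sup>2"
    proof -
      have eq: "4 * pi * ((X / 12000)\<^sup>2 * y) = (sqrt (4 * pi * (X\<^sup>2 * y)) / 12000)\<^sup>2" if "0 \<le> y" for X y :: real
        using that by (simp add: power_divide)
      show ?thesis unfolding test_grad_def by (rule eq) (use z abs_square_le_1[of ?z] in simp)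
    qed
    finally have sq: "(gnorm (grad_S2 (\<lambda>x. test_fn \<epsilon> (x $ 3)) x))\<^sup>2 = (test_grad \<epsilon> ?z / 12000)\<^sup>2" .
    have "0 \<le> gnorm v" for v by (simp add: gnorm_def g_round_def)
    moreover have "gnorm (grad_S2 (\<lambda>x. test_fn \<epsilon> (x $ 3)) x) = test_grad \<epsilon> ?z / 12000"
      by (rule power2_eq_imp_eq[OF sq]) (use nnz[OF z] in \<open>simp_all add: gnorm_def g_round_def\<close>)
    ultimately show ?thesis by simp
  qed
  have "continuous_on S2 (\<lambda>x. test_grad \<epsilon> (x $ 3))"
    unfolding test_grad_def using dens_w_pos[OF abs_S2_3]
    by (intro continuous_intros continuous_on_dens_S2) (auto simp: less_imp_neq[symmetric])
  then show "(\<lambda>x::real^3. ennreal ((test_grad \<epsilon> (x $ 3))\<^sup>2 / ln (2 + test_grad \<epsilon> (x $ 3)))) \<in> borel_measurable dvg"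
    by (rule young_measurable) (rule nn)
  have "(\<integral>\<^sup>+x. ennreal ((test_grad \<epsilon> (x $ 3))\<^sup>2 / ln (2 + test_grad \<epsilon> (x $ 3))) \<partial>dvg) \<le> ennreal (2 * (pi / 2) + 640 * pi * 2)"
  proof (rule nn_integral_zonal_le[where h = "\<lambda>z. 2 * (1 / sqrt (dens_w \<epsilon> z)) + 640 * pi * (\<epsilon> * (1 / dens_w \<epsilon> z))"])
    fix z :: real assume z: "\<bar>z\<bar> \<le> 1"
    show "(test_grad \<epsilon> z)\<^sup>2 / ln (2 + test_grad \<epsilon> z) \<le> 2 * (1 / sqrt (dens_w \<epsilon> z)) + 640 * pi * (\<epsilon> * (1 / dens_w \<epsilon> z))"
      using test_grad_young[OF \<epsilon> z] by simp
    show "0 \<le> (test_grad \<epsilon> z)\<^sup>2 / ln (2 + test_grad \<epsilon> z)"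
      using nnz[OF z] by (intro divide_nonneg_nonneg ln_ge_zero) auto
  next
    have i: "integrable dvg (\<lambda>x. 2 * (1 / sqrt (dens_w \<epsilon> (x $ 3))))" "integrable dvg (\<lambda>x. 640 * pi * (\<epsilon> * (1 / dens_w \<epsilon> (x $ 3))))"
      by (intro integrable_mult_right integral_recip_sqrt_w(2) integral_recip_w(2) \<epsilon>)+
    then show "integrable dvg (\<lambda>x. 2 * (1 / sqrt (dens_w \<epsilon> (x $ 3))) + 640 * pi * (\<epsilon> * (1 / dens_w \<epsilon> (x $ 3))))"
      by (rule Bochner_Integration.integrable_add)
    have "(\<integral>x. 2 * (1 / sqrt (dens_w \<epsilon> (x $ 3))) + 640 * pi * (\<epsilon> * (1 / dens_w \<epsilon> (x $ 3))) \<partial>dvg)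
      = 2 * (\<integral>x. 1 / sqrt (dens_w \<epsilon> (x $ 3)) \<partial>dvg) + 640 * pi * (\<epsilon> * (\<integral>x. 1 / dens_w \<epsilon> (x $ 3) \<partial>dvg))"
      unfolding Bochner_Integration.integral_add[OF i] by (simp only: Bochner_Integration.integral_mult_right_zero)
    also have "\<dots> \<le> 2 * (pi / 2) + 640 * pi * 2"
      by (intro add_mono mult_left_mono integral_recip_sqrt_w(1) integral_recip_w(1) \<epsilon>) auto
    finally show "(\<integral>x. 2 * (1 / sqrt (dens_w \<epsilon> (x $ 3))) + 640 * pi * (\<epsilon> * (1 / dens_w \<epsilon> (x $ 3))) \<partial>dvg) \<le> 2 * (pi / 2) + 640 * pi * 2" .
  qed
  also have "\<dots> \<le> ennreal (real 6000)" using pi_less_4 by (intro ennreal_leI) simp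
  finally show "(\<integral>\<^sup>+x. ennreal ((test_grad \<epsilon> (x $ 3))\<^sup>2 / ln (2 + test_grad \<epsilon> (x $ 3))) \<partial>dvg) \<le> ennreal (real 6000)" .
qed simp

lemma test_fn_sobolev_norm:
  assumes "0 < \<epsilon>" "\<epsilon> \<le> 1"
  shows "orlicz_sobolev_norm (\<lambda>x. test_fn \<epsilon> (x $ 3)) \<le> 1"
proof -
  let ?u = "\<lambda>x::real^3. test_fn \<epsilon> (x $ 3)"
  have "weak_grad ?u (grad_S2 ?u)"
    by (intro weak_grad_smooth smooth_S2_C1 smooth_zonal[OF test_fn_class])
  then have "orlicz_sobolev_norm ?u \<le> orlicz_norm ?u + orlicz_norm (\<lambda>x. gnorm (grad_S2 ?u x))"
    unfolding orlicz_sobolev_norm_def by (intro INF_lower) simp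
  also have "\<dots> \<le> ennreal (1/2) + ennreal (1/2)"
    by (intro add_mono test_fn_norm test_grad_norm assms)
  also have "\<dots> = ennreal (1/2 + 1/2)" by (rule ennreal_plus[symmetric]) auto
  finally show ?thesis by simp
qed

text \<open>Where the fourth power of \<open>dens_w \<epsilon> z\<close> is at most
  \<open>dens_e \<epsilon>\<close>, the potential is at least \<open>1 / (4 * \<epsilon>)\<close>,
  whence 1/16. Elsewhere the peak is below \<open>sqrt (dens_e \<epsilon>)\<close> and the left-hand
  side is not positive.\<close>

lemma dens_k_weight_lower:
  assumes "0 < \<epsilon>" "\<bar>z\<bar> \<le> 1"
  shows "1 / 16 * (dens_e \<epsilon> / (dens_w \<epsilon> z)\<^sup>2 - sqrt (dens_e \<epsilon>)) \<le> (\<epsilon> * dens_k \<epsilon> z)\<^sup>2 * (dens_e \<epsilon> / (dens_w \<epsilon> z)\<^sup>2)"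
proof -
  let ?e = "dens_e \<epsilon>" and ?w = "dens_w \<epsilon> z"
  have e: "0 < ?e" by (rule dens_e_pos)
  have w: "0 < ?w" by (rule dens_w_pos[OF assms(2)])
  show ?thesis
  proof (cases "?w^4 \<le> ?e")
    case True
    then have "ln (?w^4) \<le> ln ?e" using w by (intro ln_mono) auto
    then have "4 * ln ?w \<le> - 1 / \<epsilon>" using w by (simp add: ln_realpow dens_e_def)
    moreover have "dens_k \<epsilon> z = ln (1 + ?e) - ln ?w"
      unfolding dens_k_def using e w by (intro ln_divide_pos) auto
    moreover have "0 \<le> ln (1 + ?e)" using e by simp
    ultimately have "1 / \<epsilon> \<le> 4 * dens_k \<epsilon> z" by simp
    then have "1 / 4 \<le> \<epsilon> * dens_k \<epsilon> z" using assms(1) by (simp add: field_simps)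
    then have "(1 / 4)\<^sup>2 \<le> (\<epsilon> * dens_k \<epsilon> z)\<^sup>2" by (intro power_mono) auto
    then have "1 / 16 * (?e / ?w\<^sup>2) \<le> (\<epsilon> * dens_k \<epsilon> z)\<^sup>2 * (?e / ?w\<^sup>2)"
      using e by (intro mult_right_mono) (auto simp: power2_eq_square)
    moreover have "0 \<le> sqrt ?e" using e by simp
    ultimately show ?thesis unfolding right_diff_distrib by linarith
  next
    case False
    then have "?e \<le> (?w\<^sup>2)\<^sup>2" by simp
    then have "sqrt ?e \<le> ?w\<^sup>2" using real_le_lsqrt zero_le_power2 by blast
    then have "sqrt ?e * sqrt ?e \<le> sqrt ?e * ?w\<^sup>2" using e by (intro mult_left_mono) auto
    then have "?e / ?w\<^sup>2 \<le> sqrt ?e" using e w by (simp add: field_simps)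
    then have "1 / 16 * (?e / ?w\<^sup>2 - sqrt ?e) \<le> 0" by simp
    also have "0 \<le> (\<epsilon> * dens_k \<epsilon> z)\<^sup>2 * (?e / ?w\<^sup>2)" using e by simp
    finally show ?thesis .
  qed
qed

text \<open>The area measure sees at most \<open>48 * \<epsilon>\<close> of
  \<open>\<epsilon> * k\<^sup>2\<close>, while the peak of \<open>dens_N\<close> alone gives at
  least 1/256, hence 1/512 after division by \<open>dens_c \<epsilon> \<le> 2\<close>. The threshold
  1/50000 keeps \<open>48 * \<epsilon>\<close> below half of that.\<close>

lemma mu_diff_test_fn:
  assumes \<epsilon>: "0 < \<epsilon>" "\<epsilon> \<le> 1 / 50000"
  shows "1 / (12000 * 1024) \<le> mu_diff \<epsilon> (\<lambda>x. test_fn \<epsilon> (x $ 3))"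
proof -
  let ?e = "dens_e \<epsilon>" and ?k = "\<lambda>x::real^3. dens_k \<epsilon> (x $ 3)" and ?w = "\<lambda>x::real^3. dens_w \<epsilon> (x $ 3)"
  define A where "A = (\<integral>x. \<epsilon> * (?k x)\<^sup>2 \<partial>dvg)"
  define B where "B = (\<integral>x. dens_N \<epsilon> (x $ 3) * (\<epsilon> * (?k x)\<^sup>2) \<partial>dvg)"
  have iA: "integrable dvg (\<lambda>x. \<epsilon> * (?k x)\<^sup>2)" and iB: "integrable dvg (\<lambda>x. dens_N \<epsilon> (x $ 3) * (\<epsilon> * (?k x)\<^sup>2))"
    by (intro dvg_integral_vec(1) continuous_intros continuous_on_dens_S2)+
  have "A \<le> (\<integral>x. \<epsilon> * (24 * (1 / sqrt (?w x))) \<partial>dvg)"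
    unfolding A_def
  proof (rule integral_mono[OF iA])
    show "integrable dvg (\<lambda>x. \<epsilon> * (24 * (1 / sqrt (?w x))))"
      by (intro integrable_mult_right integral_recip_sqrt_w(2) \<epsilon>)
    show "\<epsilon> * (?k x)\<^sup>2 \<le> \<epsilon> * (24 * (1 / sqrt (?w x)))" if "x \<in> space dvg" for x
      using dens_k_sq_le[OF \<epsilon>(1) abs_S2_3, of x] that \<epsilon> by (intro mult_left_mono) auto
  qed
  also have "\<dots> = \<epsilon> * (24 * (\<integral>x. 1 / sqrt (?w x) \<partial>dvg))"
    by (simp only: Bochner_Integration.integral_mult_right_zero)
  also have "\<dots> \<le> \<epsilon> * (24 * (pi / 2))"
    using \<epsilon> by (intro mult_left_mono integral_recip_sqrt_w(1)) auto
  also have "\<dots> \<le> \<epsilon> * 48" using \<epsilon> pi_less_4 by (intro mult_left_mono) auto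
  also have "\<dots> \<le> 1 / 1024" using \<epsilon> by simp
  finally have A: "A \<le> 1 / 1024" .
  define I where "I = (\<integral>x. ?e / (?w x)\<^sup>2 \<partial>dvg)"
  have I: "1 / 4 \<le> I" using integral_e_div_w2[OF \<epsilon>(1)] by (simp add: I_def)
  have "sqrt ?e = exp (- (1 / (2 * \<epsilon>)))"
  proof (rule real_sqrt_unique)
    have "(exp (- (1 / (2 * \<epsilon>))))\<^sup>2 = exp (- (1 / (2 * \<epsilon>)) + - (1 / (2 * \<epsilon>)))"
      by (simp only: power2_eq_square exp_add)
    then show "(exp (- (1 / (2 * \<epsilon>))))\<^sup>2 = ?e" using \<epsilon> by (simp add: dens_e_def field_simps)
  qed simp
  also have "\<dots> \<le> 1 / (1 / (2 * \<epsilon>))"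
  proof -
    have "1 / (2 * \<epsilon>) \<le> exp (1 / (2 * \<epsilon>))" using exp_ge_add_one_self[of "1 / (2 * \<epsilon>)"] by linarith
    then have "1 / exp (1 / (2 * \<epsilon>)) \<le> 1 / (1 / (2 * \<epsilon>))" using \<epsilon> by (intro divide_left_mono) auto
    then show ?thesis by (simp only: exp_minus inverse_eq_divide)
  qed
  also have "\<dots> \<le> 1 / 8" using \<epsilon> by simp
  finally have se: "sqrt ?e \<le> 1 / 8" .
  have "1 / 32 * (I - sqrt ?e) = (\<integral>x. 1 / 32 * (?e / (?w x)\<^sup>2 - sqrt ?e) \<partial>dvg)"
    using integrable_zonal_w2[of \<epsilon>] dvg.prob_space by (simp add: I_def)
  also have "\<dots> \<le> B"
    unfolding B_def
  proof (rule integral_mono[OF _ iB])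
    show "integrable dvg (\<lambda>x. 1 / 32 * (?e / (?w x)\<^sup>2 - sqrt ?e))"
      using integrable_zonal_w2[of \<epsilon>] by simp
    fix x assume "x \<in> space dvg"
    then have x: "x \<in> S2" by simp
    have "1 / 32 * (?e / (?w x)\<^sup>2 - sqrt ?e) \<le> 1 / 2 * ((\<epsilon> * ?k x)\<^sup>2 * (?e / (?w x)\<^sup>2))"
    proof -
      have half: "1 / 32 * a \<le> 1 / 2 * b" if "1 / 16 * a \<le> b" for a b :: real using that by simp
      show ?thesis by (rule half, rule dens_k_weight_lower[OF \<epsilon>(1) abs_S2_3[OF x]])
    qed
    \<comment> \<open>The \<open>\<epsilon>\<close> of the peak and the \<open>\<epsilon>\<close> of
      the test function combine to \<open>(\<epsilon> * k)\<^sup>2\<close>, which does not become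
      small at the poles.\<close>
    also have "\<dots> = (\<epsilon> / 2 * (?e / (?w x)\<^sup>2)) * (\<epsilon> * (?k x)\<^sup>2)" by (simp add: power2_eq_square)
    also have "\<dots> \<le> dens_N \<epsilon> (x $ 3) * (\<epsilon> * (?k x)\<^sup>2)"
      unfolding dens_N_def using \<epsilon> by (intro mult_right_mono) auto
    finally show "1 / 32 * (?e / (?w x)\<^sup>2 - sqrt ?e) \<le> dens_N \<epsilon> (x $ 3) * (\<epsilon> * (?k x)\<^sup>2)" .
  qed
  finally have "1 / 32 * (I - sqrt ?e) \<le> B" .
  moreover have "1 / 32 * (1 / 4 - 1 / 8) \<le> 1 / 32 * (I - sqrt ?e)"
    using I se by (intro mult_left_mono diff_mono) auto
  ultimately have B: "1 / 256 \<le> B" by simp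
  have c: "dens_c \<epsilon> \<le> 2" "1 \<le> dens_c \<epsilon>" using dens_c_bounds[OF \<epsilon>(1)] \<epsilon> by auto
  have "1 / 512 \<le> B / 2" using B by simp
  also have "\<dots> \<le> B / dens_c \<epsilon>" using B c by (intro divide_left_mono) auto
  finally have Bc: "1 / 512 \<le> B / dens_c \<epsilon>" .
  have "mu_diff \<epsilon> (\<lambda>x. test_fn \<epsilon> (x $ 3)) = (B / dens_c \<epsilon> - A) / 12000"
  proof -
    have "continuous_on S2 (\<lambda>x. \<epsilon> * (?k x)\<^sup>2)" by (intro continuous_intros continuous_on_dens_S2)
    from integral_mu_continuous(1)[OF \<epsilon>(1) this]
    have "(\<integral>x. \<epsilon> * (?k x)\<^sup>2 \<partial>mu \<epsilon>) = B / dens_c \<epsilon>" by (simp add: B_def)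
    then show ?thesis
      unfolding mu_diff_def test_fn_def Bochner_Integration.integral_divide_zero by (simp add: A_def diff_divide_distrib)
  qed
  also have "\<dots> \<ge> (1 / 512 - 1 / 1024) / 12000" using A Bc by (intro divide_right_mono diff_mono) auto
  finally show ?thesis by simp
qed

lemma dual_norm_lower:
  assumes "0 < \<epsilon>" "\<epsilon> \<le> 1 / 50000"
  shows "ennreal (1 / (12000 * 1024)) \<le> dual_norm (mu_diff \<epsilon>)"
proof -
  let ?u = "\<lambda>x::real^3. test_fn \<epsilon> (x $ 3)"
  have "ennreal (1 / (12000 * 1024)) \<le> ennreal \<bar>mu_diff \<epsilon> ?u\<bar>"
    using mu_diff_test_fn[OF assms] by (intro ennreal_leI) linarith
  also have "\<dots> \<le> dual_norm (mu_diff \<epsilon>)"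
    unfolding dual_norm_def using test_fn_sobolev_norm[of \<epsilon>] assms by (intro SUP_upper) auto
  finally show ?thesis .
qed

lemma Liminf_dual_norm: "0 < Liminf (at_right 0) (\<lambda>\<epsilon>. dual_norm (mu_diff \<epsilon>))"
proof -
  have "\<forall>\<^sub>F \<epsilon> in at_right 0. ennreal (1 / (12000 * 1024)) \<le> dual_norm (mu_diff \<epsilon>)"
    by (rule eventually_mono[OF eventually_at_right_real[of 0 "1/50000"]]) (simp, rule dual_norm_lower, auto)
  then have "ennreal (1 / (12000 * 1024)) \<le> Liminf (at_right 0) (\<lambda>\<epsilon>. dual_norm (mu_diff \<epsilon>))"
    by (rule Liminf_bounded)
  moreover have "0 < ennreal (1 / (12000 * 1024))" by simp
  ultimately show ?thesis by (rule less_le_trans[rotated])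
qed

section \<open>Compactness\<close>

lemma square_diff_le: "(a - b)\<^sup>2 \<le> 2 * a\<^sup>2 + 2 * b\<^sup>2" for a b :: real
  using zero_le_power2[of "a + b"] by (simp add: power2_eq_square algebra_simps)

text \<open>Completeness of L2, in the form that the definition of compactness asks for. On a
  probability space the sequence is Cauchy in L1, so a subsequence converges almost everywhere;
  Fatou's lemma upgrades this to convergence in L2.\<close>

lemma (in prob_space) L2_Cauchy_converges:
  fixes u :: "nat \<Rightarrow> 'a \<Rightarrow> real"
  assumes um: "\<And>n. u n \<in> borel_measurable M" and u2: "\<And>n. integrable M (\<lambda>x. (u n x)\<^sup>2)"
    and Cauchy: "\<And>e. e > 0 \<Longrightarrow> \<exists>N. \<forall>i\<ge>N. \<forall>j\<ge>N. (\<integral>x. (u i x - u j x)\<^sup>2 \<partial>M) < e"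
  shows "\<exists>r w. strict_mono r \<and> w \<in> borel_measurable M \<and> integrable M (\<lambda>x. (w x)\<^sup>2) \<and>
    (\<lambda>n. \<integral>x. (u (r n) x - w x)\<^sup>2 \<partial>M) \<longlonglongrightarrow> 0"
proof -
  note [measurable] = um
  have sq: "integrable M (\<lambda>x. (f x - g x)\<^sup>2)"
    if [measurable]: "f \<in> borel_measurable M" "g \<in> borel_measurable M"
      and "integrable M (\<lambda>x. (f x)\<^sup>2)" "integrable M (\<lambda>x. (g x)\<^sup>2)" for f g :: "'a \<Rightarrow> real"
  proof (rule Bochner_Integration.integrable_bound)
    show "integrable M (\<lambda>x. 2 * (f x)\<^sup>2 + 2 * (g x)\<^sup>2)" using that by auto
    show "AE x in M. norm ((f x - g x)\<^sup>2) \<le> norm (2 * (f x)\<^sup>2 + 2 * (g x)\<^sup>2)"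
      by (intro AE_I2) (simp add: square_diff_le)
  qed measurable
  have u1: "integrable M (u n)" for n
    using square_integrable_imp_integrable[OF um u2] .
  have d2: "integrable M (\<lambda>x. (u i x - u j x)\<^sup>2)" for i j
    by (intro sq um u2)
  have L1: "\<exists>N. \<forall>i\<ge>N. \<forall>j\<ge>N. (\<integral>x. norm (u i x - u j x) \<partial>M) < e" if e: "e > 0" for e
  proof -
    obtain N where N: "\<And>i j. i \<ge> N \<Longrightarrow> j \<ge> N \<Longrightarrow> (\<integral>x. (u i x - u j x)\<^sup>2 \<partial>M) < e\<^sup>2"
      using Cauchy[of "e\<^sup>2"] e by auto
    have "(\<integral>x. norm (u i x - u j x) \<partial>M) < e" if "i \<ge> N" "j \<ge> N" for i j
    proof -
      have i1: "integrable M (\<lambda>x. norm (u i x - u j x))" using u1 by auto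
      have "(\<integral>x. norm (u i x - u j x) \<partial>M) \<le> (\<integral>x. e / 2 + (u i x - u j x)\<^sup>2 / (2 * e) \<partial>M)"
      proof (rule integral_mono[OF i1])
        show "integrable M (\<lambda>x. e / 2 + (u i x - u j x)\<^sup>2 / (2 * e))" using d2 by auto
        \<comment> \<open>Young's inequality with parameter \<open>e\<close> takes the place of
          Cauchy-Schwarz.\<close>
        have "\<bar>t\<bar> \<le> e / 2 + t\<^sup>2 / (2 * e)" for t
          using zero_le_power2[of "\<bar>t\<bar> - e"] e by (simp add: field_simps power2_eq_square)
        then show "norm (u i x - u j x) \<le> e / 2 + (u i x - u j x)\<^sup>2 / (2 * e)" for x by simp
      qed
      also have "\<dots> = e / 2 + (\<integral>x. (u i x - u j x)\<^sup>2 \<partial>M) / (2 * e)"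
        using d2[of i j] by (subst Bochner_Integration.integral_add) (auto simp: prob_space)
      also have "\<dots> < e / 2 + e\<^sup>2 / (2 * e)"
        using N[OF that] e by (intro add_strict_left_mono divide_strict_right_mono) auto
      also have "\<dots> = e" using e by (simp add: power2_eq_square)
      finally show ?thesis .
    qed
    then show ?thesis by blast
  qed
  obtain r where r: "strict_mono r" and ae: "AE x in M. Cauchy (\<lambda>i. u (r i) x)"
    using cauchy_L1_AE_cauchy_subseq[OF u1 L1] by blast
  define w where "w x = lim (\<lambda>i. u (r i) x)" for x
  have [measurable]: "w \<in> borel_measurable M" unfolding w_def by measurable
  have lim: "AE x in M. (\<lambda>i. u (r i) x) \<longlonglongrightarrow> w x"
    using ae by eventually_elim (simp add: w_def convergent_LIMSEQ_iff[symmetric] Cauchy_convergent_iff)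
  have fatou: "(\<integral>\<^sup>+x. ennreal ((u (r n) x - w x)\<^sup>2) \<partial>M) \<le> ennreal e"
    if N: "\<And>j. j \<ge> N \<Longrightarrow> (\<integral>x. (u (r n) x - u (r j) x)\<^sup>2 \<partial>M) < e" for n N e
  proof -
    have "(\<integral>\<^sup>+x. ennreal ((u (r n) x - w x)\<^sup>2) \<partial>M) = (\<integral>\<^sup>+x. liminf (\<lambda>j. ennreal ((u (r n) x - u (r j) x)\<^sup>2)) \<partial>M)"
    proof (rule nn_integral_cong_AE)
      show "AE x in M. ennreal ((u (r n) x - w x)\<^sup>2) = liminf (\<lambda>j. ennreal ((u (r n) x - u (r j) x)\<^sup>2))"
        using lim
      proof eventually_elim
        case (elim x)
        have "(\<lambda>j. ennreal ((u (r n) x - u (r j) x)\<^sup>2)) \<longlonglongrightarrow> ennreal ((u (r n) x - w x)\<^sup>2)"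
          by (intro tendsto_ennrealI tendsto_intros elim)
        then show ?case by (intro lim_imp_Liminf[symmetric]) auto
      qed
    qed
    also have "\<dots> \<le> liminf (\<lambda>j. \<integral>\<^sup>+x. ennreal ((u (r n) x - u (r j) x)\<^sup>2) \<partial>M)"
      by (rule nn_integral_liminf) measurable
    also have "\<dots> \<le> ennreal e"
    proof (rule Liminf_le)
      have "(\<integral>\<^sup>+x. ennreal ((u (r n) x - u (r j) x)\<^sup>2) \<partial>M) \<le> ennreal e" if "j \<ge> N" for j
        using N[OF that] by (subst nn_integral_eq_integral[OF d2]) (auto intro!: ennreal_leI)
      then show "\<forall>\<^sub>F j in sequentially. (\<integral>\<^sup>+x. ennreal ((u (r n) x - u (r j) x)\<^sup>2) \<partial>M) \<le> ennreal e"
        by (auto simp: eventually_sequentially)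
    qed simp
    finally show ?thesis .
  qed
  have Cauchy_r: "\<exists>N. \<forall>i\<ge>N. \<forall>j\<ge>N. (\<integral>x. (u (r i) x - u (r j) x)\<^sup>2 \<partial>M) < e" if "e > 0" for e
    using Cauchy[OF that] seq_suble[OF r] by (meson order_trans)
  obtain N1 where N1: "\<And>j. j \<ge> N1 \<Longrightarrow> (\<integral>x. (u (r N1) x - u (r j) x)\<^sup>2 \<partial>M) < 1"
    using Cauchy_r[of 1] by auto
  have "integrable M (\<lambda>x. (u (r N1) x - w x)\<^sup>2)"
  proof (rule integrableI_nonneg)
    show "(\<integral>\<^sup>+x. ennreal ((u (r N1) x - w x)\<^sup>2) \<partial>M) < \<infinity>"
      unfolding infinity_ennreal_def by (rule order.strict_trans1[OF fatou[OF N1] ennreal_less_top])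
  qed auto
  from sq[OF um[of "r N1"] _ u2[of "r N1"] this] have w2: "integrable M (\<lambda>x. (w x)\<^sup>2)" by simp
  have di: "integrable M (\<lambda>x. (u (r n) x - w x)\<^sup>2)" for n by (intro sq um u2 w2) measurable
  have "(\<lambda>n. \<integral>x. (u (r n) x - w x)\<^sup>2 \<partial>M) \<longlonglongrightarrow> 0"
  proof (rule LIMSEQ_I)
    fix e :: real assume e: "0 < e"
    then obtain N where N: "\<And>i j. i \<ge> N \<Longrightarrow> j \<ge> N \<Longrightarrow> (\<integral>x. (u (r i) x - u (r j) x)\<^sup>2 \<partial>M) < e / 2"
      using Cauchy_r[of "e/2"] by auto
    have "norm ((\<integral>x. (u (r n) x - w x)\<^sup>2 \<partial>M) - 0) < e" if "n \<ge> N" for n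
    proof -
      have "ennreal (\<integral>x. (u (r n) x - w x)\<^sup>2 \<partial>M) \<le> ennreal (e / 2)"
        using fatou[OF N[OF that]] by (subst nn_integral_eq_integral[OF di, symmetric]) auto
      then have "(\<integral>x. (u (r n) x - w x)\<^sup>2 \<partial>M) \<le> e / 2"
        by (subst (asm) ennreal_le_iff) (use e in auto)
      moreover have "0 \<le> (\<integral>x. (u (r n) x - w x)\<^sup>2 \<partial>M)" by (intro integral_nonneg_AE) simp
      ultimately show ?thesis using e by simp
    qed
    then show "\<exists>N. \<forall>n\<ge>N. norm ((\<integral>x. (u (r n) x - w x)\<^sup>2 \<partial>M) - 0) < e" by blast
  qed
  then show ?thesis using r w2 \<open>w \<in> borel_measurable M\<close> by blast
qed

section \<open>Poincare inequalities on intervals and rectangles\<close>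

lemma integral_square_le:
  fixes f :: "real \<Rightarrow> real"
  assumes "a < b" "continuous_on {a..b} f"
  shows "(integral {a..b} f)\<^sup>2 \<le> (b - a) * integral {a..b} (\<lambda>x. (f x)\<^sup>2)"
proof -
  have i: "f integrable_on {a..b}" "(\<lambda>x. (f x)\<^sup>2) integrable_on {a..b}"
    by (intro integrable_continuous_interval continuous_intros assms)+
  define I where "I = integral {a..b} f"
  define m where "m = I / (b - a)"
  \<comment> \<open>Cauchy-Schwarz against the constant 1, read off from a nonnegative
    variance.\<close>
  have "0 \<le> integral {a..b} (\<lambda>x. (f x - m)\<^sup>2)"
    by (intro integral_nonneg integrable_continuous_interval continuous_intros assms) simp
  also have "\<dots> = integral {a..b} (\<lambda>x. ((f x)\<^sup>2 - 2 * m * f x) + m\<^sup>2)"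
    by (intro integral_cong) (simp add: power2_eq_square algebra_simps)
  also have "\<dots> = integral {a..b} (\<lambda>x. (f x)\<^sup>2) - 2 * m * I + m\<^sup>2 * (b - a)"
    unfolding I_def using i integrable_on_mult_right[OF i(1), of "2*m"] assms(1)
    by (subst integral_add; (subst integral_diff)?) (auto intro!: integrable_diff)
  finally have "0 \<le> (b - a) * (integral {a..b} (\<lambda>x. (f x)\<^sup>2) - 2 * m * I + m\<^sup>2 * (b - a))"
    using assms(1) by (intro mult_nonneg_nonneg) auto
  also have "\<dots> = (b - a) * integral {a..b} (\<lambda>x. (f x)\<^sup>2) - 2 * (m * (b - a)) * I + (m * (b - a))\<^sup>2"
    by (simp add: power2_eq_square algebra_simps)
  also have "m * (b - a) = I" using assms(1) by (simp add: m_def)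
  finally show ?thesis by (simp add: I_def power2_eq_square)
qed

text \<open>The oscillation about the left end point is controlled by the fundamental theorem and
  \<open>integral_square_le\<close>. The value \<open>v a\<close> then disappears by completing the
  square, which leaves the integral of \<open>v\<close>.\<close>

lemma poincare_interval:
  fixes v v' :: "real \<Rightarrow> real"
  assumes h: "0 < h" and v: "\<And>x. (v has_real_derivative v' x) (at x)" and v': "continuous_on UNIV v'"
  shows "integral {a..a+h} (\<lambda>x. (v x)\<^sup>2) \<le> h\<^sup>2 * integral {a..a+h} (\<lambda>x. (v' x)\<^sup>2) + (integral {a..a+h} v)\<^sup>2 / h"
proof -
  have cv: "continuous_on A v" for A
    using v by (meson DERIV_continuous_on has_field_derivative_at_within)
  have cv': "continuous_on A v'" for A
    using v' by (rule continuous_on_subset) simp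
  have i: "v integrable_on {c..d}" "(\<lambda>x. (v x)\<^sup>2) integrable_on {c..d}" "(\<lambda>x. (v' x)\<^sup>2) integrable_on {c..d}" for c d
    by (intro integrable_continuous_interval continuous_intros cv cv')+
  define D where "D = integral {a..a+h} (\<lambda>x. (v' x)\<^sup>2)"
  define I where "I = integral {a..a+h} v"
  have pt: "(v x - v a)\<^sup>2 \<le> h * D" if x: "x \<in> {a..a+h}" for x
  proof (cases "x = a")
    case True
    have "0 \<le> D" unfolding D_def by (intro integral_nonneg i) simp
    then show ?thesis using True h by simp
  next
    case False
    then have ax: "a < x" using x by simp
    have "(v' has_integral (v x - v a)) {a..x}"
      using ax by (intro fundamental_theorem_of_calculus)
        (auto intro: has_field_derivative_at_within[OF v] simp flip: has_real_derivative_iff_has_vector_derivative)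
    then have "(v x - v a)\<^sup>2 = (integral {a..x} v')\<^sup>2" by (simp add: integral_unique)
    also have "\<dots> \<le> (x - a) * integral {a..x} (\<lambda>x. (v' x)\<^sup>2)" by (rule integral_square_le[OF ax cv'])
    also have "\<dots> \<le> h * D"
      unfolding D_def using x ax h
      by (intro mult_mono integral_subset_le integral_nonneg i) auto
    finally show ?thesis .
  qed
  have "integral {a..a+h} (\<lambda>x. (v x - v a)\<^sup>2) \<le> integral {a..a+h} (\<lambda>x. h * D)"
    by (intro integral_le integrable_continuous_interval continuous_intros cv pt) auto
  also have "\<dots> = h\<^sup>2 * D" using h by (simp add: power2_eq_square)
  finally have 1: "integral {a..a+h} (\<lambda>x. (v x - v a)\<^sup>2) \<le> h\<^sup>2 * D" .
  have "integral {a..a+h} (\<lambda>x. (v x - v a)\<^sup>2) = integral {a..a+h} (\<lambda>x. ((v x)\<^sup>2 - 2 * v a * v x) + (v a)\<^sup>2)"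
    by (intro integral_cong) (simp add: power2_eq_square algebra_simps)
  also have "\<dots> = integral {a..a+h} (\<lambda>x. (v x)\<^sup>2) - 2 * v a * I + (v a)\<^sup>2 * h"
    unfolding I_def using i integrable_on_mult_right[OF i(1), of "2 * v a"] h
    by (subst integral_add; (subst integral_diff)?) (auto intro!: integrable_diff)
  finally have 2: "integral {a..a+h} (\<lambda>x. (v x - v a)\<^sup>2) = integral {a..a+h} (\<lambda>x. (v x)\<^sup>2) - 2 * v a * I + (v a)\<^sup>2 * h" .
  have "0 \<le> (v a * h - I)\<^sup>2 / h" using h by simp
  also have "\<dots> = (v a)\<^sup>2 * h - 2 * v a * I + I\<^sup>2 / h"
    using h by (simp add: power2_eq_square field_simps)
  finally show ?thesis using 1 2 unfolding D_def I_def by linarith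
qed

text \<open>For a fine mesh the derivative term is small, and all that remains are finitely many
  linear functionals of \<open>v\<close>: this is the source of compactness.\<close>

lemma poincare_partition:
  fixes v v' :: "real \<Rightarrow> real"
  assumes h: "0 < h" and v: "\<And>x. (v has_real_derivative v' x) (at x)" and v': "continuous_on UNIV v'"
  shows "integral {0..real N * h} (\<lambda>x. (v x)\<^sup>2) \<le> h\<^sup>2 * integral {0..real N * h} (\<lambda>x. (v' x)\<^sup>2)
     + (\<Sum>i<N. (integral {real i * h..real i * h + h} v)\<^sup>2) / h"
proof (induction N)
  case (Suc N)
  have cv: "continuous_on A v" for A
    using v by (meson DERIV_continuous_on has_field_derivative_at_within)
  have cv': "continuous_on A v'" for A
    using v' by (rule continuous_on_subset) simp
  have i: "(\<lambda>x. (v x)\<^sup>2) integrable_on {c..d}" "(\<lambda>x. (v' x)\<^sup>2) integrable_on {c..d}" for c d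
    by (intro integrable_continuous_interval continuous_intros cv cv')+
  have eq: "real (Suc N) * h = real N * h + h" by (simp add: algebra_simps)
  have comb: "integral {0..real (Suc N) * h} f = integral {0..real N * h} f + integral {real N * h..real N * h + h} f"
    if "\<And>c d. f integrable_on {c..d}" for f :: "real \<Rightarrow> real"
    unfolding eq using h that by (intro Henstock_Kurzweil_Integration.integral_combine[symmetric]) auto
  show ?case
    unfolding comb[OF i(1)] comb[OF i(2)] sum.lessThan_Suc add_divide_distrib distrib_left
    using Suc.IH poincare_interval[OF h v v', of "real N * h"] by linarith
qed simp

text \<open>The interval inequality is used in \<open>s\<close> for fixed \<open>t\<close>, then in
  \<open>t\<close> for the strip integrals \<open>m i\<close>. Differentiating those under the
  integral and applying \<open>integral_square_le\<close> costs a factor \<open>a\<close>, which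
  cancels the \<open>1 / a\<close> of the first step.\<close>

lemma poincare_rectangle:
  fixes v vs vt :: "real \<Rightarrow> real \<Rightarrow> real"
  assumes N: "0 < N"
    and cv: "continuous_on UNIV (\<lambda>x. v (fst x) (snd x))"
    and cs: "continuous_on UNIV (\<lambda>x. vs (fst x) (snd x))"
    and ct: "continuous_on UNIV (\<lambda>x. vt (fst x) (snd x))"
    and ds: "\<And>s t. ((\<lambda>s. v s t) has_real_derivative vs s t) (at s)"
    and dt: "\<And>s t. ((\<lambda>t. v s t) has_real_derivative vt s t) (at t)"
  defines "a \<equiv> pi / real N" and "b \<equiv> 2 * pi / real N"
  shows "II (\<lambda>s t. (v s t)\<^sup>2) \<le> a\<^sup>2 * II (\<lambda>s t. (vs s t)\<^sup>2) + b\<^sup>2 * II (\<lambda>s t. (vt s t)\<^sup>2)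
    + (\<Sum>i<N. \<Sum>j<N. (integral {real j * b..real j * b + b} (\<lambda>t. integral {real i * a..real i * a + a} (\<lambda>s. v s t)))\<^sup>2) / (a * b)"
proof -
  have ab: "0 < a" "0 < b" "real N * a = pi" "real N * b = 2 * pi" using N by (auto simp: a_def b_def)
  let ?J = "{0..2*pi}" and ?I = "\<lambda>i. {real i * a..real i * a + a}"
  note swap = continuous_on_swap
  define m where "m i t = integral (?I i) (\<lambda>s. v s t)" for i t
  define m' where "m' i t = integral (?I i) (\<lambda>s. vt s t)" for i t
  have dm: "(m i has_real_derivative m' i t) (at t)" for i t
    unfolding m_def[abs_def] m'_def
    by (rule DERIV_integral_param[where f = "\<lambda>t s. v s t" and f' = "\<lambda>t s. vt s t", OF dt swap[OF cv] swap[OF ct]])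
  have cm': "continuous_on A (m' i)" for A i
    unfolding m'_def[abs_def] by (rule continuous_on_II_inner[OF swap[OF ct]])
  have cm: "continuous_on A (m i)" for A i
    unfolding m_def[abs_def] by (rule continuous_on_II_inner[OF swap[OF cv]])
  have c2: "continuous_on UNIV (\<lambda>x. (v (fst x) (snd x))\<^sup>2)" "continuous_on UNIV (\<lambda>x. (vs (fst x) (snd x))\<^sup>2)"
      "continuous_on UNIV (\<lambda>x. (vt (fst x) (snd x))\<^sup>2)"
    by (intro continuous_intros cv cs ct)+
  have ii: "(\<lambda>t. integral {c..d} (\<lambda>s. (f s t)\<^sup>2)) integrable_on {c'..d'}"
    if "continuous_on UNIV (\<lambda>x. (f (fst x) (snd x))\<^sup>2)" for f :: "real \<Rightarrow> real \<Rightarrow> real" and c d c' d'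
    by (rule II_integrable(3)[where f = "\<lambda>t s. (f s t)\<^sup>2", OF swap[where f = "\<lambda>s t. (f s t)\<^sup>2", OF that]])
  have im: "(\<lambda>t. (m i t)\<^sup>2) integrable_on {c..d}" "(\<lambda>t. (m' i t)\<^sup>2) integrable_on {c..d}" for i c d
    by (intro integrable_continuous_interval continuous_intros cm cm')+
  let ?C = "\<lambda>i j. integral {real j * b..real j * b + b} (m i)"
  let ?T = "\<lambda>i. integral ?J (\<lambda>t. integral (?I i) (\<lambda>s. (vt s t)\<^sup>2))"
  have "II (\<lambda>s t. (v s t)\<^sup>2) = integral ?J (\<lambda>t. integral {0..pi} (\<lambda>s. (v s t)\<^sup>2))"
    by (rule II_swap[OF c2(1)])
  also have "\<dots> \<le> integral ?J (\<lambda>t. a\<^sup>2 * integral {0..pi} (\<lambda>s. (vs s t)\<^sup>2) + (\<Sum>i<N. (m i t)\<^sup>2) / a)"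
  proof (rule integral_le)
    show "(\<lambda>t. integral {0..pi} (\<lambda>s. (v s t)\<^sup>2)) integrable_on ?J" by (rule ii[OF c2(1)])
    show "(\<lambda>t. a\<^sup>2 * integral {0..pi} (\<lambda>s. (vs s t)\<^sup>2) + (\<Sum>i<N. (m i t)\<^sup>2) / a) integrable_on ?J"
      by (intro integrable_add integrable_on_mult_right integrable_on_divide integrable_sum ii[OF c2(2)] im) simp
    show "integral {0..pi} (\<lambda>s. (v s t)\<^sup>2) \<le> a\<^sup>2 * integral {0..pi} (\<lambda>s. (vs s t)\<^sup>2) + (\<Sum>i<N. (m i t)\<^sup>2) / a" for t
    proof -
      have "integral {0..real N * a} (\<lambda>s. (v s t)\<^sup>2) \<le> a\<^sup>2 * integral {0..real N * a} (\<lambda>s. (vs s t)\<^sup>2)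
         + (\<Sum>i<N. (integral (?I i) (\<lambda>s. v s t))\<^sup>2) / a"
        by (rule poincare_partition[OF ab(1) ds continuous_on_slice(2)[OF cs]])
      then show ?thesis unfolding ab(3) m_def .
    qed
  qed
  also have "\<dots> = a\<^sup>2 * II (\<lambda>s t. (vs s t)\<^sup>2) + (\<Sum>i<N. integral ?J (\<lambda>t. (m i t)\<^sup>2)) / a"
    unfolding II_swap[OF c2(2)] using ii[OF c2(2)] im
    by (subst integral_add) (auto intro!: integrable_on_mult_right integrable_on_divide integrable_sum simp: integral_sum)
  finally have step1: "II (\<lambda>s t. (v s t)\<^sup>2) \<le> a\<^sup>2 * II (\<lambda>s t. (vs s t)\<^sup>2) + (\<Sum>i<N. integral ?J (\<lambda>t. (m i t)\<^sup>2)) / a" .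
  have "(\<Sum>i<N. integral ?J (\<lambda>t. (m i t)\<^sup>2)) \<le> (\<Sum>i<N. b\<^sup>2 * (a * ?T i) + (\<Sum>j<N. (?C i j)\<^sup>2) / b)"
  proof (rule sum_mono)
    fix i
    have "integral ?J (\<lambda>t. (m i t)\<^sup>2) \<le> b\<^sup>2 * integral ?J (\<lambda>t. (m' i t)\<^sup>2) + (\<Sum>j<N. (integral {real j * b..real j * b + b} (m i))\<^sup>2) / b"
    proof -
      have "integral {0..real N * b} (\<lambda>t. (m i t)\<^sup>2) \<le> b\<^sup>2 * integral {0..real N * b} (\<lambda>t. (m' i t)\<^sup>2)
         + (\<Sum>j<N. (?C i j)\<^sup>2) / b"
        by (rule poincare_partition[OF ab(2) dm cm'])
      then show ?thesis unfolding ab(4) .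
    qed
    moreover have "integral ?J (\<lambda>t. (m' i t)\<^sup>2) \<le> integral ?J (\<lambda>t. a * integral (?I i) (\<lambda>s. (vt s t)\<^sup>2))"
    proof (intro integral_le im integrable_on_mult_right ii[OF c2(3)])
      show "(m' i t)\<^sup>2 \<le> a * integral (?I i) (\<lambda>s. (vt s t)\<^sup>2)" for t
        unfolding m'_def using integral_square_le[of "real i * a" "real i * a + a" "\<lambda>s. vt s t"] ab(1) continuous_on_slice(2)[OF ct] by simp
    qed
    then have "b\<^sup>2 * integral ?J (\<lambda>t. (m' i t)\<^sup>2) \<le> b\<^sup>2 * (a * ?T i)"
      unfolding integral_mult_right by (rule mult_left_mono) simp
    ultimately show "integral ?J (\<lambda>t. (m i t)\<^sup>2) \<le> b\<^sup>2 * (a * ?T i) + (\<Sum>j<N. (?C i j)\<^sup>2) / b"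
      by linarith
  qed
  also have "\<dots> = b\<^sup>2 * a * (\<Sum>i<N. ?T i) + (\<Sum>i<N. \<Sum>j<N. (?C i j)\<^sup>2) / b"
    unfolding sum.distrib sum_distrib_left sum_divide_distrib mult.assoc ..
  finally have step2: "(\<Sum>i<N. integral ?J (\<lambda>t. (m i t)\<^sup>2)) \<le> b\<^sup>2 * a * (\<Sum>i<N. ?T i) + (\<Sum>i<N. \<Sum>j<N. (?C i j)\<^sup>2) / b" .
  have step3: "(\<Sum>i<N. integral ?J (\<lambda>t. integral (?I i) (\<lambda>s. (vt s t)\<^sup>2))) = II (\<lambda>s t. (vt s t)\<^sup>2)"
  proof -
    have part: "(\<Sum>i<k. integral (?I i) f) = integral {0..real k * a} f"
      if "\<And>c d. f integrable_on {c..d}" for f :: "real \<Rightarrow> real" and k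
    proof (induction k)
      case (Suc k)
      have "real (Suc k) * a = real k * a + a" by (simp add: algebra_simps)
      then show ?case
        using Suc Henstock_Kurzweil_Integration.integral_combine[of 0 "real k * a" "real k * a + a" f] that ab by simp
    qed simp
    have "(\<Sum>i<N. integral ?J (\<lambda>t. integral (?I i) (\<lambda>s. (vt s t)\<^sup>2))) = integral ?J (\<lambda>t. \<Sum>i<N. integral (?I i) (\<lambda>s. (vt s t)\<^sup>2))"
      by (rule integral_sum[symmetric]) (auto intro: ii[OF c2(3)])
    also have "\<dots> = integral ?J (\<lambda>t. integral {0..pi} (\<lambda>s. (vt s t)\<^sup>2))"
      by (intro integral_cong) (simp only: part[OF II_integrable(2)[OF c2(3)]] ab(3))
    finally show ?thesis by (simp add: II_swap[OF c2(3)])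
  qed
  have "(\<Sum>i<N. integral ?J (\<lambda>t. (m i t)\<^sup>2)) / a \<le> (b\<^sup>2 * a * II (\<lambda>s t. (vt s t)\<^sup>2) + (\<Sum>i<N. \<Sum>j<N. (?C i j)\<^sup>2) / b) / a"
    using step2 ab unfolding step3 by (intro divide_right_mono) auto
  also have "\<dots> = b\<^sup>2 * II (\<lambda>s t. (vt s t)\<^sup>2) + (\<Sum>i<N. \<Sum>j<N. (?C i j)\<^sup>2) / (a * b)"
    using ab by (simp add: add_divide_distrib mult.commute)
  finally show ?thesis using step1 unfolding m_def[abs_def] by linarith
qed

section \<open>Rellich compactness on the sphere\<close>

definition w12_sq :: "(real^3 \<Rightarrow> real) \<Rightarrow> real" where
  "w12_sq f = (\<integral>x. (f x)\<^sup>2 \<partial>dvg) + (\<integral>x. (gnorm (grad_S2 f x))\<^sup>2 \<partial>dvg)"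

text \<open>The weight \<open>sin s\<close> is part of the functional because Poincare's inequality
  is applied to \<open>sin s * f\<close>. No division by the cell area takes place; the area appears
  in the estimates instead.\<close>

definition cell :: "nat \<Rightarrow> nat \<Rightarrow> nat \<Rightarrow> (real^3 \<Rightarrow> real) \<Rightarrow> real" where
  "cell N i j f = integral {real j * (2 * pi / real N)..real j * (2 * pi / real N) + 2 * pi / real N}
     (\<lambda>t. integral {real i * (pi / real N)..real i * (pi / real N) + pi / real N} (\<lambda>s. sin s * f (spherical (s,t))))"

lemma II_linear:
  fixes f g :: "real \<Rightarrow> real \<Rightarrow> real"
  assumes "continuous_on UNIV (\<lambda>p. f (fst p) (snd p))" "continuous_on UNIV (\<lambda>p. g (fst p) (snd p))"
  shows "II (\<lambda>s t. a * f s t + b * g s t) = a * II f + b * II g"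
  using II_add[of "\<lambda>s t. a * f s t" "\<lambda>s t. b * g s t"] assms
  by (simp add: II_cmult continuous_intros)

text \<open>Removes the degenerate weight at the price of a derivative: the derivative of
  \<open>sin s * cos s * (y s)\<^sup>2\<close> integrates to zero, and subtracting it from
  \<open>(y s)\<^sup>2\<close> leaves only terms with a factor \<open>sin s\<close>.\<close>

lemma integral_square_unweighted:
  fixes y p :: "real \<Rightarrow> real"
  assumes y: "\<And>s. (y has_real_derivative p s) (at s)" and p: "continuous_on UNIV p"
  shows "integral {0..pi} (\<lambda>s. (y s)\<^sup>2) \<le> integral {0..pi} (\<lambda>s. (3 * (y s)\<^sup>2 + (p s)\<^sup>2) * sin s)"
proof -
  have cy: "continuous_on A y" for A
    using y by (meson DERIV_continuous_on has_field_derivative_at_within)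
  have cp: "continuous_on A p" for A
    using p by (rule continuous_on_subset) simp
  let ?F = "\<lambda>s. ((cos s)\<^sup>2 - (sin s)\<^sup>2) * (y s)\<^sup>2 + 2 * sin s * cos s * y s * p s"
  have "(?F has_integral (sin pi * cos pi * (y pi)\<^sup>2 - sin 0 * cos 0 * (y 0)\<^sup>2)) {0..pi}"
  proof (rule fundamental_theorem_of_calculus)
    show "((\<lambda>s. sin s * cos s * (y s)\<^sup>2) has_vector_derivative ?F s) (at s within {0..pi})" for s
      unfolding has_real_derivative_iff_has_vector_derivative[symmetric]
      by (auto intro!: derivative_eq_intros has_field_derivative_at_within[OF y] simp: power2_eq_square algebra_simps)
  qed simp
  then have F: "(?F has_integral 0) {0..pi}" by simp
  have i: "(\<lambda>s. (y s)\<^sup>2) integrable_on {0..pi}" "(\<lambda>s. (3 * (y s)\<^sup>2 + (p s)\<^sup>2) * sin s) integrable_on {0..pi}"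
    by (intro integrable_continuous_interval continuous_intros cy cp)+
  have d: "((\<lambda>s. (y s)\<^sup>2 - ?F s) has_integral (integral {0..pi} (\<lambda>s. (y s)\<^sup>2) - 0)) {0..pi}"
    by (intro has_integral_diff F integrable_integral i)
  have "integral {0..pi} (\<lambda>s. (y s)\<^sup>2) - 0 \<le> integral {0..pi} (\<lambda>s. (3 * (y s)\<^sup>2 + (p s)\<^sup>2) * sin s)"
  proof (rule has_integral_le[OF d integrable_integral[OF i(2)]])
    fix s assume "s \<in> {0..pi}"
    then have s: "0 \<le> sin s" by (simp add: sin_ge_zero)
    have "(sin s)\<^sup>2 * (y s)\<^sup>2 \<le> sin s * (y s)\<^sup>2"
      using s sin_le_one[of s] by (intro mult_right_mono) (auto simp: power2_eq_square mult_left_le)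
    moreover have "- (2 * sin s * cos s * y s * p s) \<le> sin s * ((y s)\<^sup>2 + (p s)\<^sup>2)"
    proof -
      have "0 \<le> (cos s * y s + p s)\<^sup>2" by simp
      also have "\<dots> = (cos s)\<^sup>2 * (y s)\<^sup>2 + 2 * cos s * y s * p s + (p s)\<^sup>2"
        by (simp add: power2_eq_square algebra_simps)
      finally have "- (2 * cos s * y s * p s) \<le> (cos s)\<^sup>2 * (y s)\<^sup>2 + (p s)\<^sup>2" by simp
      moreover have "(cos s)\<^sup>2 * (y s)\<^sup>2 \<le> 1 * (y s)\<^sup>2"
        by (intro mult_right_mono) (auto simp: cos_squared_eq)
      ultimately have "- (2 * cos s * y s * p s) \<le> (y s)\<^sup>2 + (p s)\<^sup>2" by linarith
      then have "sin s * - (2 * cos s * y s * p s) \<le> sin s * ((y s)\<^sup>2 + (p s)\<^sup>2)"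
        using s by (intro mult_left_mono)
      then show ?thesis by (simp add: mult_ac)
    qed
    moreover have "(y s)\<^sup>2 - ((cos s)\<^sup>2 - (sin s)\<^sup>2) * (y s)\<^sup>2 = 2 * ((sin s)\<^sup>2 * (y s)\<^sup>2)"
      by (simp add: cos_squared_eq algebra_simps)
    moreover have "(3 * (y s)\<^sup>2 + (p s)\<^sup>2) * sin s = 2 * (sin s * (y s)\<^sup>2) + sin s * ((y s)\<^sup>2 + (p s)\<^sup>2)"
      by (simp add: algebra_simps)
    ultimately show "(y s)\<^sup>2 - ?F s \<le> (3 * (y s)\<^sup>2 + (p s)\<^sup>2) * sin s" by linarith
  qed
  then show ?thesis by simp
qed

locale C1_pullback =
  fixes f :: "real^3 \<Rightarrow> real" and y p q :: "real \<Rightarrow> real \<Rightarrow> real"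
  assumes f: "C1_S2 f"
  defines "y \<equiv> (\<lambda>s t. f (spherical (s,t)))"
    and "p \<equiv> (\<lambda>s t. diff_S2 f (spherical (s,t)) (e_phi s t))"
    and "q \<equiv> (\<lambda>s t. diff_S2 f (spherical (s,t)) (e_theta t))"
begin

lemma cont: "continuous_on UNIV (\<lambda>x. y (fst x) (snd x))" "continuous_on UNIV (\<lambda>x. p (fst x) (snd x))"
    "continuous_on UNIV (\<lambda>x. q (fst x) (snd x))"
  unfolding y_def p_def q_def
  using continuous_on_pullback[OF C1_S2_continuous[OF f]] continuous_on_diff_frame[OF f] by auto

lemma derivs: "((\<lambda>s. y s t) has_real_derivative p s t) (at s)" "((\<lambda>t. y s t) has_real_derivative sin s * q s t) (at t)"
  using C1_S2_spherical_derivs[OF f]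
  by (simp_all add: y_def p_def q_def has_real_derivative_iff_has_vector_derivative)

lemma w12_sq_eq: "4 * pi * (\<integral>x. (f x)\<^sup>2 \<partial>dvg) = II (\<lambda>s t. (y s t)\<^sup>2 * sin s)"
  "(\<integral>x. (gnorm (grad_S2 f x))\<^sup>2 \<partial>dvg) = II (\<lambda>s t. ((p s t)\<^sup>2 + (q s t)\<^sup>2) * sin s)"
proof -
  have "continuous_on S2 (\<lambda>x. (f x)\<^sup>2)" by (intro continuous_intros C1_S2_continuous[OF f])
  from dvg_integral[OF this] show "4 * pi * (\<integral>x. (f x)\<^sup>2 \<partial>dvg) = II (\<lambda>s t. (y s t)\<^sup>2 * sin s)"
    by (simp add: y_def)
  have "continuous_on S2 (\<lambda>x. (gnorm (grad_S2 f x))\<^sup>2)"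
    unfolding gnorm_sq by (intro continuous_intros continuous_on_grad[OF f]) simp
  from dvg_integral[OF this] show "(\<integral>x. (gnorm (grad_S2 f x))\<^sup>2 \<partial>dvg) = II (\<lambda>s t. ((p s t)\<^sup>2 + (q s t)\<^sup>2) * sin s)"
    using II_cmult[of "4*pi" "\<lambda>s t. ((p s t)\<^sup>2 + (q s t)\<^sup>2) * sin s"]
    by (simp add: gnorm_grad_spherical[OF f] p_def q_def mult.assoc)
qed

text \<open>16 bounds \<open>4 * pi\<close>, and \<open>49 = 3 * 16 + 1\<close> comes from
  \<open>integral_square_unweighted\<close>.\<close>

lemma II_bounds: "II (\<lambda>s t. (y s t)\<^sup>2 * sin s) \<le> 16 * w12_sq f"
  "II (\<lambda>s t. ((p s t)\<^sup>2 + (q s t)\<^sup>2) * sin s) \<le> w12_sq f" "II (\<lambda>s t. (y s t)\<^sup>2) \<le> 49 * w12_sq f" "0 \<le> w12_sq f"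
proof -
  have nn: "0 \<le> (\<integral>x. (f x)\<^sup>2 \<partial>dvg)" "0 \<le> (\<integral>x. (gnorm (grad_S2 f x))\<^sup>2 \<partial>dvg)"
    by (intro integral_nonneg_AE; simp)+
  then show "0 \<le> w12_sq f" "II (\<lambda>s t. ((p s t)\<^sup>2 + (q s t)\<^sup>2) * sin s) \<le> w12_sq f"
    by (simp_all add: w12_sq_def w12_sq_eq(2)[symmetric])
  have "4 * pi * (\<integral>x. (f x)\<^sup>2 \<partial>dvg) \<le> 16 * (\<integral>x. (f x)\<^sup>2 \<partial>dvg)"
    using nn pi_less_4 by (intro mult_right_mono) auto
  also have "\<dots> \<le> 16 * w12_sq f" using nn by (simp add: w12_sq_def)
  finally show Y: "II (\<lambda>s t. (y s t)\<^sup>2 * sin s) \<le> 16 * w12_sq f" by (simp add: w12_sq_eq(1))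
  have c: "continuous_on UNIV (\<lambda>x. (y (fst x) (snd x))\<^sup>2)"
    "continuous_on UNIV (\<lambda>x. (3 * (y (fst x) (snd x))\<^sup>2 + (p (fst x) (snd x))\<^sup>2) * sin (fst x))"
    "continuous_on UNIV (\<lambda>x. (3 * ((y (fst x) (snd x))\<^sup>2 * sin (fst x)) + 1 * (((p (fst x) (snd x))\<^sup>2 + (q (fst x) (snd x))\<^sup>2) * sin (fst x))))"
    "continuous_on UNIV (\<lambda>x. (y (fst x) (snd x))\<^sup>2 * sin (fst x))"
    "continuous_on UNIV (\<lambda>x. ((p (fst x) (snd x))\<^sup>2 + (q (fst x) (snd x))\<^sup>2) * sin (fst x))"
    by (intro continuous_intros cont)+
  have "II (\<lambda>s t. (y s t)\<^sup>2) \<le> II (\<lambda>s t. (3 * (y s t)\<^sup>2 + (p s t)\<^sup>2) * sin s)"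
    unfolding II_swap[OF c(1)] II_swap[OF c(2)]
  proof (rule integral_le)
    show "(\<lambda>t. integral {0..pi} (\<lambda>s. (y s t)\<^sup>2)) integrable_on {0..2 * pi}"
      by (rule II_integrable(3)[where f = "\<lambda>t s. (y s t)\<^sup>2", OF continuous_on_swap[where f = "\<lambda>s t. (y s t)\<^sup>2", OF c(1)]])
    show "(\<lambda>t. integral {0..pi} (\<lambda>s. (3 * (y s t)\<^sup>2 + (p s t)\<^sup>2) * sin s)) integrable_on {0..2 * pi}"
      by (rule II_integrable(3)[where f = "\<lambda>t s. (3 * (y s t)\<^sup>2 + (p s t)\<^sup>2) * sin s",
          OF continuous_on_swap[where f = "\<lambda>s t. (3 * (y s t)\<^sup>2 + (p s t)\<^sup>2) * sin s", OF c(2)]])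
    show "integral {0..pi} (\<lambda>s. (y s t)\<^sup>2) \<le> integral {0..pi} (\<lambda>s. (3 * (y s t)\<^sup>2 + (p s t)\<^sup>2) * sin s)" for t
      by (rule integral_square_unweighted[OF derivs(1) continuous_on_slice(2)[OF cont(2)]])
  qed
  also have "\<dots> \<le> II (\<lambda>s t. 3 * ((y s t)\<^sup>2 * sin s) + 1 * (((p s t)\<^sup>2 + (q s t)\<^sup>2) * sin s))"
    by (rule II_mono[OF c(2) c(3)]) (simp add: algebra_simps sin_ge_zero)
  also have "\<dots> = 3 * II (\<lambda>s t. (y s t)\<^sup>2 * sin s) + 1 * II (\<lambda>s t. ((p s t)\<^sup>2 + (q s t)\<^sup>2) * sin s)"
    by (rule II_linear[OF c(4,5)])
  finally show "II (\<lambda>s t. (y s t)\<^sup>2) \<le> 49 * w12_sq f"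
    using Y \<open>II (\<lambda>s t. ((p s t)\<^sup>2 + (q s t)\<^sup>2) * sin s) \<le> w12_sq f\<close> by linarith
qed

text \<open>
  The weight \<open>sin s\<close> degenerates at the poles, so Poincare's inequality is applied to
  \<open>sin s * f\<close>, whose coordinate derivatives are square integrable without weight.
\<close>

lemma weighted_poincare:
  assumes N: "0 < N"
  shows "II (\<lambda>s t. (sin s * y s t)\<^sup>2) \<le> 2000 / (real N)\<^sup>2 * w12_sq f
     + (\<Sum>i<N. \<Sum>j<N. (cell N i j f)\<^sup>2) / (pi / real N * (2 * pi / real N))"
proof -
  let ?a = "pi / real N" and ?b = "2 * pi / real N"
  have sin2: "(sin s)\<^sup>2 \<le> sin s" if "s \<in> {0..pi}" for s
    using that sin_le_one[of s] sin_ge_zero[of s] by (simp add: power2_eq_square mult_left_le)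
  have c: "continuous_on UNIV (\<lambda>x. sin (fst x) * y (fst x) (snd x))"
    "continuous_on UNIV (\<lambda>x. cos (fst x) * y (fst x) (snd x) + sin (fst x) * p (fst x) (snd x))"
    "continuous_on UNIV (\<lambda>x. sin (fst x) * (sin (fst x) * q (fst x) (snd x)))"
    by (intro continuous_intros cont)+
  have "II (\<lambda>s t. (sin s * y s t)\<^sup>2) \<le> ?a\<^sup>2 * II (\<lambda>s t. (cos s * y s t + sin s * p s t)\<^sup>2)
      + ?b\<^sup>2 * II (\<lambda>s t. (sin s * (sin s * q s t))\<^sup>2)
    + (\<Sum>i<N. \<Sum>j<N. (integral {real j * ?b..real j * ?b + ?b} (\<lambda>t. integral {real i * ?a..real i * ?a + ?a} (\<lambda>s. sin s * y s t)))\<^sup>2) / (?a * ?b)"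
    by (rule poincare_rectangle[OF N c]) (auto intro!: derivative_eq_intros derivs)
  \<comment> \<open>100 is \<open>2 * 49 + 2\<close>: the unweighted bound for \<open>y\<close> and
    the weighted one for \<open>p\<close>.\<close>
  moreover have "II (\<lambda>s t. (cos s * y s t + sin s * p s t)\<^sup>2) \<le> 100 * w12_sq f"
  proof -
    have cc: "continuous_on UNIV (\<lambda>x. (cos (fst x) * y (fst x) (snd x) + sin (fst x) * p (fst x) (snd x))\<^sup>2)"
      "continuous_on UNIV (\<lambda>x. 2 * (y (fst x) (snd x))\<^sup>2 + 2 * (((p (fst x) (snd x))\<^sup>2 + (q (fst x) (snd x))\<^sup>2) * sin (fst x)))"
      "continuous_on UNIV (\<lambda>x. (y (fst x) (snd x))\<^sup>2)"
      "continuous_on UNIV (\<lambda>x. ((p (fst x) (snd x))\<^sup>2 + (q (fst x) (snd x))\<^sup>2) * sin (fst x))"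
      by (intro continuous_intros cont)+
    have "II (\<lambda>s t. (cos s * y s t + sin s * p s t)\<^sup>2) \<le> II (\<lambda>s t. 2 * (y s t)\<^sup>2 + 2 * (((p s t)\<^sup>2 + (q s t)\<^sup>2) * sin s))"
    proof (rule II_mono[OF cc(1,2)])
      fix s t :: real assume s: "s \<in> {0..pi}"
      then have s0: "0 \<le> sin s" by (simp add: sin_ge_zero)
      have "(cos s * y s t + sin s * p s t)\<^sup>2 \<le> 2 * ((cos s)\<^sup>2 * (y s t)\<^sup>2) + 2 * ((sin s)\<^sup>2 * (p s t)\<^sup>2)"
        using zero_le_power2[of "cos s * y s t - sin s * p s t"] by (simp add: power2_eq_square algebra_simps)
      moreover have "(cos s)\<^sup>2 * (y s t)\<^sup>2 \<le> 1 * (y s t)\<^sup>2"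
        by (intro mult_right_mono) (auto simp: cos_squared_eq)
      moreover have "(sin s)\<^sup>2 * (p s t)\<^sup>2 \<le> sin s * (p s t)\<^sup>2" by (intro mult_right_mono sin2 s) simp
      moreover have "sin s * (p s t)\<^sup>2 \<le> ((p s t)\<^sup>2 + (q s t)\<^sup>2) * sin s" using s0 by (simp add: algebra_simps)
      ultimately show "(cos s * y s t + sin s * p s t)\<^sup>2 \<le> 2 * (y s t)\<^sup>2 + 2 * (((p s t)\<^sup>2 + (q s t)\<^sup>2) * sin s)"
        by linarith
    qed
    also have "\<dots> = 2 * II (\<lambda>s t. (y s t)\<^sup>2) + 2 * II (\<lambda>s t. ((p s t)\<^sup>2 + (q s t)\<^sup>2) * sin s)"
      by (rule II_linear[OF cc(3,4)])
    finally show ?thesis using II_bounds by linarith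
  qed
  moreover have "II (\<lambda>s t. (sin s * (sin s * q s t))\<^sup>2) \<le> w12_sq f"
  proof -
    have "II (\<lambda>s t. (sin s * (sin s * q s t))\<^sup>2) \<le> II (\<lambda>s t. ((p s t)\<^sup>2 + (q s t)\<^sup>2) * sin s)"
    proof (rule II_mono)
      fix s t :: real assume s: "s \<in> {0..pi}"
      then have s0: "0 \<le> sin s" by (simp add: sin_ge_zero)
      have "(sin s)\<^sup>2 * (sin s)\<^sup>2 \<le> 1 * sin s"
        using sin2[OF s] s0 by (intro mult_mono) (auto simp: abs_square_le_1)
      then have "((sin s)\<^sup>2 * (sin s)\<^sup>2) * (q s t)\<^sup>2 \<le> (1 * sin s) * (q s t)\<^sup>2" by (intro mult_right_mono) auto
      moreover have "0 \<le> (p s t)\<^sup>2 * sin s" using s0 by simp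
      ultimately show "(sin s * (sin s * q s t))\<^sup>2 \<le> ((p s t)\<^sup>2 + (q s t)\<^sup>2) * sin s"
        by (simp add: power_mult_distrib algebra_simps)
    qed (intro continuous_intros cont)+
    then show ?thesis using II_bounds(2) by linarith
  qed
  moreover have "?a\<^sup>2 \<le> 16 / (real N)\<^sup>2" "?b\<^sup>2 \<le> 64 / (real N)\<^sup>2"
  proof -
    have "pi\<^sup>2 \<le> 4\<^sup>2" using pi_less_4 by (intro power_mono) auto
    then show "?a\<^sup>2 \<le> 16 / (real N)\<^sup>2" "?b\<^sup>2 \<le> 64 / (real N)\<^sup>2"
      by (auto simp: power_divide power_mult_distrib intro!: divide_right_mono)
  qed
  ultimately have "II (\<lambda>s t. (sin s * y s t)\<^sup>2) \<le> 16 / (real N)\<^sup>2 * (100 * w12_sq f) + 64 / (real N)\<^sup>2 * w12_sq f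
    + (\<Sum>i<N. \<Sum>j<N. (cell N i j f)\<^sup>2) / (?a * ?b)"
  proof -
    have m: "x * u \<le> x' * u'" if "x \<le> x'" "u \<le> u'" "0 \<le> x" "0 \<le> u'" for x x' u u' :: real
      using that by (meson mult_left_mono mult_right_mono order_trans)
    assume A: "II (\<lambda>s t. (sin s * y s t)\<^sup>2) \<le> ?a\<^sup>2 * II (\<lambda>s t. (cos s * y s t + sin s * p s t)\<^sup>2)
      + ?b\<^sup>2 * II (\<lambda>s t. (sin s * (sin s * q s t))\<^sup>2)
    + (\<Sum>i<N. \<Sum>j<N. (integral {real j * ?b..real j * ?b + ?b} (\<lambda>t. integral {real i * ?a..real i * ?a + ?a} (\<lambda>s. sin s * y s t)))\<^sup>2) / (?a * ?b)"
      and B: "II (\<lambda>s t. (cos s * y s t + sin s * p s t)\<^sup>2) \<le> 100 * w12_sq f"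
      and C: "II (\<lambda>s t. (sin s * (sin s * q s t))\<^sup>2) \<le> w12_sq f"
      and D: "?a\<^sup>2 \<le> 16 / (real N)\<^sup>2" "?b\<^sup>2 \<le> 64 / (real N)\<^sup>2"
    have "?a\<^sup>2 * II (\<lambda>s t. (cos s * y s t + sin s * p s t)\<^sup>2) \<le> 16 / (real N)\<^sup>2 * (100 * w12_sq f)"
      by (rule m[OF D(1) B]) (use II_bounds(4) in auto)
    moreover have "?b\<^sup>2 * II (\<lambda>s t. (sin s * (sin s * q s t))\<^sup>2) \<le> 64 / (real N)\<^sup>2 * w12_sq f"
      by (rule m[OF D(2) C]) (use II_bounds(4) in auto)
    ultimately show ?thesis using A unfolding cell_def y_def by linarith
  qed
  moreover have "16 / (real N)\<^sup>2 * (100 * w12_sq f) + 64 / (real N)\<^sup>2 * w12_sq f \<le> 2000 / (real N)\<^sup>2 * w12_sq f"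
  proof -
    have "16 / (real N)\<^sup>2 * (100 * w12_sq f) + 64 / (real N)\<^sup>2 * w12_sq f = 1664 / (real N)\<^sup>2 * w12_sq f"
      by (simp add: algebra_simps add_divide_distrib[symmetric])
    also have "\<dots> \<le> 2000 / (real N)\<^sup>2 * w12_sq f"
      using II_bounds(4) by (intro mult_right_mono divide_right_mono) auto
    finally show ?thesis .
  qed
  ultimately show ?thesis by linarith
qed

text \<open>Poincare's inequality sees only the weight \<open>(sin s)\<^sup>2\<close>, whereas the
  area element is \<open>sin s\<close>. The bound
  \<open>sin s \<le> \<delta> / 2 + (sin s)\<^sup>2 / (2 * \<delta>)\<close> bridges the gap, its
  first term being covered by the unweighted estimate.\<close>

lemma L2_estimate:
  assumes N: "0 < N" and \<delta>: "0 < \<delta>"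
  shows "(\<integral>x. (f x)\<^sup>2 \<partial>dvg) \<le> 25 * \<delta> * w12_sq f + 1000 / (\<delta> * (real N)\<^sup>2) * w12_sq f
    + (\<Sum>i<N. \<Sum>j<N. (cell N i j f)\<^sup>2) / (pi / real N * (2 * pi / real N)) / (2 * \<delta>)"
proof -
  let ?S = "(\<Sum>i<N. \<Sum>j<N. (cell N i j f)\<^sup>2) / (pi / real N * (2 * pi / real N))"
  have c: "continuous_on UNIV (\<lambda>x. (y (fst x) (snd x))\<^sup>2 * sin (fst x))" "continuous_on UNIV (\<lambda>x. (y (fst x) (snd x))\<^sup>2)"
    "continuous_on UNIV (\<lambda>x. (sin (fst x) * y (fst x) (snd x))\<^sup>2)"
    "continuous_on UNIV (\<lambda>x. \<delta> / 2 * (y (fst x) (snd x))\<^sup>2 + 1 / (2 * \<delta>) * (sin (fst x) * y (fst x) (snd x))\<^sup>2)"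
    by (intro continuous_intros cont)+
  have "1 * (\<integral>x. (f x)\<^sup>2 \<partial>dvg) \<le> 4 * pi * (\<integral>x. (f x)\<^sup>2 \<partial>dvg)"
    using pi_ge_two by (intro mult_right_mono) (auto intro!: integral_nonneg_AE)
  also have "\<dots> = II (\<lambda>s t. (y s t)\<^sup>2 * sin s)" by (rule w12_sq_eq(1))
  also have "\<dots> \<le> II (\<lambda>s t. \<delta> / 2 * (y s t)\<^sup>2 + 1 / (2 * \<delta>) * (sin s * y s t)\<^sup>2)"
  proof (rule II_mono[OF c(1) c(4)])
    fix s t :: real
    have "0 \<le> (\<delta> - sin s)\<^sup>2 * (y s t)\<^sup>2 / (2 * \<delta>)" using \<delta> by simp
    also have "\<dots> = \<delta> / 2 * (y s t)\<^sup>2 + 1 / (2 * \<delta>) * (sin s * y s t)\<^sup>2 - (y s t)\<^sup>2 * sin s"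
      using \<delta> by (simp add: power2_eq_square field_simps)
    finally show "(y s t)\<^sup>2 * sin s \<le> \<delta> / 2 * (y s t)\<^sup>2 + 1 / (2 * \<delta>) * (sin s * y s t)\<^sup>2" by simp
  qed
  also have "\<dots> = \<delta> / 2 * II (\<lambda>s t. (y s t)\<^sup>2) + 1 / (2 * \<delta>) * II (\<lambda>s t. (sin s * y s t)\<^sup>2)"
    by (rule II_linear[OF c(2,3)])
  also have "\<dots> \<le> \<delta> / 2 * (49 * w12_sq f) + 1 / (2 * \<delta>) * (2000 / (real N)\<^sup>2 * w12_sq f + ?S)"
    using \<delta> by (intro add_mono mult_left_mono II_bounds weighted_poincare N) auto
  also have "\<dots> = 49 / 2 * \<delta> * w12_sq f + 1000 / (\<delta> * (real N)\<^sup>2) * w12_sq f + ?S / (2 * \<delta>)"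
    by (simp add: algebra_simps add_divide_distrib)
  finally have "(\<integral>x. (f x)\<^sup>2 \<partial>dvg) \<le> 49 / 2 * \<delta> * w12_sq f + 1000 / (\<delta> * (real N)\<^sup>2) * w12_sq f + ?S / (2 * \<delta>)"
    by simp
  moreover have "49 / 2 * \<delta> * w12_sq f \<le> 25 * \<delta> * w12_sq f"
    using \<delta> II_bounds(4) by (intro mult_right_mono) auto
  ultimately show ?thesis by linarith
qed

text \<open>Cauchy-Schwarz in both variables. Along a family bounded in \<open>w12_sq\<close> every
  cell integral is thus a bounded sequence.\<close>

lemma cell_sq_le:
  assumes "i < N" "j < N"
  shows "(cell N i j f)\<^sup>2 \<le> pi / real N * (2 * pi / real N) * (49 * w12_sq f)"
proof -
  let ?a = "pi / real N" and ?b = "2 * pi / real N"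
  let ?I = "{real i * ?a..real i * ?a + ?a}" and ?J = "{real j * ?b..real j * ?b + ?b}"
  have ab: "0 < ?a" "0 < ?b" using assms by auto
  have I: "?I \<subseteq> {0..pi}" and J: "?J \<subseteq> {0..2*pi}"
  proof -
    have *: "real k * (c / real N) + c / real N \<le> c" if "k < N" "0 \<le> c" for k c
    proof -
      have "real k + 1 \<le> real N" using that by simp
      then have "(real k + 1) * c \<le> real N * c" using that by (intro mult_right_mono) auto
      then show ?thesis using that by (simp add: field_simps)
    qed
    show "?I \<subseteq> {0..pi}" using *[of i pi] assms by (auto intro: order_trans[of 0 "real i * ?a"])
    show "?J \<subseteq> {0..2*pi}" using *[of j "2*pi"] assms by (auto intro: order_trans[of 0 "real j * ?b"])
  qed
  have c1: "continuous_on UNIV (\<lambda>x. (\<lambda>s t. sin s * y s t) (fst x) (snd x))"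
    and c2: "continuous_on UNIV (\<lambda>x. (\<lambda>s t. (sin s * y s t)\<^sup>2) (fst x) (snd x))"
    and c3: "continuous_on UNIV (\<lambda>x. (\<lambda>s t. (y s t)\<^sup>2) (fst x) (snd x))"
    by (auto intro!: continuous_intros cont)
  note s1 = continuous_on_swap[OF c1] and s2 = continuous_on_swap[OF c2]
  define m where "m t = integral ?I (\<lambda>s. sin s * y s t)" for t
  have cm: "continuous_on A m" for A unfolding m_def[abs_def] by (rule continuous_on_II_inner[OF s1])
  have i2: "(\<lambda>t. integral {c..d} (\<lambda>s. (sin s * y s t)\<^sup>2)) integrable_on {c'..d'}" for c d c' d'
    by (rule II_integrable(3)[where f = "\<lambda>t s. (sin s * y s t)\<^sup>2", OF s2])
  have nn2: "0 \<le> integral {c..d} (\<lambda>s. (sin s * y s t)\<^sup>2)" for c d t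
    by (rule integral_nonneg[OF II_integrable(2)[OF c2]]) simp
  have "(cell N i j f)\<^sup>2 = (integral ?J m)\<^sup>2" by (simp add: cell_def m_def[abs_def] y_def)
  also have "\<dots> \<le> ?b * integral ?J (\<lambda>t. (m t)\<^sup>2)"
    using integral_square_le[of "real j * ?b" "real j * ?b + ?b" m] ab cm by simp
  also have "\<dots> \<le> ?b * integral ?J (\<lambda>t. ?a * integral {0..pi} (\<lambda>s. (sin s * y s t)\<^sup>2))"
  proof (intro mult_left_mono integral_le)
    show "(\<lambda>t. (m t)\<^sup>2) integrable_on ?J" by (intro integrable_continuous_interval continuous_intros cm)
    show "(\<lambda>t. ?a * integral {0..pi} (\<lambda>s. (sin s * y s t)\<^sup>2)) integrable_on ?J" by (intro integrable_on_mult_right i2)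
    fix t
    have "(m t)\<^sup>2 \<le> ?a * integral ?I (\<lambda>s. (sin s * y s t)\<^sup>2)"
      unfolding m_def using integral_square_le[of "real i * ?a" "real i * ?a + ?a" "\<lambda>s. sin s * y s t"] ab
        continuous_on_slice(2)[OF c1] by simp
    also have "\<dots> \<le> ?a * integral {0..pi} (\<lambda>s. (sin s * y s t)\<^sup>2)"
      using ab by (intro mult_left_mono integral_subset_le I II_integrable(2)[OF c2]) auto
    finally show "(m t)\<^sup>2 \<le> ?a * integral {0..pi} (\<lambda>s. (sin s * y s t)\<^sup>2)" .
  qed (use ab in simp)
  also have "\<dots> = ?b * (?a * integral ?J (\<lambda>t. integral {0..pi} (\<lambda>s. (sin s * y s t)\<^sup>2)))"
    by (simp only: integral_mult_right)
  also have "\<dots> \<le> ?b * (?a * integral {0..2*pi} (\<lambda>t. integral {0..pi} (\<lambda>s. (sin s * y s t)\<^sup>2)))"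
    using ab by (intro mult_left_mono integral_subset_le J i2) (auto intro: nn2)
  also have "\<dots> = ?b * (?a * II (\<lambda>s t. (sin s * y s t)\<^sup>2))"
    using II_swap[OF c2] by simp
  finally have 1: "(cell N i j f)\<^sup>2 \<le> ?b * (?a * II (\<lambda>s t. (sin s * y s t)\<^sup>2))" .
  have "II (\<lambda>s t. (sin s * y s t)\<^sup>2) \<le> II (\<lambda>s t. (y s t)\<^sup>2)"
  proof (rule II_mono[OF c2 c3])
    fix s t
    have "(sin s)\<^sup>2 * (y s t)\<^sup>2 \<le> 1 * (y s t)\<^sup>2" by (intro mult_right_mono) (auto simp: sin_squared_eq)
    then show "(sin s * y s t)\<^sup>2 \<le> (y s t)\<^sup>2" by (simp add: power_mult_distrib)
  qed
  also note II_bounds(3)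
  finally have "?b * (?a * II (\<lambda>s t. (sin s * y s t)\<^sup>2)) \<le> ?b * (?a * (49 * w12_sq f))"
    using ab by (intro mult_left_mono) auto
  then show ?thesis using 1 by (simp only: mult_ac)
qed

end

lemma cell_diff:
  assumes "continuous_on S2 f" "continuous_on S2 g"
  shows "cell N i j (\<lambda>x. f x - g x) = cell N i j f - cell N i j g"
proof -
  have c: "continuous_on UNIV (\<lambda>x. (\<lambda>t s. sin s * h (spherical (s,t))) (fst x) (snd x))" if "continuous_on S2 h" for h :: "real^3 \<Rightarrow> real"
    by (intro continuous_intros continuous_on_compose2[OF that continuous_on_spherical(1)]) (auto intro!: continuous_intros simp: spherical_S2)
  show ?thesis
    unfolding cell_def right_diff_distrib
    using II_integrable[OF c[OF assms(1)]] II_integrable[OF c[OF assms(2)]]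
    by (simp add: integral_diff)
qed

lemma gnorm_diff_sq_le: "(gnorm (v - w))\<^sup>2 \<le> 2 * (gnorm v)\<^sup>2 + 2 * (gnorm w)\<^sup>2"
proof -
  have "(v - w) \<bullet> (v - w) \<le> 2 * (v \<bullet> v) + 2 * (w \<bullet> w)"
    using inner_ge_zero[of "v + w"] by (simp add: inner_diff_left inner_diff_right inner_add_left inner_add_right inner_commute)
  then have "((v - w) \<bullet> (v - w)) / (4 * pi) \<le> (2 * (v \<bullet> v) + 2 * (w \<bullet> w)) / (4 * pi)"
    by (intro divide_right_mono) auto
  then show ?thesis by (simp add: gnorm_sq add_divide_distrib)
qed

lemma C1_S2_diff:
  fixes f g :: "real^3 \<Rightarrow> real"
  assumes "C1_S2 f" "C1_S2 g"
  shows "C1_S2 (\<lambda>x. f x - g x)" "x \<in> S2 \<Longrightarrow> grad_S2 (\<lambda>x. f x - g x) x = grad_S2 f x - grad_S2 g x"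
proof -
  have eq: "(\<lambda>x. 1 * f x + (- 1) * g x) = (\<lambda>x. f x - g x)" by auto
  note C = C1_S2_lincomb[OF assms, where a = 1 and b = "-1", unfolded eq]
  show "C1_S2 (\<lambda>x. f x - g x)" by (rule C(1))
  show "grad_S2 (\<lambda>x. f x - g x) x = grad_S2 f x - grad_S2 g x" if x: "x \<in> S2"
    unfolding grad_S2_eq(1)[OF C(1) x] grad_S2_eq(1)[OF assms(1) x] grad_S2_eq(1)[OF assms(2) x] C(2)[OF x]
    by (simp add: algebra_simps sum_subtractf scaleR_diff_left)
qed

lemma w12_sq_diff_le:
  assumes f: "C1_S2 f" and g: "C1_S2 g"
  shows "w12_sq (\<lambda>x. f x - g x) \<le> 2 * w12_sq f + 2 * w12_sq g"
proof -
  note D = C1_S2_diff[OF f g]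
  note c = C1_S2_continuous[OF f] C1_S2_continuous[OF g] C1_S2_continuous[OF D(1)]
  have i: "integrable dvg (\<lambda>x. (h x)\<^sup>2)" "integrable dvg (\<lambda>x. (gnorm (grad_S2 h x))\<^sup>2)" if "C1_S2 h" for h
    unfolding gnorm_sq by (intro dvg_integral_vec(1) continuous_intros C1_S2_continuous[OF that] continuous_on_grad[OF that]; simp)+
  have "(\<integral>x. (f x - g x)\<^sup>2 \<partial>dvg) \<le> (\<integral>x. 2 * (f x)\<^sup>2 + 2 * (g x)\<^sup>2 \<partial>dvg)"
    by (intro integral_mono Bochner_Integration.integrable_add integrable_mult_right i D(1) f g square_diff_le)
  also have "\<dots> = 2 * (\<integral>x. (f x)\<^sup>2 \<partial>dvg) + 2 * (\<integral>x. (g x)\<^sup>2 \<partial>dvg)"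
    using i[OF f] i[OF g] by simp
  finally have 1: "(\<integral>x. (f x - g x)\<^sup>2 \<partial>dvg) \<le> 2 * (\<integral>x. (f x)\<^sup>2 \<partial>dvg) + 2 * (\<integral>x. (g x)\<^sup>2 \<partial>dvg)" .
  have "(\<integral>x. (gnorm (grad_S2 (\<lambda>x. f x - g x) x))\<^sup>2 \<partial>dvg) \<le> (\<integral>x. 2 * (gnorm (grad_S2 f x))\<^sup>2 + 2 * (gnorm (grad_S2 g x))\<^sup>2 \<partial>dvg)"
    by (intro integral_mono Bochner_Integration.integrable_add integrable_mult_right i D(1) f g)
      (simp add: D(2) gnorm_diff_sq_le)
  also have "\<dots> = 2 * (\<integral>x. (gnorm (grad_S2 f x))\<^sup>2 \<partial>dvg) + 2 * (\<integral>x. (gnorm (grad_S2 g x))\<^sup>2 \<partial>dvg)"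
    using i[OF f] i[OF g] by simp
  finally show ?thesis using 1 unfolding w12_sq_def distrib_left by linarith
qed

lemma diagonal_convergent:
  fixes g :: "nat \<Rightarrow> nat \<Rightarrow> real"
  assumes "\<And>k. \<exists>B. \<forall>n. \<bar>g k n\<bar> \<le> B"
  shows "\<exists>d. strict_mono d \<and> (\<forall>k. convergent (\<lambda>n. g k (d n)))"
proof -
  let ?P = "\<lambda>k s. convergent (\<lambda>n. g k (s n))"
  interpret subseqs ?P
  proof
    fix k and s :: "nat \<Rightarrow> nat"
    obtain B where "\<And>n. \<bar>g k n\<bar> \<le> B" using assms by blast
    then have "\<And>n. g k (s n) \<in> {-B..B}" by (simp add: abs_le_iff minus_le_iff)
    then obtain l r where "strict_mono r" "((\<lambda>n. g k (s n)) \<circ> r) \<longlonglongrightarrow> l"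
      using compact_imp_seq_compact[OF compact_Icc] unfolding seq_compact_def by metis
    then show "\<exists>r. strict_mono r \<and> ?P k (s \<circ> r)" by (auto simp: convergent_def o_def)
  qed
  have "?P k diagseq" for k
  proof -
    \<comment> \<open>The diagonal sequence is a subsequence of the \<open>k\<close>-th extraction
      only beyond its first terms, hence the shift by \<open>Suc k\<close>.\<close>
    have "?P k (diagseq \<circ> ((+) (Suc k)))"
    proof (rule diagseq_holds)
      fix r s :: "nat \<Rightarrow> nat" and n assume "strict_mono r" "?P n s"
      then show "?P n (s \<circ> r)" using convergent_subseq_convergent[of "\<lambda>i. g n (s i)" r] by (simp add: o_def)
    qed
    then obtain l where "(\<lambda>n. g k (diagseq (n + Suc k))) \<longlonglongrightarrow> l" by (auto simp: convergent_def add.commute)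
    then have "(\<lambda>n. g k (diagseq n)) \<longlonglongrightarrow> l" by (rule LIMSEQ_offset)
    then show ?thesis by (auto simp: convergent_def)
  qed
  then show ?thesis using subseq_diagseq by blast
qed

text \<open>All cell integrals, for all grid sizes, are made convergent along one diagonal
  subsequence. For two late members \<open>L2_estimate\<close> is then applied with
  \<open>\<delta>\<close> small, next \<open>N\<close> large, and finally the finitely many cell
  differences small.\<close>

lemma rellich:
  fixes \<phi> :: "nat \<Rightarrow> real^3 \<Rightarrow> real"
  assumes \<phi>: "\<And>n. C1_S2 (\<phi> n)" and K: "\<And>n. w12_sq (\<phi> n) \<le> K"
  shows "\<exists>d::nat \<Rightarrow> nat. strict_mono d \<and> (\<forall>e>0. \<exists>M. \<forall>k\<ge>M. \<forall>l\<ge>M. (\<integral>x. (\<phi> (d k) x - \<phi> (d l) x)\<^sup>2 \<partial>dvg) < e)"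
proof -
  \<comment> \<open>The triples \<open>(N, i, j)\<close> are coded by one natural number for the
    diagonal argument; codes without a cell give the constant 0.\<close>
  define g where "g k n = (case prod_decode k of (N, m) \<Rightarrow> case prod_decode m of (i, j) \<Rightarrow>
     if i < N \<and> j < N then cell N i j (\<phi> n) else 0)" for k n
  have "\<exists>B. \<forall>n. \<bar>g k n\<bar> \<le> B" for k
  proof -
    obtain N m where k: "prod_decode k = (N, m)" by force
    obtain i j where m: "prod_decode m = (i, j)" by force
    have gk: "g k n = (if i < N \<and> j < N then cell N i j (\<phi> n) else 0)" for n by (simp add: g_def k m)
    show ?thesis
    proof (cases "i < N \<and> j < N")
      case True
      let ?B = "pi / real N * (2 * pi / real N) * (49 * K)"
      have "\<bar>cell N i j (\<phi> n)\<bar> \<le> sqrt ?B" for n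
      proof -
        have "(cell N i j (\<phi> n))\<^sup>2 \<le> pi / real N * (2 * pi / real N) * (49 * w12_sq (\<phi> n))"
          by (rule C1_pullback.cell_sq_le) (use True in \<open>auto intro: C1_pullback.intro \<phi>\<close>)
        also have "\<dots> \<le> ?B" using K[of n] by (intro mult_left_mono) auto
        finally show ?thesis using real_le_rsqrt by fastforce
      qed
      then show ?thesis using True by (auto simp: gk)
    qed (auto simp: gk)
  qed
  from diagonal_convergent[where g = g, OF this] obtain d where d: "strict_mono d" and conv: "\<And>k. convergent (\<lambda>n. g k (d n))"
    by blast
  have cells: "Cauchy (\<lambda>n. cell N i j (\<phi> (d n)))" if "i < N" "j < N" for N i j
    using conv[of "prod_encode (N, prod_encode (i, j))"] that by (simp add: g_def Cauchy_convergent_iff)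
  have key: "\<exists>M. \<forall>k\<ge>M. \<forall>l\<ge>M. (\<integral>x. (\<phi> (d k) x - \<phi> (d l) x)\<^sup>2 \<partial>dvg) < e" if e: "0 < e" for e
  proof -
    have K0: "0 \<le> K"
      using K[of 0] C1_pullback.II_bounds(4)[OF C1_pullback.intro[OF \<phi>]] by (rule order_trans[rotated])
    \<comment> \<open>As \<open>w12_sq\<close> of a difference is at most \<open>4 * K\<close>, the
      first term becomes at most \<open>e / 8\<close>; \<open>K + 1\<close> keeps the denominator
      positive for \<open>K = 0\<close>.\<close>
    define \<delta> where "\<delta> = e / (800 * (K + 1))"
    have \<delta>: "0 < \<delta>" using e K0 by (simp add: \<delta>_def)
    \<comment> \<open>For \<open>e / 8\<close> the second term needs only
      \<open>32000 * (K + 1) / (\<delta> * e)\<close>.\<close>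
    obtain N :: nat where N: "40000 * (K + 1) / (\<delta> * e) < real N" using reals_Archimedean2 by blast
    have "0 < 40000 * (K + 1) / (\<delta> * e)" using e K0 \<delta> by simp
    then have N0: "0 < real N" using N by linarith
    then have N1: "0 < N" by simp
    define C where "C = 1 / (pi / real N * (2 * pi / real N)) / (2 * \<delta>)"
    have C0: "0 < C" using N0 \<delta> by (simp add: C_def)
    \<comment> \<open>Chosen so that \<open>C * (real N)\<^sup>2 * \<xi>\<^sup>2 = e / 4\<close>;
      the three terms then add up to at most \<open>e / 2\<close>.\<close>
    define \<xi> where "\<xi> = sqrt (e / (4 * C * (real N)\<^sup>2))"
    have \<xi>: "0 < \<xi>" using e C0 N0 by (simp add: \<xi>_def)
    have "\<exists>M. \<forall>k\<ge>M. \<forall>l\<ge>M. \<bar>cell N i j (\<phi> (d k)) - cell N i j (\<phi> (d l))\<bar> < \<xi>" if "i < N" "j < N" for i j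
      using CauchyD[OF cells[OF that] \<xi>] by simp
    then obtain M where M: "\<And>i j k l. i < N \<Longrightarrow> j < N \<Longrightarrow> k \<ge> M i j \<Longrightarrow> l \<ge> M i j \<Longrightarrow>
        \<bar>cell N i j (\<phi> (d k)) - cell N i j (\<phi> (d l))\<bar> < \<xi>" by metis
    \<comment> \<open>A sum of natural numbers serves as a common upper bound of the
      thresholds.\<close>
    define M' where "M' = (\<Sum>i<N. \<Sum>j<N. M i j)"
    have M': "M i j \<le> M'" if "i < N" "j < N" for i j
    proof -
      have "M i j \<le> (\<Sum>j<N. M i j)" using that by (intro member_le_sum) auto
      also have "\<dots> \<le> M'" unfolding M'_def using that by (intro member_le_sum[of i "{..<N}" "\<lambda>i. \<Sum>j<N. M i j"]) auto
      finally show ?thesis .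
    qed
    have "(\<integral>x. (\<phi> (d k) x - \<phi> (d l) x)\<^sup>2 \<partial>dvg) < e" if kl: "k \<ge> M'" "l \<ge> M'" for k l
    proof -
      let ?f = "\<lambda>x. \<phi> (d k) x - \<phi> (d l) x"
      have F: "C1_S2 ?f" by (rule C1_S2_diff(1)[OF \<phi> \<phi>])
      note P = C1_pullback.intro[OF F]
      have W: "w12_sq ?f \<le> 4 * K" using w12_sq_diff_le[OF \<phi> \<phi>, of "d k" "d l"] K[of "d k"] K[of "d l"] by linarith
      have W0: "0 \<le> w12_sq ?f" by (rule C1_pullback.II_bounds(4)[OF P])
      have est: "(\<integral>x. (?f x)\<^sup>2 \<partial>dvg) \<le> 25 * \<delta> * w12_sq ?f + 1000 / (\<delta> * (real N)\<^sup>2) * w12_sq ?f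
        + (\<Sum>i<N. \<Sum>j<N. (cell N i j ?f)\<^sup>2) / (pi / real N * (2 * pi / real N)) / (2 * \<delta>)"
        by (rule C1_pullback.L2_estimate[OF P N1 \<delta>])
      have "25 * \<delta> * w12_sq ?f \<le> 25 * \<delta> * (4 * (K + 1))" using W \<delta> by (intro mult_left_mono) auto
      also have "\<dots> = e / 8" using K0 by (simp add: \<delta>_def field_simps)
      finally have t1: "25 * \<delta> * w12_sq ?f \<le> e / 8" .
      have "1000 / (\<delta> * (real N)\<^sup>2) * w12_sq ?f \<le> 1000 / (\<delta> * real N) * (4 * (K + 1))"
      proof (rule mult_mono)
        have "real N * 1 \<le> real N * real N" using N1 by (intro mult_left_mono) auto
        then have "\<delta> * real N \<le> \<delta> * (real N)\<^sup>2" using \<delta> by (simp add: power2_eq_square)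
        then show "1000 / (\<delta> * (real N)\<^sup>2) \<le> 1000 / (\<delta> * real N)"
          using \<delta> N0 by (intro divide_left_mono) auto
      qed (use W W0 \<delta> N0 in auto)
      also have "\<dots> \<le> e / 8"
        using N \<delta> e N0 K0 by (simp add: field_simps)
      finally have t2: "1000 / (\<delta> * (real N)\<^sup>2) * w12_sq ?f \<le> e / 8" .
      have "(\<Sum>i<N. \<Sum>j<N. (cell N i j ?f)\<^sup>2) \<le> (\<Sum>i<N. \<Sum>j<N. \<xi>\<^sup>2)"
      proof (intro sum_mono)
        fix i j assume "i \<in> {..<N}" "j \<in> {..<N}"
        then have ij: "i < N" "j < N" by auto
        have "cell N i j ?f = cell N i j (\<phi> (d k)) - cell N i j (\<phi> (d l))"
          by (rule cell_diff[OF C1_S2_continuous[OF \<phi>] C1_S2_continuous[OF \<phi>]])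
        then have "\<bar>cell N i j ?f\<bar> \<le> \<xi>"
          using M[OF ij, of k l] M'[OF ij] kl by simp
        then show "(cell N i j ?f)\<^sup>2 \<le> \<xi>\<^sup>2" using abs_le_square_iff[of "cell N i j ?f" \<xi>] \<xi> by simp
      qed
      also have "\<dots> = (real N)\<^sup>2 * \<xi>\<^sup>2" by (simp add: power2_eq_square)
      finally have "C * (\<Sum>i<N. \<Sum>j<N. (cell N i j ?f)\<^sup>2) \<le> C * ((real N)\<^sup>2 * \<xi>\<^sup>2)"
        using C0 by (intro mult_left_mono) auto
      also have "\<dots> = e / 4" using C0 N0 e by (simp add: \<xi>_def field_simps)
      finally have t3: "C * (\<Sum>i<N. \<Sum>j<N. (cell N i j ?f)\<^sup>2) \<le> e / 4" .
      have "(\<Sum>i<N. \<Sum>j<N. (cell N i j ?f)\<^sup>2) / (pi / real N * (2 * pi / real N)) / (2 * \<delta>) = C * (\<Sum>i<N. \<Sum>j<N. (cell N i j ?f)\<^sup>2)"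
        by (simp add: C_def)
      then show ?thesis using est t1 t2 t3 e by linarith
    qed
    then show ?thesis by (intro exI[of _ M'] allI impI)
  qed
  show ?thesis by (intro exI[of _ d] conjI d allI impI key)
qed

section \<open>Compactness of the embedding into L2 of the measure\<close>

lemma integrable_square_diff:
  fixes f g :: "real^3 \<Rightarrow> real"
  assumes "f \<in> borel_measurable dvg" "g \<in> borel_measurable dvg" "integrable dvg (\<lambda>x. (f x)\<^sup>2)" "integrable dvg (\<lambda>x. (g x)\<^sup>2)"
  shows "integrable dvg (\<lambda>x. (f x - g x)\<^sup>2)"
proof (rule Bochner_Integration.integrable_bound)
  show "integrable dvg (\<lambda>x. 2 * (f x)\<^sup>2 + 2 * (g x)\<^sup>2)" using assms by auto
  show "AE x in dvg. norm ((f x - g x)\<^sup>2) \<le> norm (2 * (f x)\<^sup>2 + 2 * (g x)\<^sup>2)"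
    by (intro AE_I2) (simp add: square_diff_le)
  show "(\<lambda>x. (f x - g x)\<^sup>2) \<in> borel_measurable dvg" using assms(1,2) by simp
qed

lemma integral_square_diff_le:
  fixes f g :: "real^3 \<Rightarrow> real"
  assumes "f \<in> borel_measurable dvg" "g \<in> borel_measurable dvg" "integrable dvg (\<lambda>x. (f x)\<^sup>2)" "integrable dvg (\<lambda>x. (g x)\<^sup>2)"
  shows "(\<integral>x. (f x - g x)\<^sup>2 \<partial>dvg) \<le> 2 * (\<integral>x. (f x)\<^sup>2 \<partial>dvg) + 2 * (\<integral>x. (g x)\<^sup>2 \<partial>dvg)"
proof -
  have "(\<integral>x. (f x - g x)\<^sup>2 \<partial>dvg) \<le> (\<integral>x. 2 * (f x)\<^sup>2 + 2 * (g x)\<^sup>2 \<partial>dvg)"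
    using assms by (intro integral_mono Bochner_Integration.integrable_add integrable_mult_right integrable_square_diff square_diff_le)
  also have "\<dots> = 2 * (\<integral>x. (f x)\<^sup>2 \<partial>dvg) + 2 * (\<integral>x. (g x)\<^sup>2 \<partial>dvg)"
    using assms by simp
  finally show ?thesis .
qed

text \<open>The approximant must stay bounded in the \<open>W12\<close> norm, not only be close to
  \<open>u\<close>. Errors below 1 for the function and for the gradient give
  \<open>2 * (1 + 1) + 2 * C\<close>.\<close>

lemma W12_grad_approx:
  assumes "W12_grad u V" "W12_norm_sq u V \<le> C" "0 < \<delta>"
  shows "\<exists>\<phi>. C1_S2 \<phi> \<and> w12_sq \<phi> \<le> 4 + 2 * C \<and> (\<integral>x. (\<phi> x - u x)\<^sup>2 \<partial>dvg) < \<delta>"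
proof -
  have u: "u \<in> borel_measurable dvg" "integrable dvg (\<lambda>x. (u x)\<^sup>2)"
    and V: "V \<in> borel_measurable dvg" "integrable dvg (\<lambda>x. (gnorm (V x))\<^sup>2)"
    using assms(1) by (auto simp: W12_grad_def L2_def)
  obtain \<phi> :: "nat \<Rightarrow> real^3 \<Rightarrow> real" where sm: "\<And>n. smooth_S2 (\<phi> n)"
    and lim: "(\<lambda>n. \<integral>x. (\<phi> n x - u x)\<^sup>2 \<partial>dvg) \<longlonglongrightarrow> 0" "(\<lambda>n. \<integral>x. (gnorm (grad_S2 (\<phi> n) x - V x))\<^sup>2 \<partial>dvg) \<longlonglongrightarrow> 0"
    using assms(1) unfolding W12_grad_def by blast
  have "\<forall>\<^sub>F n in sequentially. (\<integral>x. (\<phi> n x - u x)\<^sup>2 \<partial>dvg) < min \<delta> 1"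
    using lim(1) assms(3) by (intro order_tendstoD(2)) auto
  moreover have "\<forall>\<^sub>F n in sequentially. (\<integral>x. (gnorm (grad_S2 (\<phi> n) x - V x))\<^sup>2 \<partial>dvg) < 1"
    using lim(2) by (intro order_tendstoD(2)) auto
  ultimately have "\<forall>\<^sub>F n in sequentially. (\<integral>x. (\<phi> n x - u x)\<^sup>2 \<partial>dvg) < min \<delta> 1 \<and> (\<integral>x. (gnorm (grad_S2 (\<phi> n) x - V x))\<^sup>2 \<partial>dvg) < 1"
    by (rule eventually_conj)
  then obtain n where n: "(\<integral>x. (\<phi> n x - u x)\<^sup>2 \<partial>dvg) < min \<delta> 1" "(\<integral>x. (gnorm (grad_S2 (\<phi> n) x - V x))\<^sup>2 \<partial>dvg) < 1"
    using eventually_happens'[OF sequentially_bot] by blast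
  define f where "f = \<phi> n"
  have f: "C1_S2 f" unfolding f_def by (rule smooth_S2_C1[OF sm])
  have fm: "f \<in> borel_measurable dvg" and f2: "integrable dvg (\<lambda>x. (f x)\<^sup>2)"
    by (rule borel_measurable_dvg[OF C1_S2_continuous[OF f]], intro dvg_integral_vec(1) continuous_intros C1_S2_continuous[OF f])
  have du: "(\<integral>x. (f x - u x)\<^sup>2 \<partial>dvg) < \<delta>" "(\<integral>x. (f x - u x)\<^sup>2 \<partial>dvg) < 1" using n(1) by (auto simp: f_def)
  have gm: "grad_S2 f \<in> borel_measurable dvg" by (rule borel_measurable_dvg[OF continuous_on_grad[OF f]])
  have g2: "integrable dvg (\<lambda>x. (gnorm (grad_S2 f x))\<^sup>2)"
    unfolding gnorm_sq by (intro dvg_integral_vec(1) continuous_intros continuous_on_grad[OF f]) simp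
  have A: "(\<integral>x. (f x)\<^sup>2 \<partial>dvg) \<le> 2 * (\<integral>x. (f x - u x)\<^sup>2 \<partial>dvg) + 2 * (\<integral>x. (u x)\<^sup>2 \<partial>dvg)"
  proof -
    have um: "(\<lambda>x. - u x) \<in> borel_measurable dvg" using u(1) by simp
    have dm: "(\<lambda>x. f x - u x) \<in> borel_measurable dvg" using fm u(1) by simp
    have "(\<integral>x. ((f x - u x) - (- u x))\<^sup>2 \<partial>dvg) \<le> 2 * (\<integral>x. (f x - u x)\<^sup>2 \<partial>dvg) + 2 * (\<integral>x. (- u x)\<^sup>2 \<partial>dvg)"
      by (rule integral_square_diff_le[OF dm um]) (use integrable_square_diff[OF fm u(1) f2 u(2)] u(2) in auto)
    then show ?thesis by simp
  qed
  have B: "(\<integral>x. (gnorm (grad_S2 f x))\<^sup>2 \<partial>dvg) \<le> 2 * (\<integral>x. (gnorm (grad_S2 f x - V x))\<^sup>2 \<partial>dvg) + 2 * (\<integral>x. (gnorm (V x))\<^sup>2 \<partial>dvg)"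
  proof -
    have i: "integrable dvg (\<lambda>x. (gnorm (grad_S2 f x - V x))\<^sup>2)"
    proof (rule Bochner_Integration.integrable_bound)
      show "integrable dvg (\<lambda>x. 2 * (gnorm (grad_S2 f x))\<^sup>2 + 2 * (gnorm (V x))\<^sup>2)" using g2 V by auto
      show "AE x in dvg. norm ((gnorm (grad_S2 f x - V x))\<^sup>2) \<le> norm (2 * (gnorm (grad_S2 f x))\<^sup>2 + 2 * (gnorm (V x))\<^sup>2)"
        by (intro AE_I2) (simp add: gnorm_diff_sq_le)
      show "(\<lambda>x. (gnorm (grad_S2 f x - V x))\<^sup>2) \<in> borel_measurable dvg"
        unfolding gnorm_sq using gm V(1) by simp
    qed
    have pt: "(gnorm (grad_S2 f x))\<^sup>2 \<le> 2 * (gnorm (grad_S2 f x - V x))\<^sup>2 + 2 * (gnorm (V x))\<^sup>2" for x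
      using gnorm_diff_sq_le[of "grad_S2 f x - V x" "- V x"] by (simp add: gnorm_sq)
    have "(\<integral>x. (gnorm (grad_S2 f x))\<^sup>2 \<partial>dvg) \<le> (\<integral>x. 2 * (gnorm (grad_S2 f x - V x))\<^sup>2 + 2 * (gnorm (V x))\<^sup>2 \<partial>dvg)"
      by (intro integral_mono g2 pt Bochner_Integration.integrable_add integrable_mult_right i V(2))
    also have "\<dots> = 2 * (\<integral>x. (gnorm (grad_S2 f x - V x))\<^sup>2 \<partial>dvg) + 2 * (\<integral>x. (gnorm (V x))\<^sup>2 \<partial>dvg)"
      using i V(2) by simp
    finally show ?thesis .
  qed
  have "w12_sq f \<le> 4 + 2 * C"
    using A B du(2) n(2) assms(2) unfolding w12_sq_def W12_norm_sq_def f_def by simp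
  then show ?thesis using f du by blast
qed

text \<open>For fixed \<open>\<epsilon>\<close> the density is bounded, so functions in L2 of the
  area measure are in L2 of \<open>mu \<epsilon>\<close> and the identity on representatives is the
  required extension. A bounded sequence is replaced by \<open>C1_S2\<close> functions at distance
  tending to 0, to which \<open>rellich\<close> applies; the bounded density transfers the Cauchy
  property.\<close>

lemma admissible_mu:
  assumes \<epsilon>: "0 < \<epsilon>"
  shows "admissible (mu \<epsilon>)"
  unfolding admissible_def
proof (intro conjI exI[of _ "\<lambda>u. u"])
  interpret mu: prob_space "mu \<epsilon>" by (rule prob_space_mu[OF \<epsilon>])
  show "radon_S2 (mu \<epsilon>)" unfolding radon_S2_def using mu.finite_measure_axioms by simp
  show "emeasure (mu \<epsilon>) S2 \<noteq> 0" using mu.emeasure_space_1 by simp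
  show "\<forall>\<phi>. smooth_S2 \<phi> \<longrightarrow> (AE x in mu \<epsilon>. \<phi> x = \<phi> x)" by simp
  have meas: "f \<in> borel_measurable (mu \<epsilon>) \<longleftrightarrow> f \<in> borel_measurable dvg" for f :: "real^3 \<Rightarrow> real"
    by (rule arg_cong[where f = "\<lambda>A. f \<in> A"], rule measurable_cong_sets) auto
  show "compact_operator_W12_L2 (mu \<epsilon>) (\<lambda>u. u)"
    unfolding compact_operator_W12_L2_def
  proof (intro conjI ballI allI impI)
    fix u assume "u \<in> W12"
    then have "u \<in> borel_measurable dvg" "integrable dvg (\<lambda>x. (u x)\<^sup>2)"
      by (auto simp: W12_def W12_grad_def L2_def)
    then show "u \<in> L2 (mu \<epsilon>)" using integrable_mu_dvg(1)[OF \<epsilon>] by (auto simp: L2_def meas)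
  next
    fix u :: "nat \<Rightarrow> real^3 \<Rightarrow> real" and V C
    assume "\<forall>n. W12_grad (u n) (V n) \<and> W12_norm_sq (u n) (V n) \<le> C"
    then have uV: "\<And>n. W12_grad (u n) (V n)" "\<And>n. W12_norm_sq (u n) (V n) \<le> C" by auto
    have um: "\<And>n. u n \<in> borel_measurable dvg" and u2: "\<And>n. integrable dvg (\<lambda>x. (u n x)\<^sup>2)"
      using uV(1) by (auto simp: W12_grad_def L2_def)
    have "\<exists>\<phi>. \<forall>n. C1_S2 (\<phi> n) \<and> w12_sq (\<phi> n) \<le> 4 + 2 * C \<and> (\<integral>x. (\<phi> n x - u n x)\<^sup>2 \<partial>dvg) < 1 / real (Suc n)"
    proof (intro choice allI)
      show "\<exists>\<phi>. C1_S2 \<phi> \<and> w12_sq \<phi> \<le> 4 + 2 * C \<and> (\<integral>x. (\<phi> x - u n x)\<^sup>2 \<partial>dvg) < 1 / real (Suc n)" for n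
        by (rule W12_grad_approx[OF uV(1)[of n] uV(2)[of n]]) simp
    qed
    then obtain \<phi> where \<phi>: "\<And>n. C1_S2 (\<phi> n)" "\<And>n. w12_sq (\<phi> n) \<le> 4 + 2 * C"
      and close: "\<And>n. (\<integral>x. (\<phi> n x - u n x)\<^sup>2 \<partial>dvg) < 1 / real (Suc n)" by blast
    obtain d :: "nat \<Rightarrow> nat" where d: "strict_mono d"
      and dC: "\<forall>e>0. \<exists>M. \<forall>k\<ge>M. \<forall>l\<ge>M. (\<integral>x. (\<phi> (d k) x - \<phi> (d l) x)\<^sup>2 \<partial>dvg) < e"
      using rellich[where \<phi> = \<phi>, OF \<phi>] by (elim exE conjE)
    have \<phi>m: "\<phi> n \<in> borel_measurable dvg" and \<phi>2: "integrable dvg (\<lambda>x. (\<phi> n x)\<^sup>2)" for n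
      by (rule borel_measurable_dvg[OF C1_S2_continuous[OF \<phi>(1)]], intro dvg_integral_vec(1) continuous_intros C1_S2_continuous[OF \<phi>(1)])
    let ?B = "1 + \<epsilon> / 2 / dens_e \<epsilon>"
    have B: "1 \<le> ?B" using \<epsilon> dens_e_pos[of \<epsilon>] by simp
    have "\<exists>r w. strict_mono r \<and> w \<in> borel_measurable (mu \<epsilon>) \<and> integrable (mu \<epsilon>) (\<lambda>x. (w x)\<^sup>2) \<and>
      (\<lambda>n. \<integral>x. (u (d (r n)) x - w x)\<^sup>2 \<partial>mu \<epsilon>) \<longlonglongrightarrow> 0"
    proof (rule mu.L2_Cauchy_converges[where u = "\<lambda>n. u (d n)"])
      show "u (d n) \<in> borel_measurable (mu \<epsilon>)" "integrable (mu \<epsilon>) (\<lambda>x. (u (d n) x)\<^sup>2)" for n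
        using um u2 integrable_mu_dvg(1)[OF \<epsilon>] by (auto simp: meas)
      fix e :: real assume e: "0 < e"
      \<comment> \<open>Splitting the difference into three costs a factor
        \<open>2 + 2 * (2 + 2) = 10\<close>, and 16 leaves room for strictness.\<close>
      define e' where "e' = e / (16 * ?B)"
      have e': "0 < e'" using e B by (simp add: e'_def)
      obtain M where M: "\<And>k l. k \<ge> M \<Longrightarrow> l \<ge> M \<Longrightarrow> (\<integral>x. (\<phi> (d k) x - \<phi> (d l) x)\<^sup>2 \<partial>dvg) < e'"
        using dC e' by metis
      obtain M1 :: nat where M1: "1 / e' < real M1" using reals_Archimedean2 by blast
      have small: "(\<integral>x. (\<phi> (d k) x - u (d k) x)\<^sup>2 \<partial>dvg) < e'" if "k \<ge> M1" for k
      proof -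
        have "k \<le> d k" by (rule seq_suble[OF d])
        then have "real M1 \<le> real (Suc (d k))" using that by simp
        then have "1 / e' < real (Suc (d k))" using M1 by linarith
        then have "1 / real (Suc (d k)) < e'" using e' by (simp add: field_simps)
        then show ?thesis using close[of "d k"] by linarith
      qed
      have "(\<integral>x. (u (d k) x - u (d l) x)\<^sup>2 \<partial>mu \<epsilon>) < e" if k: "k \<ge> max M M1" and l: "l \<ge> max M M1" for k l
      proof -
        let ?p = "\<lambda>x. \<phi> (d k) x - \<phi> (d l) x" and ?a = "\<lambda>x. \<phi> (d k) x - u (d k) x" and ?b = "\<lambda>x. \<phi> (d l) x - u (d l) x"
        have m: "?p \<in> borel_measurable dvg" "?a \<in> borel_measurable dvg" "?b \<in> borel_measurable dvg"
          using \<phi>m um by auto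
        have i: "integrable dvg (\<lambda>x. (?p x)\<^sup>2)" "integrable dvg (\<lambda>x. (?a x)\<^sup>2)" "integrable dvg (\<lambda>x. (?b x)\<^sup>2)"
          by (intro integrable_square_diff \<phi>m um \<phi>2 u2)+
        have mab: "(\<lambda>x. ?a x - ?b x) \<in> borel_measurable dvg" using m by simp
        have iab: "integrable dvg (\<lambda>x. (?a x - ?b x)\<^sup>2)" by (rule integrable_square_diff[OF m(2,3) i(2,3)])
        have iu: "integrable dvg (\<lambda>x. (u (d k) x - u (d l) x)\<^sup>2)" by (intro integrable_square_diff um u2)
        have "(\<integral>x. (u (d k) x - u (d l) x)\<^sup>2 \<partial>dvg) = (\<integral>x. (?p x - (?a x - ?b x))\<^sup>2 \<partial>dvg)" by simp
        also have "\<dots> \<le> 2 * (\<integral>x. (?p x)\<^sup>2 \<partial>dvg) + 2 * (\<integral>x. (?a x - ?b x)\<^sup>2 \<partial>dvg)"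
          by (rule integral_square_diff_le[OF m(1) mab i(1) iab])
        finally have "(\<integral>x. (u (d k) x - u (d l) x)\<^sup>2 \<partial>dvg) < 10 * e'"
          using integral_square_diff_le[OF m(2,3) i(2,3)] M[of k l] small[of k] small[of l] k l by simp
        moreover have "(\<integral>x. (u (d k) x - u (d l) x)\<^sup>2 \<partial>mu \<epsilon>) \<le> ?B * (\<integral>x. (u (d k) x - u (d l) x)\<^sup>2 \<partial>dvg)"
          using integrable_mu_dvg(3)[OF \<epsilon> iu] by simp
        moreover have "?B * (\<integral>x. (u (d k) x - u (d l) x)\<^sup>2 \<partial>dvg) \<le> ?B * (10 * e')"
          using calculation(1) B by (intro mult_left_mono) auto
        moreover have "?B * (10 * e') < e"
        proof -
          have "X * (10 * (e / (16 * X))) < e" if "1 \<le> X" for X :: real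
            using that e by (simp add: field_simps)
          from this[OF B] show ?thesis unfolding e'_def .
        qed
        ultimately show ?thesis by linarith
      qed
      then show "\<exists>N. \<forall>i\<ge>N. \<forall>j\<ge>N. (\<integral>x. (u (d i) x - u (d j) x)\<^sup>2 \<partial>mu \<epsilon>) < e" by blast
    qed
    then obtain r w where r: "strict_mono r" and w: "w \<in> borel_measurable (mu \<epsilon>)" "integrable (mu \<epsilon>) (\<lambda>x. (w x)\<^sup>2)"
      and lim: "(\<lambda>n. \<integral>x. (u (d (r n)) x - w x)\<^sup>2 \<partial>mu \<epsilon>) \<longlonglongrightarrow> 0" by blast
    show "\<exists>r w. strict_mono r \<and> w \<in> L2 (mu \<epsilon>) \<and> (\<lambda>n. \<integral>x. (u (r n) x - w x)\<^sup>2 \<partial>mu \<epsilon>) \<longlonglongrightarrow> 0"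
      using strict_mono_o[OF d r] w lim by (intro exI[of _ "d \<circ> r"] exI[of _ w]) (simp add: L2_def)
  qed simp
qed

theorem theorem7p5:
  shows "\<exists>(\<mu> :: real \<Rightarrow> (real^3) measure) (L :: real \<Rightarrow> (real^3 \<Rightarrow> real) \<Rightarrow> real).
           (\<forall>\<epsilon>>0. admissible (\<mu> \<epsilon>) \<and> balanced (\<mu> \<epsilon>) \<and> prob_space (\<mu> \<epsilon>)) \<and>
           ((\<lambda>\<epsilon>. lambda1 (\<mu> \<epsilon>)) \<longlongrightarrow> ereal (8 * pi)) (at_right 0) \<and>
           (\<forall>\<epsilon>>0. represents_diff (L \<epsilon>) (\<mu> \<epsilon>) dvg) \<and>
           Liminf (at_right 0) (\<lambda>\<epsilon>. dual_norm (L \<epsilon>)) > 0"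
  using admissible_mu balanced_mu prob_space_mu lambda1_tendsto represents_mu_diff Liminf_dual_norm
  by (intro exI[of _ mu] exI[of _ mu_diff]) blast

end
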